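(* Let $1<p<2$ and let $q\ge p$ satisfy $\frac1p+\frac1q>1$. Let $\omega:\mathbb{R}^+\to\mathbb{R}$, $A:\mathbb{R}^+\to\mathbb{R}^{d\times d}$ and $C:\mathbb{R}^+\to\mathbb{R}^{d\times d}$ be such that for every $T>0$ one has $\omega\in\mathcal{C}^{p\text{-var}}([0,T],\mathbb{R})$, $A\in C([0,T],\mathbb{R}^{d\times d})$ and $C\in\mathcal{C}^{q\text{-var}}([0,T],\mathbb{R}^{d\times d})$, and let $F:\mathbb{R}^+\times\mathbb{R}^d\to\mathbb{R}^d$. Consider the Young differential equation $$dx(t)=[A(t)x(t)+F(t,x(t))]\,dt+C(t)x(t)\,d\omega(t),\qquad x(0)=x_0\in\mathbb{R}^d,\quad t\ge 0. \qquad (\ast)$$ Assume the following. 1. There is a function $h:\mathbb{R}^+\to\mathbb{R}^+$ such that $\langle x,A(t)x\rangle\le -h(t)\|x\|^2$ for all $x\in\mathbb{R}^d$ and $t\in\mathbb{R}^+$. 2. $F(t,0)=0$ for all $t\in\mathbb{R}^+$, and there is a positive continuous function $f:\mathbb{R}^+\to\mathbb{R}^+$ such that $\|F(t,x)-F(t,y)\|\le f(t)\|x-y\|$ for all $x,y\in\mathbb{R}^d$ and $t\in\mathbb{R}^+$. 3. With $\Delta_k:=[k,k+1]$, $$\hat A:=\varlimsup_{m\to\infty}\Big(\frac1{m+1}\sum_{k=0}^m\big(\|A\|_{\infty,\Delta_k}+\|f\|_{\infty,\Delta_k}\big)^{4p}\Big)^{\frac1{4p}}<\infty,$$ $$\hat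 C:=\varlimsup_{m\to\infty}\Big(\frac1{m+1}\sum_{k=0}^m\|C\|_{q\text{-var},\Delta_k}^{2p+2}\Big)^{\frac1{2p+2}}<\infty,\qquad \Gamma(\omega,2p+2)<\infty,$$ where, for $r>0$, $$\Gamma(\omega,r):=\varlimsup_{m\to\infty}\Big(\frac1{m+1}\sum_{k=0}^m |||\omega|||_{p\text{-var},\Delta_k}^{r}\Big)^{\frac1r}.$$ Suppose further that $$\liminf_{t\to\infty}\frac1t\int_0^t[h(s)-f(s)]\,ds\ \ge\ h_0>0 .$$ If $$h_0>K\big(1+4\hat G\big)\hat C\Big[\Gamma(\omega,2)+\Gamma(\omega,4)^2+\Gamma(\omega,2p+2)^{p+1}\Big],$$ where $$K:=(1-2^{1-\theta})^{-1},\quad \theta:=\frac1p+\frac1q,\qquad \hat G:=\max\big\{8\hat A,\ 16K\hat C,\ 8^p\hat A^p,\ 16^pK^p\hat C^p\big\},$$ then the zero solution of $(\ast)$ is exponentially stable.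
   Context: Notation. $\mathbb{R}^+=[0,\infty)$; $\|\cdot\|$ is the Euclidean norm on $\mathbb{R}^d$ (and the induced operator norm on matrices). For a function $x$ on $[a,b]$: $\|x\|_{\infty,[a,b]}=\sup_{t\in[a,b]}\|x(t)\|$; for $p\ge1$, $$|||x|||_{p\text{-var},[a,b]}=\Big(\sup\sum_{i}\|x(t_{i+1})-x(t_i)\|^p\Big)^{1/p},$$ the supremum being over all finite partitions $\{t_i\}$ of $[a,b]$; $\|x\|_{p\text{-var},[a,b]}=\|x(a)\|+|||x|||_{p\text{-var},[a,b]}$. $C([a,b],E)$ is the space of continuous $E$-valued paths and $\mathcal{C}^{p\text{-var}}([a,b],E)$ is the space of continuous paths $x:[a,b]\to E$ with $|||x|||_{p\text{-var},[a,b]}<\infty$. Young integral. For $x\in\mathcal{C}^{q\text{-var}}([a,b],\cdot)$ and $\omega\in\mathcal{C}^{p\text{-var}}([a,b],\mathbb{R})$ with $\frac1p+\frac1q>1$, $\int_a^b x(s)\,d\omega(s)$ is the limit of the sums $\sum_{[u,v]\in\Pi}x(u)(\omega(v)-\omega(u))$ over finite partitions $\Pi$ of $[a,b]$ as the mesh $|\Pi|\to0$. A solution of $(\ast)$ is a function $x:\mathbb{R}^+\to\mathbb{R}^d$ belonging to $\mathcal{C}^{q\text{-var}}([0,T],\mathbb{R}^d)$ for every $T>0$ and satisfying $x(t)=x_0+\int_0^t[A(s)x(s)+F(s,x(s))]ds+\int_0^tC(s)x(s)\,d\omega(s)$ for all $t\ge0$, the last integral being a Young integral. The integrals with respect to $ds$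 appearing in the statement are understood to be well defined. Stability. A solution $\mu$ of $(\ast)$ is stable if for every $\varepsilon>0$ there is $r>0$ such that every solution $x$ with $\|x(0)-\mu(0)\|<r$ satisfies $\sup_{t\ge0}\|x(t)-\mu(t)\|<\varepsilon$. It is exponentially stable if it is stable and there is $r>0$ such that every solution $x$ with $\|x(0)-\mu(0)\|<r$ satisfies $\varlimsup_{t\to\infty}\frac1t\log\|x(t)-\mu(t)\|<0$ (with $\log0=-\infty$). *)

theory Defs
  imports "HOL-Analysis.Analysis"
begin

section \<open>Finite partitions, variation and supremum norms\<close>

definition partition_of :: "real \<Rightarrow> real \<Rightarrow> nat \<Rightarrow> (nat \<Rightarrow> real) \<Rightarrow> bool" where
  "partition_of a b n t \<longleftrightarrow> t 0 = a \<and> t n = b \<and> (\<forall>i<n. t i < t (Suc i))"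

definition pvar_sums :: "real \<Rightarrow> (real \<Rightarrow> 'a::real_normed_vector) \<Rightarrow> real \<Rightarrow> real \<Rightarrow> real set" where
  "pvar_sums p x a b =
     {\<Sum>i<n. norm (x (t (Suc i)) - x (t i)) powr p | n t. partition_of a b n t}"

text \<open>The supremum is taken in the reals, so \<open>pvar_seminorm\<close> and \<open>pvar_norm\<close> are meaningful
  for paths whose variation sums are bounded above, which is part of \<open>in_Cpvar\<close>.\<close>

definition pvar_seminorm :: "real \<Rightarrow> (real \<Rightarrow> 'a::real_normed_vector) \<Rightarrow> real \<Rightarrow> real \<Rightarrow> real" where
  "pvar_seminorm p x a b = (Sup (pvar_sums p x a b)) powr (1 / p)"

definition pvar_norm :: "real \<Rightarrow> (real \<Rightarrow> 'a::real_normed_vector) \<Rightarrow> real \<Rightarrow> real \<Rightarrow> real" where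
  "pvar_norm p x a b = norm (x a) + pvar_seminorm p x a b"

definition in_Cpvar :: "real \<Rightarrow> (real \<Rightarrow> 'a::real_normed_vector) \<Rightarrow> real \<Rightarrow> real \<Rightarrow> bool" where
  "in_Cpvar p x a b \<longleftrightarrow> continuous_on {a..b} x \<and> bdd_above (pvar_sums p x a b)"

definition sup_norm :: "(real \<Rightarrow> 'a::real_normed_vector) \<Rightarrow> real \<Rightarrow> real \<Rightarrow> real" where
  "sup_norm x a b = (SUP t\<in>{a..b}. norm (x t))"

text \<open>The type-class norm of \<open>real^'d^'d\<close> is the Frobenius norm. Viewing a matrix as a bounded
  linear operator makes \<open>norm\<close> the operator norm induced by the Euclidean norm.\<close>

definition mat_op :: "real^'d^'d \<Rightarrow> (real^'d) \<Rightarrow>\<^sub>L (real^'d)" where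
  "mat_op M = Blinfun (\<lambda>x. M *v x)"

lemma blinfun_apply_mat_op: "blinfun_apply (mat_op M) x = M *v x"
  by (simp add: mat_op_def bounded_linear_Blinfun_apply)

lemma norm_mat_op: "norm (mat_op M) = onorm (\<lambda>x. M *v x)"
  by (simp add: norm_blinfun.rep_eq blinfun_apply_mat_op [abs_def])

section \<open>Young integral and Young differential equation\<close>

definition has_young_integral ::
  "(real \<Rightarrow> 'a::real_normed_vector) \<Rightarrow> (real \<Rightarrow> real) \<Rightarrow> real \<Rightarrow> real \<Rightarrow> 'a \<Rightarrow> bool" where
  "has_young_integral x \<omega> a b I \<longleftrightarrow>
     (\<forall>\<epsilon>>0. \<exists>\<delta>>0. \<forall>n t. partition_of a b n t \<longrightarrow> (\<forall>i<n. t (Suc i) - t i < \<delta>) \<longrightarrow>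
        norm ((\<Sum>i<n. (\<omega> (t (Suc i)) - \<omega> (t i)) *\<^sub>R x (t i)) - I) < \<epsilon>)"

text \<open>Paths on the half-line are total functions on the reals of which only the values at
  nonnegative times matter. Being a solution includes the existence of both integrals.\<close>

definition yde_solution ::
  "real \<Rightarrow> (real \<Rightarrow> real) \<Rightarrow> (real \<Rightarrow> real^'d^'d) \<Rightarrow> (real \<Rightarrow> real^'d^'d)
   \<Rightarrow> (real \<Rightarrow> real^'d \<Rightarrow> real^'d) \<Rightarrow> real^'d \<Rightarrow> (real \<Rightarrow> real^'d) \<Rightarrow> bool" where
  "yde_solution q \<omega> A C F x0 x \<longleftrightarrow>
     (\<forall>T>0. in_Cpvar q x 0 T) \<and>
     (\<forall>t\<ge>0. \<exists>I J. ((\<lambda>s. A s *v x s + F s (x s)) has_integral I) {0..t} \<and>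
                 has_young_integral (\<lambda>s. C s *v x s) \<omega> 0 t J \<and>
                 x t = x0 + I + J)"

section \<open>Stability\<close>

definition ereal_log :: "real \<Rightarrow> ereal" where
  "ereal_log r = (if r = 0 then -\<infinity> else ereal (ln r))"

text \<open>\<open>S\<close> is the set of all solutions of the equation, for all initial values.\<close>

definition stable_sol :: "(real \<Rightarrow> 'a::real_normed_vector) set \<Rightarrow> (real \<Rightarrow> 'a) \<Rightarrow> bool" where
  "stable_sol S \<mu> \<longleftrightarrow> \<mu> \<in> S \<and>
     (\<forall>\<epsilon>>0. \<exists>r>0. \<forall>x\<in>S. norm (x 0 - \<mu> 0) < r \<longrightarrow>
        (SUP t\<in>{0..}. ereal (norm (x t - \<mu> t))) < ereal \<epsilon>)"

definition exp_stable_sol :: "(real \<Rightarrow> 'a::real_normed_vector) set \<Rightarrow> (real \<Rightarrow> 'a) \<Rightarrow> bool" where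
  "exp_stable_sol S \<mu> \<longleftrightarrow> stable_sol S \<mu> \<and>
     (\<exists>r>0. \<forall>x\<in>S. norm (x 0 - \<mu> 0) < r \<longrightarrow>
        Limsup at_top (\<lambda>t. ereal (1 / t) * ereal_log (norm (x t - \<mu> t))) < 0)"

section \<open>Asymptotic power means\<close>

definition limsup_mean :: "real \<Rightarrow> (nat \<Rightarrow> real) \<Rightarrow> ereal" where
  "limsup_mean r a = limsup (\<lambda>m. ereal ((1 / (real m + 1) * (\<Sum>k\<le>m. a k powr r)) powr (1 / r)))"

text \<open>By monotonicity of power means, \<open>Gam p \<omega> r\<close> is finite as soon as \<open>Gam p \<omega> r'\<close> is for some
  \<open>r' \<ge> r > 0\<close>; being nonnegative, it is then recovered from \<open>real_of_ereal\<close>.\<close>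

definition Gam :: "real \<Rightarrow> (real \<Rightarrow> real) \<Rightarrow> real \<Rightarrow> ereal" where
  "Gam p \<omega> r = limsup_mean r (\<lambda>k. pvar_seminorm p \<omega> (real k) (real k + 1))"

end

theory Submission
  imports Defs
begin

text \<open>
  Neither a change of variables nor integrals along the normalised path \<open>y = x / \<parallel>x\<parallel>\<close> are needed:
  everything is read off the increments of a solution. Removing one point at a time from a partition
  bounds Riemann sums of Young integrals by the constant \<open>K\<close>, since
  \<open>\<Sum>j. j powr - \<theta> \<le> K\<close>. On an interval where
  \<open>8 a (t - s) + 16 K c W\<close> is at most 1, with \<open>a\<close>, \<open>c\<close> bounds of the coefficients and \<open>W\<close> the
  \<open>p\<close>-variation of the driver, the \<open>q\<close>-variation of \<open>x\<close> is at most a small multiple of the minimum of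
  \<open>\<parallel>x\<parallel>\<close>. Hence a solution that vanishes somewhere vanishes identically, and otherwise \<open>y\<close> has small
  variation on such intervals; counting them bounds the variation of \<open>y\<close> on unit intervals.
  Summing \<open>ln (\<parallel>x v\<parallel> / \<parallel>x u\<parallel>) \<le> x u \<bullet> (x v - x u) / \<parallel>x u\<parallel>\<^sup>2 + \<parallel>x v - x u\<parallel>\<^sup>2 / (2 \<parallel>x u\<parallel>\<^sup>2)\<close>
  over finer and finer partitions leaves the integral of \<open>f - h\<close> and Riemann sums of
  \<open>y \<bullet> C y\<close> against the driver. The bounds of the latter on unit intervals are averaged with
  the Cauchy--Schwarz inequality and the monotonicity of power means.
\<close>

section \<open>Superadditive interval functions\<close>

text \<open>The exponent \<open>q\<close> may exceed 2, so finite \<open>q\<close>-variation of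
  \<open>x\<close> alone does not make the sum of the squared increments small along fine
  partitions. The increments of a solution are better than that: they are at most a constant times
  \<open>(v - u) + W u v\<close>, and \<open>p < 2\<close> then sends the quadratic terms to 0.
  Bounds of this shape also explain \<open>supadd\<close>: \<open>g\<close> is a root of a
  superadditive function, so it can be compared directly with increments, can be added by
  Minkowski's inequality, and turns a bound on single increments into a bound on the variation.
  Raising the exponent puts the driver on the scale \<open>q\<close> of the path.

  Only an upper bound of the logarithm is wanted, and the Young estimate is uniform over partitions;
  hence no integral of \<open>growth\<close> against the driver is ever formed. Division by
  \<open>norm (x t)\<close> is the other obstacle: it is removed by running the local estimate
  backwards in time.\<close>

definition supadd :: "real \<Rightarrow> (real \<Rightarrow> real \<Rightarrow> real) \<Rightarrow> real \<Rightarrow> real \<Rightarrow> bool" where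
  "supadd r g a b \<longleftrightarrow>
     (\<forall>u v. a \<le> u \<longrightarrow> u \<le> v \<longrightarrow> v \<le> b \<longrightarrow> 0 \<le> g u v) \<and>
     (\<forall>u v w. a \<le> u \<longrightarrow> u \<le> v \<longrightarrow> v \<le> w \<longrightarrow> w \<le> b \<longrightarrow>
        g u v powr r + g v w powr r \<le> g u w powr r)"

lemma supaddD:
  assumes "supadd r g a b"
  shows "\<And>u v. \<lbrakk>a \<le> u; u \<le> v; v \<le> b\<rbrakk> \<Longrightarrow> 0 \<le> g u v"
    and "\<And>u v w. \<lbrakk>a \<le> u; u \<le> v; v \<le> w; w \<le> b\<rbrakk> \<Longrightarrow> g u v powr r + g v w powr r \<le> g u w powr r"
  using assms by (auto simp: supadd_def)

lemma supaddI:
  assumes "\<And>u v. \<lbrakk>a \<le> u; u \<le> v; v \<le> b\<rbrakk> \<Longrightarrow> 0 \<le> g u v"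
    and "\<And>u v w. \<lbrakk>a \<le> u; u \<le> v; v \<le> w; w \<le> b\<rbrakk> \<Longrightarrow> g u v powr r + g v w powr r \<le> g u w powr r"
  shows "supadd r g a b"
  using assms by (auto simp: supadd_def)

section \<open>Real powers, Minkowski's inequality and closure properties of
  \<open>supadd\<close>\<close>

lemma powr_le_powr_iff:
  fixes x y r :: real
  assumes "0 < r" "0 \<le> x" "0 \<le> y"
  shows "x powr r \<le> y powr r \<longleftrightarrow> x \<le> y"
  using assms by (meson not_le powr_less_mono2 powr_mono2 less_imp_le)

text \<open>Convexity of the \<open>q\<close>-th power at \<open>a / l\<close> and
  \<open>b / (1 - l)\<close>. The weight stays free: \<open>minkowski_two\<close> takes it
  proportional to the totals, \<open>y_variation\<close> takes one half.\<close>

lemma convex_powr_split: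
  fixes a b l q :: real
  assumes l: "0 < l" "l < 1" and q: "1 \<le> q" and a: "0 \<le> a" and b: "0 \<le> b"
  shows "(a + b) powr q \<le> l powr (1 - q) * a powr q + (1 - l) powr (1 - q) * b powr q"
proof -
  have e: "m * (c / m) powr q = m powr (1 - q) * c powr q" if "0 < m" for m c :: real
    using that by (simp add: powr_divide powr_diff field_simps)
  have one: "1 \<le> m powr (1 - q)" if "0 < m" "m < 1" for m :: real
    using powr_mono'[of "1 - q" 0 m] that q by simp
  show ?thesis
  proof (cases "a = 0 \<or> b = 0")
    case True
    then show ?thesis using mult_right_mono[OF one[of l], of "a powr q"]
        mult_right_mono[OF one[of "1 - l"], of "b powr q"] l q by auto
  next
    case False
    with a b have ab: "a > 0" "b > 0" by auto
    have "((1 - l) *\<^sub>R (b / (1 - l)) + l *\<^sub>R (a / l)) powr q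
        \<le> (1 - l) * (b / (1 - l)) powr q + l * (a / l) powr q"
      using convex_onD[OF powr_convex[OF q], of l "b / (1 - l)" "a / l"] l ab by simp
    then show ?thesis using l by (simp add: e add.commute)
  qed
qed

text \<open>With \<open>l = A / (A + B)\<close> the prefactors turn \<open>A powr q\<close> and
  \<open>B powr q\<close> into \<open>A\<close> and \<open>B\<close> times
  \<open>(A + B) powr (q - 1)\<close>, which add up exactly. The cases \<open>A = 0\<close> and
  \<open>B = 0\<close> stand apart because \<open>l\<close> must lie strictly between 0 and
  1.\<close>

lemma minkowski_two:
  fixes a1 a2 b1 b2 A B q :: real
  assumes q: "1 \<le> q" and nn: "0 \<le> a1" "0 \<le> a2" "0 \<le> b1" "0 \<le> b2" "0 \<le> A" "0 \<le> B"
    and a: "a1 powr q + a2 powr q \<le> A powr q" and b: "b1 powr q + b2 powr q \<le> B powr q"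
  shows "(a1 + b1) powr q + (a2 + b2) powr q \<le> (A + B) powr q"
proof -
  have z: "x = 0 \<and> y = 0" if "x powr q + y powr q \<le> 0" for x y :: real
  proof -
    have "x powr q = 0 \<and> y powr q = 0"
      using that powr_ge_zero[of x q] powr_ge_zero[of y q] by linarith
    then show ?thesis by simp
  qed
  consider "A = 0" | "B = 0" | "A > 0" "B > 0" using nn by linarith
  then show ?thesis
  proof cases
    case 1 then show ?thesis using z[of a1 a2] a b q by simp
  next
    case 2 then show ?thesis using z[of b1 b2] a b q by simp
  next
    case 3
    define l where "l = A / (A + B)"
    have l: "0 < l" "l < 1" "1 - l = B / (A + B)" using 3 by (auto simp: l_def field_simps)
    have e: "(c / (A + B)) powr (1 - q) * c powr q = (A + B) powr (q - 1) * c" if "c > 0" for c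
      using that 3 powr_add[of c "1 - q" q] powr_minus_divide[of "A + B" "q - 1"]
      by (simp add: powr_divide)
    have s: "(a1 + b1) powr q + (a2 + b2) powr q
       \<le> l powr (1 - q) * (a1 powr q + a2 powr q) + (1 - l) powr (1 - q) * (b1 powr q + b2 powr q)"
      using convex_powr_split[OF l(1,2) q nn(1,3)] convex_powr_split[OF l(1,2) q nn(2,4)]
      by (simp add: algebra_simps)
    also have "\<dots> \<le> l powr (1 - q) * A powr q + (1 - l) powr (1 - q) * B powr q"
      using a b by (intro add_mono mult_left_mono) auto
    also have "l powr (1 - q) * A powr q = (A + B) powr (q - 1) * A"
      by (simp add: l_def e 3)
    also have "(1 - l) powr (1 - q) * B powr q = (A + B) powr (q - 1) * B"
      by (simp add: l(3) e 3)
    also have "(A + B) powr (q - 1) * A + (A + B) powr (q - 1) * B = (A + B) powr q"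
      using 3 powr_add[of "A + B" "q - 1" 1] by (simp add: distrib_left)
    finally show ?thesis .
  qed
qed

lemma supadd_add:
  assumes "1 \<le> q" "supadd q g a b" "supadd q g' a b"
  shows "supadd q (\<lambda>u v. g u v + g' u v) a b"
  using assms by (auto simp: supadd_def intro!: minkowski_two)

lemma supadd_mult:
  assumes "0 \<le> c" "supadd q g a b"
  shows "supadd q (\<lambda>u v. c * g u v) a b"
proof (rule supaddI)
  fix u v w assume "a \<le> u" "u \<le> v" "v \<le> w" "w \<le> b"
  with supaddD[OF assms(2)]
  have "c powr q * (g u v powr q + g v w powr q) \<le> c powr q * g u w powr q"
    by (intro mult_left_mono) auto
  then show "(c * g u v) powr q + (c * g v w) powr q \<le> (c * g u w) powr q"
    by (simp add: powr_mult algebra_simps)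
qed (use assms supaddD[OF assms(2)] in auto)

text \<open>Divide by the total \<open>G\<close>: a share \<open>Z / G\<close> is at most 1, so
  raising it to the power \<open>q / p \<ge> 1\<close> can only shrink it, and the two shares add up
  to at most 1.\<close>

lemma supadd_exponent:
  assumes "0 < p" "p \<le> q" "supadd p g a b"
  shows "supadd q g a b"
proof (rule supaddI)
  fix u v w assume uvw: "a \<le> u" "u \<le> v" "v \<le> w" "w \<le> b"
  define G where "G = g u w powr p"
  define X where "X = g u v powr p" define Y where "Y = g v w powr p"
  have XY: "0 \<le> X" "0 \<le> Y" "X + Y \<le> G"
    using uvw supaddD(2)[OF assms(3), of u v w] by (auto simp: X_def Y_def G_def)
  have s: "1 \<le> q / p" using assms by simp
  have "X powr (q / p) + Y powr (q / p) \<le> G powr (q / p)"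
  proof (cases "G = 0")
    case True
    then have "X = 0 \<and> Y = 0" using XY by linarith
    then show ?thesis using assms by simp
  next
    case False
    then have G: "G > 0" using XY by linarith
    have st: "Z powr (q / p) \<le> Z / G * G powr (q / p)" if "0 \<le> Z" "Z \<le> G" for Z
    proof -
      have "(Z / G) powr (q / p) \<le> (Z / G) powr 1"
        using that G s by (intro powr_mono') auto
      then have "(Z / G) powr (q / p) * G powr (q / p) \<le> Z / G * G powr (q / p)"
        using that G by (intro mult_right_mono) auto
      then show ?thesis using G by (simp add: powr_divide)
    qed
    have "X powr (q / p) + Y powr (q / p) \<le> (X + Y) / G * G powr (q / p)"
      using st[of X] st[of Y] XY by (simp add: add_divide_distrib algebra_simps)
    also have "\<dots> \<le> 1 * G powr (q / p)"
      using XY G by (intro mult_right_mono) auto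
    finally show ?thesis by simp
  qed
  then show "g u v powr q + g v w powr q \<le> g u w powr q"
    using assms by (simp add: X_def Y_def G_def powr_powr)
qed (use supaddD[OF assms(3)] in auto)

lemma supadd_length:
  assumes "1 \<le> q"
  shows "supadd q (\<lambda>u v. v - u) a b"
proof (rule supadd_exponent[of 1])
  show "supadd 1 (\<lambda>u v. v - u) a b" by (auto intro!: supaddI)
qed (use assms in auto)

lemma supadd_mono:
  assumes "0 < q" "supadd q g a b" "a \<le> u" "u \<le> u'" "u' \<le> v'" "v' \<le> v" "v \<le> b"
  shows "g u' v' \<le> g u v"
proof -
  have "g u' v' powr q \<le> g u' v powr q"
    using supaddD(2)[OF assms(2), of u' v' v] assms(3-) powr_ge_zero[of "g v' v" q] by linarith
  also have "\<dots> \<le> g u v powr q"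
    using supaddD(2)[OF assms(2), of u u' v] assms(3-) powr_ge_zero[of "g u u'" q] by linarith
  finally show ?thesis
    using powr_le_powr_iff[of q "g u' v'" "g u v"] supaddD(1)[OF assms(2)] assms(1,3-) by simp
qed

lemma supadd_sum_mono:
  assumes "supadd q g a b" "a \<le> s 0" "\<And>i. i < n \<Longrightarrow> s i \<le> s (Suc i)" "s n \<le> b"
  shows "s 0 \<le> s n \<and> (\<Sum>i<n. g (s i) (s (Suc i)) powr q) \<le> g (s 0) (s n) powr q"
  using assms(3,4)
proof (induction n)
  case 0
  then show ?case by simp
next
  case (Suc n)
  then have le: "s n \<le> s (Suc n)" by simp
  then have IH: "s 0 \<le> s n" "(\<Sum>i<n. g (s i) (s (Suc i)) powr q) \<le> g (s 0) (s n) powr q"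
    using Suc.IH Suc.prems by (force intro: order_trans[OF le])+
  show ?case
    using IH le supaddD(2)[OF assms(1,2) IH(1) le Suc.prems(2)] by auto
qed

section \<open>Partitions and variation\<close>

lemma partition_of_step:
  assumes "partition_of a b n t" shows "i < n \<Longrightarrow> t i < t (Suc i)" "t 0 = a" "t n = b"
  using assms by (auto simp: partition_of_def)

lemma partition_of_mono:
  assumes "partition_of a b n t" "i \<le> j" "j \<le> n"
  shows "t i \<le> t j"
  using assms(2,3)
proof (induction j rule: dec_induct)
  case (step k)
  then show ?case using partition_of_step(1)[OF assms(1), of k] by force
qed auto

lemma partition_of_bounds:
  assumes "partition_of a b n t" "i \<le> n"
  shows "a \<le> t i" "t i \<le> b"
  using partition_of_mono[OF assms(1), of 0 i] partition_of_mono[OF assms(1), of i n] assms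
  by (auto simp: partition_of_def)

lemma partition_of_le: "partition_of a b n t \<Longrightarrow> a \<le> b"
  using partition_of_bounds[of a b n t 0] by (auto simp: partition_of_def)

text \<open>Partition steps are strict, so a one-point interval has the partition with
  \<open>n = 0\<close>. By \<open>n \<le> 1\<close> the only possible piece is the whole interval,
  which is what \<open>partition_good\<close> exploits.\<close>

lemma partition_of_trivial: 
  assumes "a \<le> b" obtains n t where "partition_of a b n t" "n \<le> 1"
proof (cases "a = b")
  case True
  then show ?thesis using that[of 0 "\<lambda>_. a"] by (auto simp: partition_of_def)
next
  case False
  then show ?thesis using that[of 1 "\<lambda>i. if i = 0 then a else b"] assms by (auto simp: partition_of_def)
qed

text \<open>Both endpoints of each step are recorded, so that sums over increments split at
  \<open>n\<close> and the junction \<open>b\<close> never needs separate treatment.\<close>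

lemma partition_of_concat:
  assumes s: "partition_of a b n s" and t: "partition_of b c m t"
  obtains r where "partition_of a c (n + m) r"
    "\<And>i. i < n \<Longrightarrow> r i = s i \<and> r (Suc i) = s (Suc i)"
    "\<And>i. i < m \<Longrightarrow> r (n + i) = t i \<and> r (Suc (n + i)) = t (Suc i)"
proof -
  define r where "r i = (if i < n then s i else t (i - n))" for i
  have 1: "r i = s i \<and> r (Suc i) = s (Suc i)" if "i < n" for i
    using that s t by (cases "Suc i = n") (auto simp: r_def partition_of_def)
  have 2: "r (n + i) = t i \<and> r (Suc (n + i)) = t (Suc i)" if "i < m" for i
    using that by (auto simp: r_def Suc_diff_le)
  have "r i < r (Suc i)" if "i < n + m" for i
    using 1[of i] 2[of "i - n"] that partition_of_step(1)[OF s, of i]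
      partition_of_step(1)[OF t, of "i - n"] by (cases "i < n") auto
  moreover have "r 0 = a" "r (n + m) = c"
    using s t by (auto simp: r_def partition_of_def)
  ultimately have "partition_of a c (n + m) r" by (auto simp: partition_of_def)
  then show ?thesis using that 1 2 by blast
qed

lemma sum_lessThan_add:
  fixes g :: "nat \<Rightarrow> 'a::comm_monoid_add"
  shows "(\<Sum>i<n + m. g i) = (\<Sum>i<n. g i) + (\<Sum>i<m. g (n + i))"
  by (induction m) (auto simp: add.assoc)

lemma pvar_sums_cases:
  assumes "S \<in> pvar_sums p x a b"
  obtains n t where "partition_of a b n t" "S = (\<Sum>i<n. norm (x (t (Suc i)) - x (t i)) powr p)"
  using assms by (auto simp: pvar_sums_def)

lemma pvar_sums_concat:
  assumes "S \<in> pvar_sums p x a b" "T \<in> pvar_sums p x b c"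
  shows "S + T \<in> pvar_sums p x a c"
proof -
  obtain n s where s: "partition_of a b n s" "S = (\<Sum>i<n. norm (x (s (Suc i)) - x (s i)) powr p)"
    using assms(1) by (rule pvar_sums_cases)
  obtain m t where t: "partition_of b c m t" "T = (\<Sum>i<m. norm (x (t (Suc i)) - x (t i)) powr p)"
    using assms(2) by (rule pvar_sums_cases)
  obtain r where r: "partition_of a c (n + m) r"
    "\<And>i. i < n \<Longrightarrow> r i = s i \<and> r (Suc i) = s (Suc i)"
    "\<And>i. i < m \<Longrightarrow> r (n + i) = t i \<and> r (Suc (n + i)) = t (Suc i)"
    using partition_of_concat[OF s(1) t(1)] by blast
  have "S + T = (\<Sum>i<n + m. norm (x (r (Suc i)) - x (r i)) powr p)"
    by (simp add: s t r sum_lessThan_add)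
  with r(1) show ?thesis by (auto simp: pvar_sums_def)
qed

lemma pvar_sums_nonempty: "a \<le> b \<Longrightarrow> pvar_sums p x a b \<noteq> {}"
  by (metis (mono_tags, lifting) empty_iff mem_Collect_eq partition_of_trivial pvar_sums_def)

lemma pvar_sums_nonneg: "S \<in> pvar_sums p x a b \<Longrightarrow> 0 \<le> S"
  by (auto simp: pvar_sums_def intro!: sum_nonneg)

lemma bdd_pvar_subinterval:
  assumes "bdd_above (pvar_sums p x a b)" "a \<le> u" "u \<le> v" "v \<le> b"
  shows "bdd_above (pvar_sums p x u v)"
proof -
  obtain M where M: "\<And>S. S \<in> pvar_sums p x a b \<Longrightarrow> S \<le> M"
    using assms(1) by (auto simp: bdd_above_def)
  obtain P Q where "P \<in> pvar_sums p x a u" "Q \<in> pvar_sums p x v b"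
    using pvar_sums_nonempty assms by (metis all_not_in_conv)
  then have "S \<le> M" if "S \<in> pvar_sums p x u v" for S
    using M[of "P + S + Q"] pvar_sums_concat[of P p x a u] pvar_sums_concat[of "P + S" p x a v Q b]
      pvar_sums_nonneg[of P p x a u] pvar_sums_nonneg[of Q p x v b] that by force
  then show ?thesis by (auto simp: bdd_above_def)
qed

lemma pvar_seminorm_nonneg [simp]: "0 \<le> pvar_seminorm p x a b"
  by (simp add: pvar_seminorm_def)

lemma Sup_pvar_sums_nonneg:
  "bdd_above (pvar_sums p x a b) \<Longrightarrow> a \<le> b \<Longrightarrow> 0 \<le> Sup (pvar_sums p x a b)"
  by (metis all_not_in_conv cSup_upper order_trans pvar_sums_nonempty pvar_sums_nonneg)

lemma pvar_seminorm_powr: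
  assumes "0 < p" "bdd_above (pvar_sums p x a b)" "a \<le> b"
  shows "pvar_seminorm p x a b powr p = Sup (pvar_sums p x a b)"
  using assms Sup_pvar_sums_nonneg[of p x a b] by (simp add: pvar_seminorm_def powr_powr)

lemma supadd_pvar:
  assumes "0 < p" and bdd: "bdd_above (pvar_sums p x a b)"
  shows "supadd p (pvar_seminorm p x) a b"
proof (rule supaddI)
  fix u v w assume h: "a \<le> u" "u \<le> v" "v \<le> w" "w \<le> b"
  let ?S = "\<lambda>u v. Sup (pvar_sums p x u v)"
  have b: "bdd_above (pvar_sums p x u v)" "bdd_above (pvar_sums p x v w)" "bdd_above (pvar_sums p x u w)"
    using h by (auto intro!: bdd_pvar_subinterval[OF bdd])
  have "S \<le> ?S u w - T" if "S \<in> pvar_sums p x u v" "T \<in> pvar_sums p x v w" for S T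
    using cSup_upper[OF pvar_sums_concat[OF that] b(3)] by simp
  then have "?S u v \<le> ?S u w - T" if "T \<in> pvar_sums p x v w" for T
    using that pvar_sums_nonempty[of u v p x] h by (intro cSup_least) auto
  then have "T \<le> ?S u w - ?S u v" if "T \<in> pvar_sums p x v w" for T
    using that by force
  then have "?S v w \<le> ?S u w - ?S u v"
    using pvar_sums_nonempty[of v w p x] h by (intro cSup_least) auto
  then show "pvar_seminorm p x u v powr p + pvar_seminorm p x v w powr p \<le> pvar_seminorm p x u w powr p"
    using assms(1) b h by (simp add: pvar_seminorm_powr)
qed simp

lemma norm_diff_le_pvar:
  assumes "0 < p" and bdd: "bdd_above (pvar_sums p x a b)" and uv: "a \<le> u" "u \<le> v" "v \<le> b"
  shows "norm (x v - x u) \<le> pvar_seminorm p x u v"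
proof (cases "u = v")
  case False
  have "partition_of u v 1 (\<lambda>i. if i = 0 then u else v)" using False uv by (auto simp: partition_of_def)
  then have "norm (x v - x u) powr p \<in> pvar_sums p x u v"
    by (force simp: pvar_sums_def)
  then have "norm (x v - x u) powr p \<le> pvar_seminorm p x u v powr p"
    using bdd_pvar_subinterval[OF bdd uv] uv assms(1) by (simp add: pvar_seminorm_powr cSup_upper)
  then show ?thesis using assms(1) by (simp add: powr_le_powr_iff)
qed simp

text \<open>Along a partition the powers of the increments are dominated by those of
  \<open>g\<close>, which collapse by superadditivity. This is the usual route to a variation bound
  below: dominate one increment by a \<open>supadd\<close> expression.\<close>

lemma pvar_le_supadd:
  assumes p: "0 < p" and g: "supadd p g a b" and "a \<le> b"
    and le: "\<And>u v. \<lbrakk>a \<le> u; u \<le> v; v \<le> b\<rbrakk> \<Longrightarrow> norm (x v - x u) \<le> g u v"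
  shows "bdd_above (pvar_sums p x a b)" "pvar_seminorm p x a b \<le> g a b"
proof -
  have *: "S \<le> g a b powr p" if "S \<in> pvar_sums p x a b" for S
  proof -
    from that obtain n t where t: "partition_of a b n t"
      "S = (\<Sum>i<n. norm (x (t (Suc i)) - x (t i)) powr p)" by (rule pvar_sums_cases)
    have "S \<le> (\<Sum>i<n. g (t i) (t (Suc i)) powr p)"
      unfolding t(2) using p partition_of_bounds[OF t(1)] partition_of_step[OF t(1)]
      by (intro sum_mono powr_mono2 le) (auto simp: less_imp_le Suc_leI)
    also have "\<dots> \<le> g (t 0) (t n) powr p"
      using supadd_sum_mono[OF g, of t n] partition_of_step[OF t(1)] by (simp add: less_imp_le)
    finally show ?thesis using partition_of_step[OF t(1)] by simp
  qed
  then show b: "bdd_above (pvar_sums p x a b)" by (auto simp: bdd_above_def)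
  have "pvar_seminorm p x a b powr p \<le> g a b powr p"
    using * pvar_sums_nonempty[OF \<open>a \<le> b\<close>] b p \<open>a \<le> b\<close>
    by (auto simp: pvar_seminorm_powr intro!: cSup_least)
  then show "pvar_seminorm p x a b \<le> g a b"
    using p supaddD(1)[OF g] \<open>a \<le> b\<close> by (simp add: powr_le_powr_iff)
qed

lemma pvar_sum_le:
  assumes "0 < p" "bdd_above (pvar_sums p x a b)" "partition_of a b n t"
  shows "(\<Sum>i<n. norm (x (t (Suc i)) - x (t i)) powr p) \<le> pvar_seminorm p x a b powr p"
proof -
  have "(\<Sum>i<n. norm (x (t (Suc i)) - x (t i)) powr p) \<in> pvar_sums p x a b"
    using assms(3) by (auto simp: pvar_sums_def)
  then show ?thesis
    using assms partition_of_le[OF assms(3)] by (simp add: pvar_seminorm_powr cSup_upper)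
qed

text \<open>Clamping the endpoints to the two sides of \<open>b\<close> writes any increment as one
  left of \<open>b\<close> plus one right of \<open>b\<close>. The clamped seminorms remain
  superadditive, so Minkowski's inequality replaces a discussion of the partition interval that
  straddles \<open>b\<close>.\<close>

lemma pvar_subadd:
  assumes q: "1 \<le> q" and bdd: "bdd_above (pvar_sums q x a c)" and abc: "a \<le> b" "b \<le> c"
  shows "pvar_seminorm q x a c \<le> pvar_seminorm q x a b + pvar_seminorm q x b c"
proof -
  let ?V = "pvar_seminorm q x"
  have sa: "supadd q ?V a c" using supadd_pvar[OF _ bdd] q by simp
  have g: "supadd q (\<lambda>u v. ?V (min u b) (min v b) + ?V (max u b) (max v b)) a c"
  proof (rule supadd_add[OF q])
    show "supadd q (\<lambda>u v. ?V (min u b) (min v b)) a c"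
      using abc by (intro supaddI supaddD(2)[OF sa]) auto
    show "supadd q (\<lambda>u v. ?V (max u b) (max v b)) a c"
      using abc by (intro supaddI supaddD(2)[OF sa]) auto
  qed
  have "norm (x v - x u) \<le> ?V (min u b) (min v b) + ?V (max u b) (max v b)"
    if "a \<le> u" "u \<le> v" "v \<le> c" for u v
  proof -
    have "x v - x u = (x (min v b) - x (min u b)) + (x (max v b) - x (max u b))"
      using that by (auto simp: min_def max_def)
    also have "norm \<dots> \<le> norm (x (min v b) - x (min u b)) + norm (x (max v b) - x (max u b))"
      by (rule norm_triangle_ineq)
    also have "\<dots> \<le> ?V (min u b) (min v b) + ?V (max u b) (max v b)"
      using that abc q by (intro add_mono norm_diff_le_pvar[OF _ bdd]) auto
    finally show ?thesis .
  qed
  from pvar_le_supadd(2)[OF _ g _ this] show ?thesis using q abc by simp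
qed

section \<open>The Young--Loeve estimate for Riemann sums\<close>

text \<open>Comparing the terms \<open>2 * k\<close> and \<open>2 * k + 1\<close> with the term
  \<open>k\<close> gives \<open>?H (2 * n + 1) \<le> 1 + 2 powr (1 - \<theta>) * ?H n\<close>, and
  \<open>?H n \<le> ?H (2 * n + 1)\<close> closes this into an inequality for \<open>?H n\<close>
  alone. This is how the geometric constant of the theorem arises from a zeta-type sum.\<close>

lemma sum_powr_minus_le:
  fixes \<theta> :: real
  assumes "1 < \<theta>"
  shows "(\<Sum>j=1..n. real j powr - \<theta>) \<le> inverse (1 - 2 powr (1 - \<theta>))"
proof -
  let ?H = "\<lambda>n. \<Sum>j=1..n. real j powr - \<theta>"
  have step: "?H (2 * n + 1) \<le> 1 + 2 powr (1 - \<theta>) * ?H n" for n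
  proof (induction n)
    case (Suc n)
    have le: "real (2 * n + 3) powr - \<theta> \<le> real (2 * n + 2) powr - \<theta>"
      using assms by (intro powr_mono2') auto
    have "real (2 * n + 2) powr - \<theta> = (2 * real (Suc n)) powr - \<theta>" by (simp add: algebra_simps)
    also have "\<dots> = 2 powr - \<theta> * real (Suc n) powr - \<theta>" by (simp only: powr_mult)
    also have "2 powr - \<theta> = 2 powr (1 - \<theta>) / 2" by (simp add: powr_diff powr_minus field_simps)
    finally have "real (2 * n + 2) powr - \<theta> + real (2 * n + 3) powr - \<theta>
        \<le> 2 powr (1 - \<theta>) * real (Suc n) powr - \<theta>"
      using le by simp
    moreover have "?H (2 * Suc n + 1) = ?H (2 * n + 1) + (real (2 * n + 2) powr - \<theta> + real (2 * n + 3) powr - \<theta>)"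
    proof -
      have "2 * Suc n + 1 = Suc (Suc (2 * n + 1))" by simp
      then show ?thesis by (simp add: numeral_eq_Suc)
    qed
    moreover have "?H (Suc n) = ?H n + real (Suc n) powr - \<theta>" by simp
    ultimately show ?case using Suc.IH by (simp add: distrib_left)
  qed simp
  have "?H n \<le> ?H (2 * n + 1)" by (intro sum_mono2) auto
  with step[of n] have "?H n * (1 - 2 powr (1 - \<theta>)) \<le> 1" by (simp add: algebra_simps)
  moreover have "2 powr (1 - \<theta>) < 2 powr 0" using assms by (intro powr_less_mono) auto
  ultimately show ?thesis by (simp add: field_simps)
qed

text \<open>An averaged Hoelder inequality. If every product were larger, its normalised power
  \<open>1 / \<theta>\<close> would exceed \<open>1 / card I\<close>, while Young's inequality with
  the weights \<open>\<kappa>\<close> and \<open>\<mu>\<close> splits it into \<open>q\<close>-th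
  and \<open>p\<close>-th powers whose normalised sums are at most 1; summing over \<open>I\<close>
  gives 1 < 1. Strictness also makes \<open>X\<close> and \<open>W\<close> positive, so that they
  may be divided by.\<close>

lemma exists_small_product:
  fixes a b :: "'i \<Rightarrow> real" and p q X W :: real
  assumes I: "finite I" "I \<noteq> {}" and p: "0 < p" and q: "0 < q"
    and nn: "\<And>i. i \<in> I \<Longrightarrow> 0 \<le> a i" "\<And>i. i \<in> I \<Longrightarrow> 0 \<le> b i" "0 \<le> X" "0 \<le> W"
    and aX: "(\<Sum>i\<in>I. a i powr q) \<le> X powr q" and bW: "(\<Sum>i\<in>I. b i powr p) \<le> W powr p"
  shows "\<exists>i\<in>I. a i * b i \<le> real (card I) powr - (1 / p + 1 / q) * (X * W)"
proof (rule ccontr)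
  define \<theta> where "\<theta> = 1 / p + 1 / q"
  have \<theta>: "\<theta> > 0" using p q by (simp add: \<theta>_def add_pos_pos)
  assume "\<not> ?thesis"
  then have big: "a i * b i > real (card I) powr - \<theta> * (X * W)" if "i \<in> I" for i
    using that by (auto simp: \<theta>_def not_le)
  have aX': "a i \<le> X" if "i \<in> I" for i
  proof -
    have "a i powr q \<le> X powr q"
      using aX member_le_sum[OF that, of "\<lambda>i. a i powr q"] I by force
    then show ?thesis using powr_le_powr_iff[of q "a i" X] q nn that by simp
  qed
  have bW': "b i \<le> W" if "i \<in> I" for i
  proof -
    have "b i powr p \<le> W powr p"
      using bW member_le_sum[OF that, of "\<lambda>i. b i powr p"] I by force
    then show ?thesis using powr_le_powr_iff[of p "b i" W] p nn that by simp
  qed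
  have pos: "a i > 0 \<and> b i > 0" if "i \<in> I" for i
  proof -
    have "0 \<le> real (card I) powr - \<theta> * (X * W)" using nn by simp
    then have "a i * b i > 0" using big[OF that] by linarith
    then show ?thesis using nn(1,2)[OF that] by (auto simp: zero_less_mult_iff)
  qed
  obtain i0 where "i0 \<in> I" using I by auto
  then have X: "X > 0" and W: "W > 0" using pos aX' bW' by (meson less_le_trans)+
  have n: "card I > 0" using I by (simp add: card_gt_0_iff)
  define \<kappa> where "\<kappa> = 1 / (q * \<theta>)" define \<mu> where "\<mu> = 1 / (p * \<theta>)"
  have "\<kappa> + \<mu> = (1 / p + 1 / q) / \<theta>" by (simp add: \<kappa>_def \<mu>_def add_divide_distrib)
  then have \<kappa>\<mu>: "0 \<le> \<kappa>" "0 \<le> \<mu>" "\<kappa> + \<mu> = 1"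
    using p q \<theta> by (auto simp: \<kappa>_def \<mu>_def \<theta>_def[symmetric])
  have e: "q * \<kappa> = 1 / \<theta>" "p * \<mu> = 1 / \<theta>" using p q by (auto simp: \<kappa>_def \<mu>_def)
  have each: "1 / real (card I) < \<kappa> * (a i powr q / X powr q) + \<mu> * (b i powr p / W powr p)"
    if i: "i \<in> I" for i
  proof -
    have "real (card I) powr - \<theta> < (a i / X) * (b i / W)"
      using big[OF i] X W by (simp add: field_simps)
    then have "(real (card I) powr - \<theta>) powr (1 / \<theta>) < ((a i / X) * (b i / W)) powr (1 / \<theta>)"
      using \<theta> by (intro powr_less_mono2) auto
    also have "(real (card I) powr - \<theta>) powr (1 / \<theta>) = 1 / real (card I)"
      using n \<theta> unfolding powr_powr by (simp add: powr_minus_divide)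
    also have "((a i / X) * (b i / W)) powr (1 / \<theta>) = ((a i / X) powr q) powr \<kappa> * ((b i / W) powr p) powr \<mu>"
      by (simp only: powr_powr e powr_mult)
    also have "\<dots> \<le> \<kappa> * (a i / X) powr q + \<mu> * (b i / W) powr p"
      using pos[OF i] X W by (intro Youngs_inequality_0 \<kappa>\<mu>) auto
    finally show ?thesis using pos[OF i] X W by (simp add: powr_divide)
  qed
  have "1 = (\<Sum>i\<in>I. 1 / real (card I))" using n by simp
  also have "\<dots> < (\<Sum>i\<in>I. \<kappa> * (a i powr q / X powr q) + \<mu> * (b i powr p / W powr p))"
    using each I by (intro sum_strict_mono) auto
  also have "\<dots> = \<kappa> * ((\<Sum>i\<in>I. a i powr q) / X powr q) + \<mu> * ((\<Sum>i\<in>I. b i powr p) / W powr p)"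
    by (simp add: sum.distrib sum_distrib_left sum_divide_distrib)
  also have "\<dots> \<le> \<kappa> * 1 + \<mu> * 1"
    using aX bW X W \<kappa>\<mu> by (intro add_mono mult_left_mono) auto
  finally show False using \<kappa>\<mu> by simp
qed

text \<open>Deleting an interior point changes the Riemann sum by the increment of \<open>x\<close>
  before it times the increment of \<open>\<omega>\<close> after it. Of \<open>j\<close> interior
  points the cheapest costs at most \<open>j powr - (1 / p + 1 / q)\<close> times the two
  variations; deletion goes on until the single step from \<open>a\<close> to \<open>b\<close> is
  left.\<close>

lemma young_sum_remove_points:
  fixes x :: "real \<Rightarrow> 'a::real_normed_vector" and \<omega> :: "real \<Rightarrow> real"
  assumes p: "0 < p" and q: "0 < q"
    and x: "bdd_above (pvar_sums q x a b)" and \<omega>: "bdd_above (pvar_sums p \<omega> a b)"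
    and t: "partition_of a b (Suc n) t"
  shows "norm ((\<Sum>i<Suc n. (\<omega> (t (Suc i)) - \<omega> (t i)) *\<^sub>R x (t i)) - (\<omega> b - \<omega> a) *\<^sub>R x a)
    \<le> (\<Sum>j=1..n. real j powr - (1 / p + 1 / q)) * (pvar_seminorm q x a b * pvar_seminorm p \<omega> a b)"
  using t
proof (induction n arbitrary: t)
  case 0
  then show ?case by (auto simp: partition_of_def)
next
  case (Suc n)
  let ?X = "pvar_seminorm q x a b" and ?W = "pvar_seminorm p \<omega> a b"
  let ?S = "\<lambda>m t. \<Sum>i<m. (\<omega> (t (Suc i)) - \<omega> (t i)) *\<^sub>R x (t i)"
  note st = partition_of_step[OF Suc.prems]
  \<comment> \<open>\<open>Suc (Suc n)\<close> steps have \<open>Suc n\<close> interior points. The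
    increments of \<open>x\<close> lose the last step and those of \<open>\<omega>\<close> the
    first, so that one index pairs the two sides of the same point.\<close>
  have "(\<Sum>i<Suc n. norm (x (t (Suc i)) - x (t i)) powr q) \<le> ?X powr q"
    using pvar_sum_le[OF q x Suc.prems] powr_ge_zero[of _ q] by (simp) (smt (verit) powr_ge_zero)
  moreover have "(\<Sum>i<Suc n. \<bar>\<omega> (t (Suc (Suc i))) - \<omega> (t (Suc i))\<bar> powr p) \<le> ?W powr p"
    using pvar_sum_le[OF p \<omega> Suc.prems] powr_ge_zero[of "\<bar>\<omega> (t (Suc 0)) - \<omega> (t 0)\<bar>" p]
    unfolding sum.lessThan_Suc_shift[of _ "Suc n"] real_norm_def by linarith
  ultimately have "\<exists>m\<in>{..<Suc n}. norm (x (t (Suc m)) - x (t m)) * \<bar>\<omega> (t (Suc (Suc m))) - \<omega> (t (Suc m))\<bar>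
     \<le> real (card {..<Suc n}) powr - (1 / p + 1 / q) * (?X * ?W)"
    using p q by (intro exists_small_product) auto
  then obtain m where m: "m < Suc n"
    "norm (x (t (Suc m)) - x (t m)) * \<bar>\<omega> (t (Suc (Suc m))) - \<omega> (t (Suc m))\<bar>
     \<le> real (Suc n) powr - (1 / p + 1 / q) * (?X * ?W)" by auto
  define t' where "t' j = (if j \<le> m then t j else t (Suc j))" for j
  have t': "partition_of a b (Suc n) t'"
    using st(1)[of m] st m(1) unfolding partition_of_def t'_def
    by (auto simp: not_less_eq_eq intro: less_trans)
  obtain r where r: "Suc n = m + Suc r" using m(1) by (metis less_iff_Suc_add add_Suc_right)
  let ?g = "\<lambda>t i. (\<omega> (t (Suc i)) - \<omega> (t i)) *\<^sub>R x (t i)"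
  have "?S (Suc (Suc n)) t = (\<Sum>i<m. ?g t i) + (\<Sum>i<Suc (Suc r). ?g t (m + i))"
    using sum_lessThan_add[of "?g t" m "Suc (Suc r)"] r by (simp del: sum.lessThan_Suc)
  also have "\<dots> = (\<Sum>i<m. ?g t i) + (?g t m + ?g t (Suc m) + (\<Sum>i<r. ?g t (m + Suc (Suc i))))"
    by (simp only: sum.lessThan_Suc_shift) (simp add: algebra_simps)
  finally have 1: "?S (Suc (Suc n)) t = \<dots>" .
  have "?S (Suc n) t' = (\<Sum>i<m. ?g t' i) + (\<Sum>i<Suc r. ?g t' (m + i))"
    using sum_lessThan_add[of "?g t'" m "Suc r"] r by (simp del: sum.lessThan_Suc)
  also have "\<dots> = (\<Sum>i<m. ?g t' i) + (?g t' m + (\<Sum>i<r. ?g t' (m + Suc i)))"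
    by (simp only: sum.lessThan_Suc_shift) (simp add: algebra_simps)
  also have "\<dots> = (\<Sum>i<m. ?g t i) + ((\<omega> (t (Suc (Suc m))) - \<omega> (t m)) *\<^sub>R x (t m)
      + (\<Sum>i<r. ?g t (m + Suc (Suc i))))"
    by (simp add: t'_def)
  finally have "?S (Suc (Suc n)) t = ?S (Suc n) t'
     + (\<omega> (t (Suc (Suc m))) - \<omega> (t (Suc m))) *\<^sub>R (x (t (Suc m)) - x (t m))"
    unfolding 1 by (simp add: algebra_simps)
  then have eq: "?S (Suc (Suc n)) t - (\<omega> b - \<omega> a) *\<^sub>R x a = (?S (Suc n) t' - (\<omega> b - \<omega> a) *\<^sub>R x a)
       + (\<omega> (t (Suc (Suc m))) - \<omega> (t (Suc m))) *\<^sub>R (x (t (Suc m)) - x (t m))"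
    by (simp only: diff_add_eq)
  have "norm (?S (Suc (Suc n)) t - (\<omega> b - \<omega> a) *\<^sub>R x a)
     \<le> norm (?S (Suc n) t' - (\<omega> b - \<omega> a) *\<^sub>R x a)
       + norm ((\<omega> (t (Suc (Suc m))) - \<omega> (t (Suc m))) *\<^sub>R (x (t (Suc m)) - x (t m)))"
    unfolding eq by (rule norm_triangle_ineq)
  also have "\<dots> \<le> (\<Sum>j=1..n. real j powr - (1 / p + 1 / q)) * (?X * ?W)
      + real (Suc n) powr - (1 / p + 1 / q) * (?X * ?W)"
    using Suc.IH[OF t'] m(2) by (intro add_mono) (auto simp: mult.commute)
  also have "\<dots> = (\<Sum>j=1..Suc n. real j powr - (1 / p + 1 / q)) * (?X * ?W)"
    by (simp add: algebra_simps)
  finally show ?case .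
qed

definition young_const :: "real \<Rightarrow> real \<Rightarrow> real" where
  "young_const p q = inverse (1 - 2 powr (1 - (1 / p + 1 / q)))"

lemma young_const_ge_1:
  assumes "1 / p + 1 / q > 1" shows "1 \<le> young_const p q"
proof -
  have "2 powr (1 - (1 / p + 1 / q)) < 2 powr 0" using assms by (intro powr_less_mono) auto
  then show ?thesis unfolding young_const_def by (intro one_le_inverse) auto
qed

text \<open>Being uniform in the partition, the bound serves twice: in the limit for increments of
  the Young integral in the equation, and directly for Riemann sums of
  \<open>growth\<close>.\<close>

lemma young_sum_bound:
  fixes x :: "real \<Rightarrow> 'a::real_normed_vector" and \<omega> :: "real \<Rightarrow> real"
  assumes p: "0 < p" and q: "0 < q" and \<theta>: "1 / p + 1 / q > 1"
    and x: "bdd_above (pvar_sums q x a b)" and \<omega>: "bdd_above (pvar_sums p \<omega> a b)"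
    and t: "partition_of a b n t"
  shows "norm ((\<Sum>i<n. (\<omega> (t (Suc i)) - \<omega> (t i)) *\<^sub>R x (t i)) - (\<omega> b - \<omega> a) *\<^sub>R x a)
    \<le> young_const p q * (pvar_seminorm q x a b * pvar_seminorm p \<omega> a b)"
proof (cases n)
  case 0
  then show ?thesis using t young_const_ge_1[OF \<theta>] by (auto simp: partition_of_def)
next
  case (Suc m)
  show ?thesis
    using young_sum_remove_points[OF p q x \<omega> t[unfolded Suc]] sum_powr_minus_le[OF \<theta>, of m]
    unfolding Suc young_const_def by (meson mult_right_mono mult_nonneg_nonneg order_trans pvar_seminorm_nonneg)
qed

section \<open>Partitions into small pieces\<close>

text \<open>Bisection glues good partitions. \<open>G\<close> is asked only of intervals with the
  base point \<open>x\<close> as an endpoint, because smallness of a variation is known first on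
  either side of a point; an interval around \<open>x\<close> is cut at \<open>x\<close>.\<close>

lemma partition_good:
  assumes ab: "a \<le> b"
    and loc: "\<And>x. \<lbrakk>a \<le> x; x \<le> b\<rbrakk> \<Longrightarrow> \<exists>d>0. \<forall>u v. a \<le> u \<longrightarrow> u \<le> x \<longrightarrow> x \<le> v \<longrightarrow> v \<le> b \<longrightarrow> v - u < d \<longrightarrow>
         G u x \<and> G x v"
  shows "\<exists>n t. partition_of a b n t \<and> (\<forall>i<n. G (t i) (t (Suc i)))"
proof -
  have "a \<le> a \<longrightarrow> b \<le> b \<longrightarrow> (\<exists>n t. partition_of a b n t \<and> (\<forall>i<n. G (t i) (t (Suc i))))"
    using ab
  proof (rule Bolzano[where P = "\<lambda>u v. a \<le> u \<longrightarrow> v \<le> b \<longrightarrow> (\<exists>n t. partition_of u v n t \<and> (\<forall>i<n. G (t i) (t (Suc i))))"], goal_cases)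
    case (1 u v w)
    show ?case
    proof (intro impI)
      assume "a \<le> u" "w \<le> b"
      then obtain n s m t where s: "partition_of u v n s" "\<forall>i<n. G (s i) (s (Suc i))"
        and t: "partition_of v w m t" "\<forall>i<m. G (t i) (t (Suc i))"
        using 1 by force
      obtain r where r: "partition_of u w (n + m) r"
        "\<And>i. i < n \<Longrightarrow> r i = s i \<and> r (Suc i) = s (Suc i)"
        "\<And>i. i < m \<Longrightarrow> r (n + i) = t i \<and> r (Suc (n + i)) = t (Suc i)"
        using partition_of_concat[OF s(1) t(1)] by blast
      have "G (r i) (r (Suc i))" if "i < n + m" for i
        using that r(2)[of i] r(3)[of "i - n"] s(2) t(2) by (cases "i < n") auto
      with r(1) show "\<exists>n t. partition_of u w n t \<and> (\<forall>i<n. G (t i) (t (Suc i)))" by blast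
    qed
  next
    case (2 x)
    then obtain d where d: "d > 0" "\<And>u v. \<lbrakk>a \<le> u; u \<le> x; x \<le> v; v \<le> b; v - u < d\<rbrakk> \<Longrightarrow> G u x \<and> G x v"
      using loc[of x] by blast
    show ?case
    proof (intro exI[of _ d] conjI allI impI d(1))
      fix u v assume uv: "u \<le> x \<and> x \<le> v \<and> v - u < d" "a \<le> u" "v \<le> b"
      then have g: "G u x" "G x v" using d(2)[of u v] by auto
      obtain n s where s: "partition_of u x n s" "n \<le> 1"
        using uv partition_of_trivial[of u x] by blast
      obtain m t where t: "partition_of x v m t" "m \<le> 1"
        using uv partition_of_trivial[of x v] by blast
      obtain r where r: "partition_of u v (n + m) r"
        "\<And>i. i < n \<Longrightarrow> r i = s i \<and> r (Suc i) = s (Suc i)"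
        "\<And>i. i < m \<Longrightarrow> r (n + i) = t i \<and> r (Suc (n + i)) = t (Suc i)"
        using partition_of_concat[OF s(1) t(1)] by blast
      have S: "G (s i) (s (Suc i))" if "i < n" for i
        using that s g by (cases "n = 1") (auto simp: partition_of_def)
      have T: "G (t i) (t (Suc i))" if "i < m" for i
        using that t g by (cases "m = 1") (auto simp: partition_of_def)
      have "G (r i) (r (Suc i))" if "i < n + m" for i
        using that r(2)[of i] r(3)[of "i - n"] S[of i] T[of "i - n"] by (cases "i < n") auto
      with r(1) show "\<exists>n t. partition_of u v n t \<and> (\<forall>i<n. G (t i) (t (Suc i)))" by blast
    qed
  qed
  then show ?thesis by simp
qed

lemma fine_partition_exists:
  assumes "a \<le> b" "0 < (\<delta>::real)"
  obtains n t where "partition_of a b n t" "\<And>i. i < n \<Longrightarrow> t (Suc i) - t i < \<delta>"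
proof -
  have "\<exists>n t. partition_of a b n t \<and> (\<forall>i<n. t (Suc i) - t i < \<delta>)"
    using assms(1)
  proof (rule partition_good[where G = "\<lambda>u v. v - u < \<delta>"])
    show "\<exists>d>0. \<forall>u v. a \<le> u \<longrightarrow> u \<le> x \<longrightarrow> x \<le> v \<longrightarrow> v \<le> b \<longrightarrow> v - u < d \<longrightarrow>
      x - u < \<delta> \<and> v - x < \<delta>" for x
      using assms(2) by (intro exI[of _ \<delta>]) auto
  qed
  with that show ?thesis by blast
qed

lemma has_young_integralD:
  assumes "has_young_integral x \<omega> a b I" "0 < \<epsilon>"
  obtains \<delta> where "0 < \<delta>" "\<And>n t. \<lbrakk>partition_of a b n t; \<forall>i<n. t (Suc i) - t i < \<delta>\<rbrakk> \<Longrightarrow>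
     norm ((\<Sum>i<n. (\<omega> (t (Suc i)) - \<omega> (t i)) *\<^sub>R x (t i)) - I) < \<epsilon>"
  using assms unfolding has_young_integral_def by auto

text \<open>Only integrals starting at \<open>a\<close> are given. Prolonging a fine partition of
  \<open>{a..u}\<close> by one of \<open>{u..v}\<close> makes the difference of the two Riemann sums
  a Riemann sum over \<open>{u..v}\<close> alone, to which the uniform bound applies.\<close>

lemma young_increment:
  fixes x :: "real \<Rightarrow> 'a::real_normed_vector"
  assumes p: "0 < p" and q: "0 < q" and \<theta>: "1 / p + 1 / q > 1"
    and I: "has_young_integral x \<omega> a u I" and J: "has_young_integral x \<omega> a v J"
    and uv: "a \<le> u" "u \<le> v"
    and x: "bdd_above (pvar_sums q x u v)" and \<omega>: "bdd_above (pvar_sums p \<omega> u v)"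
  shows "norm (J - I - (\<omega> v - \<omega> u) *\<^sub>R x u)
    \<le> young_const p q * (pvar_seminorm q x u v * pvar_seminorm p \<omega> u v)"
proof (rule field_le_epsilon)
  fix e :: real assume e: "0 < e"
  let ?g = "\<lambda>t i. (\<omega> (t (Suc i)) - \<omega> (t i)) *\<^sub>R x (t i)"
  obtain d1 where d1: "d1 > 0" "\<And>n t. \<lbrakk>partition_of a u n t; \<forall>i<n. t (Suc i) - t i < d1\<rbrakk> \<Longrightarrow>
      norm ((\<Sum>i<n. ?g t i) - I) < e / 2"
    using has_young_integralD[OF I, of "e / 2"] e by auto
  obtain d2 where d2: "d2 > 0" "\<And>n t. \<lbrakk>partition_of a v n t; \<forall>i<n. t (Suc i) - t i < d2\<rbrakk> \<Longrightarrow>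
      norm ((\<Sum>i<n. ?g t i) - J) < e / 2"
    using has_young_integralD[OF J, of "e / 2"] e by auto
  define d where "d = min d1 d2"
  have d: "d > 0" using d1(1) d2(1) by (simp add: d_def)
  obtain n s where s: "partition_of a u n s" "\<And>i. i < n \<Longrightarrow> s (Suc i) - s i < d"
    using fine_partition_exists[OF uv(1) d] by blast
  obtain m t where t: "partition_of u v m t" "\<And>i. i < m \<Longrightarrow> t (Suc i) - t i < d"
    using fine_partition_exists[OF uv(2) d] by blast
  obtain r where r: "partition_of a v (n + m) r"
    "\<And>i. i < n \<Longrightarrow> r i = s i \<and> r (Suc i) = s (Suc i)"
    "\<And>i. i < m \<Longrightarrow> r (n + i) = t i \<and> r (Suc (n + i)) = t (Suc i)"
    using partition_of_concat[OF s(1) t(1)] by blast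
  have "r (Suc i) - r i < d" if "i < n + m" for i
    using that r(2)[of i] r(3)[of "i - n"] s(2)[of i] t(2)[of "i - n"] by (cases "i < n") auto
  then have rJ: "norm ((\<Sum>i<n + m. ?g r i) - J) < e / 2" by (intro d2(2)[OF r(1)]) (auto simp: d_def)
  have sI: "norm ((\<Sum>i<n. ?g s i) - I) < e / 2" using s(2) by (intro d1(2)[OF s(1)]) (auto simp: d_def)
  have split: "(\<Sum>i<n + m. ?g r i) = (\<Sum>i<n. ?g s i) + (\<Sum>i<m. ?g t i)"
    by (simp add: sum_lessThan_add r)
  let ?D = "(\<omega> v - \<omega> u) *\<^sub>R x u"
  let ?A = "(\<Sum>i<m. ?g t i)" and ?B = "(\<Sum>i<n. ?g s i)" and ?R = "(\<Sum>i<n + m. ?g r i)"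
  have tri: "norm ((P + Q) - R) \<le> norm P + norm Q + norm R" for P Q R :: 'a
    using norm_triangle_ineq4[of "P + Q" R] norm_triangle_ineq[of P Q] by linarith
  have eq: "J - I - ?D = ((?A - ?D) + (?B - I)) - (?R - J)"
    unfolding split by (simp add: algebra_simps)
  show "norm (J - I - ?D) \<le> young_const p q * (pvar_seminorm q x u v * pvar_seminorm p \<omega> u v) + e"
    using young_sum_bound[OF p q \<theta> x \<omega> t(1)] rJ sI tri[of "?A - ?D" "?B - I" "?R - J"]
    unfolding eq by linarith
qed

section \<open>Continuity of the variation at a point\<close>

lemma pvar_seminorm_point [simp]: "0 < p \<Longrightarrow> pvar_seminorm p x a a = 0"
  using pvar_le_supadd(2)[of p "\<lambda>_ _. 0" a a x] pvar_seminorm_nonneg[of p x a a]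
  by (force simp: supadd_def dest: order_antisym)

text \<open>Take a nearly optimal partition of a short interval \<open>{c..b'}\<close>. By
  continuity its first increment is negligible, so the part on \<open>{?t1..b'}\<close> carries
  nearly the whole variation; superadditivity leaves little for \<open>{c..?t1}\<close>, and
  monotonicity covers shorter intervals.\<close>

lemma pvar_small_right:
  fixes x :: "real \<Rightarrow> 'a::real_normed_vector"
  assumes p: "0 < p" and x: "in_Cpvar p x a b" and c: "a \<le> c" "c \<le> b" and e: "0 < e"
  shows "\<exists>d>0. \<forall>v. c \<le> v \<longrightarrow> v \<le> b \<longrightarrow> v - c < d \<longrightarrow> pvar_seminorm p x c v \<le> e"
proof (cases "c = b")
  case True
  then show ?thesis using p e by (intro exI[of _ 1]) (auto dest!: order_antisym)
next
  case False
  then have cb: "c < b" using c by simp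
  \<comment> \<open>One half of \<open>e powr p\<close> pays for the distance to the supremum, the
    other for the first increment.\<close>
  define \<eta> where "\<eta> = e powr p / 2"
  have \<eta>: "\<eta> > 0" using e by (simp add: \<eta>_def)
  have bdd: "bdd_above (pvar_sums p x a b)" and cont: "continuous_on {a..b} x"
    using x by (auto simp: in_Cpvar_def)
  have "\<eta> powr (1 / p) > 0" using \<eta> by simp
  then obtain \<delta> where \<delta>: "\<delta> > 0" "\<And>y. \<lbrakk>y \<in> {a..b}; dist y c < \<delta>\<rbrakk> \<Longrightarrow> dist (x y) (x c) < \<eta> powr (1 / p)"
    using cont c unfolding continuous_on_iff by (metis atLeastAtMost_iff)
  define b' where "b' = min b (c + \<delta> / 2)"
  have b': "c < b'" "b' \<le> b" using cb \<delta> by (auto simp: b'_def)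
  have sa: "supadd p (pvar_seminorm p x) a b" using supadd_pvar[OF p bdd] .
  have bc: "bdd_above (pvar_sums p x u v)" if "c \<le> u" "u \<le> v" "v \<le> b'" for u v
    using bdd_pvar_subinterval[OF bdd, of u v] that c b' by simp
  obtain S where S: "S \<in> pvar_sums p x c b'" "Sup (pvar_sums p x c b') - \<eta> < S"
    using less_cSupE[of "Sup (pvar_sums p x c b') - \<eta>" "pvar_sums p x c b'"] \<eta> b'
      pvar_sums_nonempty[of c b' p x] by auto
  then obtain n t where t: "partition_of c b' n t" "S = (\<Sum>i<n. norm (x (t (Suc i)) - x (t i)) powr p)"
    by (elim pvar_sums_cases)
  obtain m where m: "n = Suc m" using t(1) b' by (cases n) (auto simp: partition_of_def)
  let ?t1 = "t (Suc 0)"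
  have t1: "c < ?t1" "?t1 \<le> b'"
    using partition_of_step[OF t(1)] partition_of_bounds[OF t(1), of "Suc 0"] m by auto
  have "partition_of ?t1 b' m (\<lambda>i. t (Suc i))"
    using t(1) m by (auto simp: partition_of_def)
  then have rest: "(\<Sum>i<m. norm (x (t (Suc (Suc i))) - x (t (Suc i))) powr p)
      \<le> pvar_seminorm p x ?t1 b' powr p"
    using t1 b' by (intro pvar_sum_le[OF p bc]) auto
  have "norm (x ?t1 - x (t 0)) \<le> \<eta> powr (1 / p)"
    using \<delta>(2)[of ?t1] t1 b' c t(1) by (auto simp: dist_norm b'_def partition_of_def)
  then have "norm (x ?t1 - x (t 0)) powr p \<le> (\<eta> powr (1 / p)) powr p"
    using p by (intro powr_mono2) auto
  then have "norm (x ?t1 - x (t 0)) powr p \<le> \<eta>"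
    using p \<eta> by (simp add: powr_powr)
  then have "S \<le> \<eta> + pvar_seminorm p x ?t1 b' powr p"
    unfolding t(2) m sum.lessThan_Suc_shift using rest by simp
  moreover have "pvar_seminorm p x c b' powr p < S + \<eta>"
    using S(2) pvar_seminorm_powr[OF p bc[of c b']] b' by simp
  moreover have "pvar_seminorm p x c ?t1 powr p + pvar_seminorm p x ?t1 b' powr p \<le> pvar_seminorm p x c b' powr p"
    using supaddD(2)[OF sa, of c ?t1 b'] t1 b' c by simp
  ultimately have "pvar_seminorm p x c ?t1 powr p \<le> e powr p" by (simp add: \<eta>_def)
  then have le: "pvar_seminorm p x c ?t1 \<le> e" using p e by (simp add: powr_le_powr_iff)
  show ?thesis
  proof (intro exI[of _ "?t1 - c"] conjI allI impI)
    fix v assume "c \<le> v" "v \<le> b" "v - c < ?t1 - c"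
    then have "pvar_seminorm p x c v \<le> pvar_seminorm p x c ?t1"
      using supadd_mono[OF p sa, of c c v ?t1] t1 b' c by simp
    then show "pvar_seminorm p x c v \<le> e" using le by simp
  qed (use t1 in simp)
qed

text \<open>Mirror image of \<open>pvar_small_right\<close>: now the last increment of a nearly
  optimal partition is the negligible one.\<close>

lemma pvar_small_left:
  fixes x :: "real \<Rightarrow> 'a::real_normed_vector"
  assumes p: "0 < p" and x: "in_Cpvar p x a b" and c: "a \<le> c" "c \<le> b" and e: "0 < e"
  shows "\<exists>d>0. \<forall>u. a \<le> u \<longrightarrow> u \<le> c \<longrightarrow> c - u < d \<longrightarrow> pvar_seminorm p x u c \<le> e"
proof (cases "c = a")
  case True
  then show ?thesis using p e by (intro exI[of _ 1]) (auto dest!: order_antisym)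
next
  case False
  then have cb: "a < c" using c by simp
  define \<eta> where "\<eta> = e powr p / 2"
  have \<eta>: "\<eta> > 0" using e by (simp add: \<eta>_def)
  have bdd: "bdd_above (pvar_sums p x a b)" and cont: "continuous_on {a..b} x"
    using x by (auto simp: in_Cpvar_def)
  have "\<eta> powr (1 / p) > 0" using \<eta> by simp
  then obtain \<delta> where \<delta>: "\<delta> > 0" "\<And>y. \<lbrakk>y \<in> {a..b}; dist y c < \<delta>\<rbrakk> \<Longrightarrow> dist (x y) (x c) < \<eta> powr (1 / p)"
    using cont c unfolding continuous_on_iff by (metis atLeastAtMost_iff)
  define a' where "a' = max a (c - \<delta> / 2)"
  have a': "a' < c" "a \<le> a'" using cb \<delta> by (auto simp: a'_def)
  have sa: "supadd p (pvar_seminorm p x) a b" using supadd_pvar[OF p bdd] .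
  have bc: "bdd_above (pvar_sums p x u v)" if "a' \<le> u" "u \<le> v" "v \<le> c" for u v
    using bdd_pvar_subinterval[OF bdd, of u v] that c a' by simp
  obtain S where S: "S \<in> pvar_sums p x a' c" "Sup (pvar_sums p x a' c) - \<eta> < S"
    using less_cSupE[of "Sup (pvar_sums p x a' c) - \<eta>" "pvar_sums p x a' c"] \<eta> a'
      pvar_sums_nonempty[of a' c p x] by auto
  then obtain n t where t: "partition_of a' c n t" "S = (\<Sum>i<n. norm (x (t (Suc i)) - x (t i)) powr p)"
    by (elim pvar_sums_cases)
  obtain m where m: "n = Suc m" using t(1) a' by (cases n) (auto simp: partition_of_def)
  let ?t1 = "t m"
  have t1: "?t1 < c" "a' \<le> ?t1"
    using partition_of_step[OF t(1)] partition_of_bounds[OF t(1), of m] m by auto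
  have "partition_of a' ?t1 m t"
    using t(1) m by (auto simp: partition_of_def)
  then have rest: "(\<Sum>i<m. norm (x (t (Suc i)) - x (t i)) powr p)
      \<le> pvar_seminorm p x a' ?t1 powr p"
    using t1 a' by (intro pvar_sum_le[OF p bc]) auto
  have "norm (x (t n) - x ?t1) \<le> \<eta> powr (1 / p)"
    using \<delta>(2)[of ?t1] t1 a' c t(1) by (auto simp: dist_norm a'_def partition_of_def norm_minus_commute)
  then have "norm (x (t n) - x ?t1) powr p \<le> (\<eta> powr (1 / p)) powr p"
    using p by (intro powr_mono2) auto
  then have "norm (x (t n) - x ?t1) powr p \<le> \<eta>"
    using p \<eta> by (simp add: powr_powr)
  then have "S \<le> \<eta> + pvar_seminorm p x a' ?t1 powr p"
    unfolding t(2) m using rest by simp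
  moreover have "pvar_seminorm p x a' c powr p < S + \<eta>"
    using S(2) pvar_seminorm_powr[OF p bc[of a' c]] a' by simp
  moreover have "pvar_seminorm p x a' ?t1 powr p + pvar_seminorm p x ?t1 c powr p \<le> pvar_seminorm p x a' c powr p"
    using supaddD(2)[OF sa, of a' ?t1 c] t1 a' c by simp
  ultimately have "pvar_seminorm p x ?t1 c powr p \<le> e powr p" by (simp add: \<eta>_def)
  then have le: "pvar_seminorm p x ?t1 c \<le> e" using p e by (simp add: powr_le_powr_iff)
  show ?thesis
  proof (intro exI[of _ "c - ?t1"] conjI allI impI)
    fix u assume "a \<le> u" "u \<le> c" "c - u < c - ?t1"
    then have "pvar_seminorm p x u c \<le> pvar_seminorm p x ?t1 c"
      using supadd_mono[OF p sa, of ?t1 u c c] t1 a' c by simp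
    then show "pvar_seminorm p x u c \<le> e" using le by simp
  qed (use t1 in simp)
qed

lemma pvar_small:
  fixes x :: "real \<Rightarrow> 'a::real_normed_vector"
  assumes p: "0 < p" and x: "in_Cpvar p x a b" and c: "a \<le> c" "c \<le> b" and e: "0 < e"
  shows "\<exists>d>0. \<forall>u v. a \<le> u \<longrightarrow> u \<le> c \<longrightarrow> c \<le> v \<longrightarrow> v \<le> b \<longrightarrow> v - u < d \<longrightarrow>
    (pvar_seminorm p x u c \<le> e \<and> c - u \<le> e) \<and> (pvar_seminorm p x c v \<le> e \<and> v - c \<le> e)"
proof -
  obtain d1 where d1: "d1 > 0" "\<And>v. \<lbrakk>c \<le> v; v \<le> b; v - c < d1\<rbrakk> \<Longrightarrow> pvar_seminorm p x c v \<le> e"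
    using pvar_small_right[OF assms] by blast
  obtain d2 where d2: "d2 > 0" "\<And>u. \<lbrakk>a \<le> u; u \<le> c; c - u < d2\<rbrakk> \<Longrightarrow> pvar_seminorm p x u c \<le> e"
    using pvar_small_left[OF assms] by blast
  show ?thesis
    using d1 d2 e by (intro exI[of _ "min e (min d1 d2)"]) auto
qed

section \<open>Local estimates for a solution\<close>

lemma norm_matrix_vector_le: "norm (M *v y) \<le> norm (mat_op M) * norm y"
  by (metis blinfun_apply_mat_op norm_blinfun)

lemma mat_op_diff: "mat_op (M - N) = mat_op M - mat_op N"
  by (rule blinfun_eqI) (simp add: blinfun_apply_mat_op blinfun.diff_left matrix_vector_mult_diff_rdistrib)

lemma continuous_on_mat_op:
  fixes A :: "real \<Rightarrow> real^'d^'d"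
  assumes "continuous_on S A"
  shows "continuous_on S (\<lambda>t. mat_op (A t))"
proof -
  have "linear (mat_op :: real^'d^'d \<Rightarrow> _)"
    by (rule linearI; rule blinfun_eqI)
      (simp_all add: blinfun_apply_mat_op blinfun.add_left blinfun.scaleR_left
        matrix_vector_mult_add_rdistrib scaleR_matrix_vector_assoc)
  then show ?thesis
    by (intro linear_continuous_on_compose[OF assms])
qed

lemma in_Cpvar_subinterval:
  assumes "in_Cpvar p x a b" "a \<le> u" "u \<le> v" "v \<le> b"
  shows "in_Cpvar p x u v"
  using assms bdd_pvar_subinterval[of p x a b u v] continuous_on_subset[of "{a..b}" x "{u..v}"]
  by (auto simp: in_Cpvar_def)

lemma pvar_matrix_vector:
  fixes M :: "real \<Rightarrow> real^'d^'d" and y :: "real \<Rightarrow> real^'d"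
  assumes q: "1 \<le> q" and st: "s \<le> t"
    and M: "bdd_above (pvar_sums q (\<lambda>r. mat_op (M r)) s t)" and y: "bdd_above (pvar_sums q y s t)"
    and c: "\<And>r. r \<in> {s..t} \<Longrightarrow> norm (mat_op (M r)) \<le> c" and X: "\<And>r. r \<in> {s..t} \<Longrightarrow> norm (y r) \<le> X"
  shows "bdd_above (pvar_sums q (\<lambda>r. M r *v y r) s t)"
    and "pvar_seminorm q (\<lambda>r. M r *v y r) s t
      \<le> c * pvar_seminorm q y s t + X * pvar_seminorm q (\<lambda>r. mat_op (M r)) s t"
proof -
  have c0: "0 \<le> c" and X0: "0 \<le> X"
    using order_trans[OF norm_ge_zero c[of s]] order_trans[OF norm_ge_zero X[of s]] st by auto
  let ?g = "\<lambda>u v. c * pvar_seminorm q y u v + X * pvar_seminorm q (\<lambda>r. mat_op (M r)) u v"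
  have sa: "supadd q ?g s t"
    using q c0 X0 M y by (intro supadd_add supadd_mult supadd_pvar) auto
  have le: "norm (M v *v y v - M u *v y u) \<le> ?g u v" if "s \<le> u" "u \<le> v" "v \<le> t" for u v
  proof -
    have "M v *v y v - M u *v y u = M v *v (y v - y u) + (M v - M u) *v y u"
      by (simp add: matrix_vector_mult_diff_distrib matrix_vector_mult_diff_rdistrib)
    then have "norm (M v *v y v - M u *v y u) \<le> norm (M v *v (y v - y u)) + norm ((M v - M u) *v y u)"
      by (simp add: norm_triangle_ineq)
    also have "norm (M v *v (y v - y u)) \<le> norm (mat_op (M v)) * norm (y v - y u)"
      by (rule norm_matrix_vector_le)
    also have "\<dots> \<le> c * pvar_seminorm q y u v"
      using that q c0 by (intro mult_mono c norm_diff_le_pvar[OF _ y]) auto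
    also have "norm ((M v - M u) *v y u) \<le> norm (mat_op (M v - M u)) * norm (y u)"
      by (rule norm_matrix_vector_le)
    also have "\<dots> = norm (y u) * norm (mat_op (M v) - mat_op (M u))" by (simp add: mat_op_diff)
    also have "\<dots> \<le> X * pvar_seminorm q (\<lambda>r. mat_op (M r)) u v"
      using that q X0 by (intro mult_mono X norm_diff_le_pvar[OF _ M]) auto
    finally show ?thesis by simp
  qed
  from pvar_le_supadd[OF _ sa st this]
  show "bdd_above (pvar_sums q (\<lambda>r. M r *v y r) s t)"
    and "pvar_seminorm q (\<lambda>r. M r *v y r) s t
      \<le> c * pvar_seminorm q y s t + X * pvar_seminorm q (\<lambda>r. mat_op (M r)) s t"
    using q by auto
qed

section \<open>Standing hypotheses and increments of one solution\<close>

locale yde_path =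
  fixes p q :: real and \<omega> h f :: "real \<Rightarrow> real" and A C :: "real \<Rightarrow> real^'d^'d"
    and F :: "real \<Rightarrow> real^'d \<Rightarrow> real^'d" and x0 :: "real^'d" and x :: "real \<Rightarrow> real^'d"
  assumes p: "1 < p" "p < 2"
    and q: "p \<le> q" "1 / p + 1 / q > 1"
    and \<omega>_pvar: "\<And>T. T > 0 \<Longrightarrow> in_Cpvar p \<omega> 0 T"
    and A_cont: "\<And>T. T > 0 \<Longrightarrow> continuous_on {0..T} A"
    and C_qvar: "\<And>T. T > 0 \<Longrightarrow> in_Cpvar q (\<lambda>t. mat_op (C t)) 0 T"
    and h_nonneg: "\<And>t. t \<ge> 0 \<Longrightarrow> h t \<ge> 0"
    and h_integrable: "\<And>t. t \<ge> 0 \<Longrightarrow> h integrable_on {0..t}"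
    and A_diss: "\<And>t x. t \<ge> 0 \<Longrightarrow> x \<bullet> (A t *v x) \<le> - h t * (norm x)\<^sup>2"
    and F_zero: "\<And>t. t \<ge> 0 \<Longrightarrow> F t 0 = 0"
    and f_pos: "\<And>t. t \<ge> 0 \<Longrightarrow> f t > 0"
    and f_cont: "continuous_on {0..} f"
    and F_lipschitz: "\<And>t x y. t \<ge> 0 \<Longrightarrow> norm (F t x - F t y) \<le> f t * norm (x - y)"
    and sol: "yde_solution q \<omega> A C F x0 x"
begin

abbreviation "K \<equiv> young_const p q"
abbreviation "W \<equiv> pvar_seminorm p \<omega>"
abbreviation "V \<equiv> pvar_seminorm q x"
abbreviation "VC \<equiv> pvar_seminorm q (\<lambda>t. mat_op (C t))"
abbreviation "drift s \<equiv> A s *v x s + F s (x s)"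

lemma K_ge_1: "1 \<le> K" using q(2) by (rule young_const_ge_1)

lemma q_gt_1: "1 < q" using p q by simp

lemma \<omega>_Cpvar: "\<lbrakk>0 \<le> u; u \<le> v\<rbrakk> \<Longrightarrow> in_Cpvar p \<omega> u v"
  using in_Cpvar_subinterval[OF \<omega>_pvar[of "v + 1"], of u v] by simp

lemma C_Cpvar: "\<lbrakk>0 \<le> u; u \<le> v\<rbrakk> \<Longrightarrow> in_Cpvar q (\<lambda>t. mat_op (C t)) u v"
  using in_Cpvar_subinterval[OF C_qvar[of "v + 1"], of u v] by simp

lemma x_Cpvar: "\<lbrakk>0 \<le> u; u \<le> v\<rbrakk> \<Longrightarrow> in_Cpvar q x u v"
proof -
  assume "0 \<le> u" "u \<le> v"
  moreover from this have "in_Cpvar q x 0 (v + 1)" using sol by (auto simp: yde_solution_def)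
  ultimately show ?thesis using in_Cpvar_subinterval[of q x 0 "v + 1" u v] by simp
qed

lemma bdd_\<omega>: "\<lbrakk>0 \<le> u; u \<le> v\<rbrakk> \<Longrightarrow> bdd_above (pvar_sums p \<omega> u v)"
  using \<omega>_Cpvar by (simp add: in_Cpvar_def)

lemma bdd_C: "\<lbrakk>0 \<le> u; u \<le> v\<rbrakk> \<Longrightarrow> bdd_above (pvar_sums q (\<lambda>t. mat_op (C t)) u v)"
  using C_Cpvar by (simp add: in_Cpvar_def)

lemma bdd_x: "\<lbrakk>0 \<le> u; u \<le> v\<rbrakk> \<Longrightarrow> bdd_above (pvar_sums q x u v)"
  using x_Cpvar by (simp add: in_Cpvar_def)

lemma supadd_W: "\<lbrakk>0 \<le> u; u \<le> v\<rbrakk> \<Longrightarrow> supadd p W u v"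
  using p bdd_\<omega> by (intro supadd_pvar) auto

lemma W_mono: "\<lbrakk>0 \<le> s; s \<le> u; u \<le> v; v \<le> t\<rbrakk> \<Longrightarrow> W u v \<le> W s t"
  using supadd_mono[OF _ supadd_W[of s t], of s u v t] p by simp

lemma V_mono: "\<lbrakk>0 \<le> s; s \<le> u; u \<le> v; v \<le> t\<rbrakk> \<Longrightarrow> V u v \<le> V s t"
  using supadd_mono[OF _ supadd_pvar[OF _ bdd_x[of s t]], of s u v t] q_gt_1 by simp

lemma VC_mono: "\<lbrakk>0 \<le> s; s \<le> u; u \<le> v; v \<le> t\<rbrakk> \<Longrightarrow> VC u v \<le> VC s t"
  using supadd_mono[OF _ supadd_pvar[OF _ bdd_C[of s t]], of s u v t] q_gt_1 by simp

text \<open>One constant \<open>c\<close> covers both the size and the \<open>q\<close>-variation of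
  \<open>C\<close>, as \<open>pvar_norm\<close> does; the product rule then collapses to
  \<open>c * (X + V s t)\<close> in \<open>Cx_variation\<close>.\<close>

definition coeff_bound :: "real \<Rightarrow> real \<Rightarrow> real \<Rightarrow> real \<Rightarrow> bool" where
  "coeff_bound a c s t \<longleftrightarrow> 0 \<le> s \<and> s \<le> t \<and>
     (\<forall>r\<in>{s..t}. norm (mat_op (A r)) + f r \<le> a \<and> norm (mat_op (C r)) \<le> c) \<and> VC s t \<le> c"

lemma coeff_boundD:
  assumes "coeff_bound a c s t"
  shows "0 \<le> s" "s \<le> t" "0 \<le> a" "0 \<le> c" "VC s t \<le> c"
    "\<And>r. r \<in> {s..t} \<Longrightarrow> norm (mat_op (A r)) + f r \<le> a" "\<And>r. r \<in> {s..t} \<Longrightarrow> norm (mat_op (C r)) \<le> c"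
proof -
  show st: "0 \<le> s" "s \<le> t" and "VC s t \<le> c"
    and *: "\<And>r. r \<in> {s..t} \<Longrightarrow> norm (mat_op (A r)) + f r \<le> a" "\<And>r. r \<in> {s..t} \<Longrightarrow> norm (mat_op (C r)) \<le> c"
    using assms by (auto simp: coeff_bound_def)
  show "0 \<le> a" "0 \<le> c"
    using *[of s] st f_pos[OF st(1)] norm_ge_zero[of "mat_op (A s)"] norm_ge_zero[of "mat_op (C s)"]
    by (simp, linarith)+
qed

lemma coeff_bound_subinterval:
  assumes "coeff_bound a c s t" "s \<le> u" "u \<le> v" "v \<le> t"
  shows "coeff_bound a c u v"
  using coeff_boundD[OF assms(1)] VC_mono[of s u v t] assms(2-) by (auto simp: coeff_bound_def)

lemma norm_drift_le:
  assumes "coeff_bound a c s t" "r \<in> {s..t}"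
  shows "norm (drift r) \<le> a * norm (x r)"
proof -
  have r: "0 \<le> r" using coeff_boundD[OF assms(1)] assms(2) by auto
  have "norm (drift r) \<le> norm (A r *v x r) + norm (F r (x r))" by (rule norm_triangle_ineq)
  also have "\<dots> \<le> norm (mat_op (A r)) * norm (x r) + f r * norm (x r)"
    using norm_matrix_vector_le F_lipschitz[OF r, of "x r" 0] F_zero[OF r] by (intro add_mono) auto
  also have "\<dots> \<le> a * norm (x r)"
    using coeff_boundD(6)[OF assms] by (simp add: distrib_right[symmetric] mult_right_mono)
  finally show ?thesis .
qed

lemma solution_increment:
  assumes uv: "0 \<le> u" "u \<le> v" and bdd: "bdd_above (pvar_sums q (\<lambda>s. C s *v x s) u v)"
  obtains I where "(drift has_integral I) {u..v}"
    "norm (x v - x u - I - (\<omega> v - \<omega> u) *\<^sub>R (C u *v x u))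
      \<le> K * (pvar_seminorm q (\<lambda>s. C s *v x s) u v * W u v)"
proof -
  have ex: "\<exists>I J. (drift has_integral I) {0..t} \<and> has_young_integral (\<lambda>s. C s *v x s) \<omega> 0 t J \<and> x t = x0 + I + J"
    if "0 \<le> t" for t using sol that unfolding yde_solution_def by blast
  from uv obtain Iu Ju Iv Jv where
    u: "(drift has_integral Iu) {0..u}" "has_young_integral (\<lambda>s. C s *v x s) \<omega> 0 u Ju" "x u = x0 + Iu + Ju" and
    v: "(drift has_integral Iv) {0..v}" "has_young_integral (\<lambda>s. C s *v x s) \<omega> 0 v Jv" "x v = x0 + Iv + Jv"
    using ex[of u] ex[of v] by force
  have "drift integrable_on {u..v}"
    using integrable_on_subinterval[of drift "{0..v}" u v] v(1) uv by (auto simp: has_integral_integrable)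
  then obtain I where I: "(drift has_integral I) {u..v}" by (auto simp: integrable_on_def)
  have "(drift has_integral (Iu + I)) {0..v}"
    using has_integral_combine[OF uv u(1) I] .
  then have "Iv = Iu + I" using v(1) has_integral_unique by blast
  then have eq: "x v - x u - I - (\<omega> v - \<omega> u) *\<^sub>R (C u *v x u) = Jv - Ju - (\<omega> v - \<omega> u) *\<^sub>R (C u *v x u)"
    by (simp add: u(3) v(3))
  have "norm (Jv - Ju - (\<omega> v - \<omega> u) *\<^sub>R (C u *v x u))
      \<le> K * (pvar_seminorm q (\<lambda>s. C s *v x s) u v * W u v)"
    using young_increment[OF _ _ q(2) u(2) v(2) uv bdd bdd_\<omega>[OF uv]] p q_gt_1 by simp
  then show ?thesis using that[OF I] eq by simp
qed

lemma Cx_variation: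
  assumes "coeff_bound a c s t" "\<And>r. r \<in> {s..t} \<Longrightarrow> norm (x r) \<le> X"
  shows "bdd_above (pvar_sums q (\<lambda>s. C s *v x s) s t)"
    "pvar_seminorm q (\<lambda>s. C s *v x s) s t \<le> c * (X + V s t)"
proof -
  note cb = coeff_boundD[OF assms(1)]
  have X0: "0 \<le> X" using order_trans[OF norm_ge_zero assms(2)[of s]] cb by auto
  have "pvar_seminorm q (\<lambda>s. C s *v x s) s t \<le> c * V s t + X * VC s t"
    using pvar_matrix_vector(2)[of q s t C x c X] q_gt_1 cb assms(2) bdd_C bdd_x by simp
  also have "\<dots> \<le> c * V s t + X * c" using cb X0 by (intro add_left_mono mult_left_mono)
  finally show "pvar_seminorm q (\<lambda>s. C s *v x s) s t \<le> c * (X + V s t)" by (simp add: algebra_simps)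
  show "bdd_above (pvar_sums q (\<lambda>s. C s *v x s) s t)"
    using pvar_matrix_vector(1)[of q s t C x c X] q_gt_1 cb assms(2) bdd_C bdd_x by simp
qed

text \<open>The coefficients belong to the outer interval \<open>{s..t}\<close>, so that the
  right-hand side is superadditive in \<open>u\<close> and \<open>v\<close> and can bound
  \<open>V s t\<close> itself. Of the \<open>2 * X\<close>, one comes from the left-point term,
  enlarged by \<open>1 \<le> K\<close>, the other from the variation of
  \<open>C s *v x s\<close>.\<close>

lemma increment_bound:
  assumes cb: "coeff_bound a c s t" and X: "\<And>r. r \<in> {s..t} \<Longrightarrow> norm (x r) \<le> X"
    and uv: "s \<le> u" "u \<le> v" "v \<le> t"
  shows "norm (x v - x u) \<le> (a * X) * (v - u) + (K * c * (2 * X + V s t)) * W u v"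
proof -
  note cbs = coeff_bound_subinterval[OF cb uv]
  note cbd = coeff_boundD[OF cb]
  have X': "\<And>r. r \<in> {u..v} \<Longrightarrow> norm (x r) \<le> X" using X uv by simp
  have X0: "0 \<le> X" using order_trans[OF norm_ge_zero X[of s]] cbd by auto
  have u0: "0 \<le> u" using cbd uv by simp
  obtain I where I: "(drift has_integral I) {u..v}"
    "norm (x v - x u - I - (\<omega> v - \<omega> u) *\<^sub>R (C u *v x u))
      \<le> K * (pvar_seminorm q (\<lambda>s. C s *v x s) u v * W u v)"
    using solution_increment[OF u0 uv(2) Cx_variation(1)[OF cbs X']] by blast
  have "norm I \<le> a * X * measure lborel (cbox u v)"
  proof (rule has_integral_bound)
    show "(drift has_integral I) (cbox u v)" using I by simp
    show "norm (drift r) \<le> a * X" if "r \<in> cbox u v" for r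
      using norm_drift_le[OF cbs, of r] X'[of r] mult_left_mono[of "norm (x r)" X a] that cbd by fastforce
  qed (use cbd X0 in auto)
  then have 1: "norm I \<le> a * X * (v - u)" using uv by simp
  have "norm ((\<omega> v - \<omega> u) *\<^sub>R (C u *v x u)) = \<bar>\<omega> v - \<omega> u\<bar> * norm (C u *v x u)" by simp
  also have "\<dots> \<le> W u v * (c * X)"
  proof (intro mult_mono)
    show "\<bar>\<omega> v - \<omega> u\<bar> \<le> W u v"
      using norm_diff_le_pvar[OF _ bdd_\<omega>[OF u0 uv(2)], of u v] p uv by simp
    show "norm (C u *v x u) \<le> c * X"
      by (rule order_trans[OF norm_matrix_vector_le]) (use cbd X uv in \<open>auto intro!: mult_mono\<close>)
  qed auto
  also have "\<dots> \<le> K * (W u v * (c * X))"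
    using K_ge_1 cbd X0 mult_right_mono[of 1 K "W u v * (c * X)"] by simp
  finally have 2: "norm ((\<omega> v - \<omega> u) *\<^sub>R (C u *v x u)) \<le> K * (W u v * (c * X))" .
  have "pvar_seminorm q (\<lambda>s. C s *v x s) u v \<le> c * (X + V u v)"
    using Cx_variation(2)[OF cbs X'] by simp
  also have "\<dots> \<le> c * (X + V s t)" using V_mono[of s u v t] cbd uv by (intro mult_left_mono) auto
  finally have "K * (pvar_seminorm q (\<lambda>s. C s *v x s) u v * W u v) \<le> K * (c * (X + V s t) * W u v)"
    using K_ge_1 by (intro mult_left_mono mult_right_mono) auto
  with I(2) have 3: "norm (x v - x u - I - (\<omega> v - \<omega> u) *\<^sub>R (C u *v x u)) \<le> K * (c * (X + V s t) * W u v)"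
    by simp
  have "norm (x v - x u) = norm ((x v - x u - I - (\<omega> v - \<omega> u) *\<^sub>R (C u *v x u)) + I + (\<omega> v - \<omega> u) *\<^sub>R (C u *v x u))"
    by simp
  also have "\<dots> \<le> norm (x v - x u - I - (\<omega> v - \<omega> u) *\<^sub>R (C u *v x u)) + norm I + norm ((\<omega> v - \<omega> u) *\<^sub>R (C u *v x u))"
    by (meson add_mono norm_triangle_ineq order_refl order_trans)
  also have "\<dots> \<le> K * (c * (X + V s t) * W u v) + a * X * (v - u) + K * (W u v * (c * X))"
    using 1 2 3 by linarith
  finally show ?thesis by (simp add: algebra_simps)
qed

section \<open>Absorption on intervals of small weight; zeros of a solution\<close>

definition weight :: "real \<Rightarrow> real \<Rightarrow> real \<Rightarrow> real \<Rightarrow> real" where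
  "weight a c s t = 8 * a * (t - s) + 16 * K * c * W s t"

text \<open>Bounding the path by \<open>X = norm (x z) + V s t\<close> turns the increment bound
  into an inequality for \<open>V s t\<close> in which the unknown returns with factor at most 1/8 +
  1/16 = 3/16. Absorbing it gives (1/8) / (13/16) = 2/13. The ratio of 8 to 16 in
  \<open>weight\<close> mirrors the \<open>2 * X\<close> of \<open>increment_bound\<close>. The
  reference point \<open>z\<close> is arbitrary, so it may be a zero or a minimum of the
  norm.\<close>

lemma variation_small:
  assumes cb: "coeff_bound a c s t" and w: "weight a c s t \<le> 1" and z: "z \<in> {s..t}"
  shows "V s t \<le> 2 / 13 * weight a c s t * norm (x z)"
proof -
  note cbd = coeff_boundD[OF cb]
  define X where "X = norm (x z) + V s t"
  have X: "norm (x r) \<le> X" if "r \<in> {s..t}" for r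
  proof -
    have "norm (x r - x z) \<le> V s t"
    proof (cases "r \<le> z")
      case True
      then have "norm (x z - x r) \<le> V r z"
        using q_gt_1 bdd_x cbd that z by (intro norm_diff_le_pvar[of q x s t]) auto
      then show ?thesis using V_mono[of s r z t] True cbd that z by (simp add: norm_minus_commute)
    next
      case False
      then have "norm (x r - x z) \<le> V z r"
        using q_gt_1 bdd_x cbd that z by (intro norm_diff_le_pvar[of q x s t]) auto
      then show ?thesis using V_mono[of s z r t] False cbd that z by simp
    qed
    then show ?thesis using norm_triangle_sub[of "x r" "x z"] by (simp add: X_def)
  qed
  have K0: "0 \<le> K" using K_ge_1 by simp
  have "V s t \<le> (a * X) * (t - s) + (K * c * (2 * X + V s t)) * W s t"
  proof (rule pvar_le_supadd(2)[where g = "\<lambda>u v. (a * X) * (v - u) + (K * c * (2 * X + V s t)) * W u v"])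
    show "supadd q (\<lambda>u v. (a * X) * (v - u) + (K * c * (2 * X + V s t)) * W u v) s t"
      using q_gt_1 cbd K0 p q
      by (intro supadd_add supadd_mult supadd_length supadd_exponent[OF _ q(1) supadd_W])
        (auto simp: X_def)
  qed (use increment_bound[OF cb X] q_gt_1 cbd in auto)
  also have "\<dots> = weight a c s t / 8 * X + (K * c * W s t) * V s t"
    by (simp add: weight_def field_simps)
  also have "(K * c * W s t) \<le> weight a c s t / 16"
    using cbd by (simp add: weight_def)
  finally have "V s t \<le> weight a c s t / 8 * X + weight a c s t / 16 * V s t"
    by (simp add: mult_right_mono)
  then have "V s t \<le> weight a c s t / 8 * norm (x z) + 3 / 16 * weight a c s t * V s t"
    by (simp add: X_def field_simps)
  also have "3 / 16 * weight a c s t * V s t \<le> 3 / 16 * 1 * V s t"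
    using w by (intro mult_right_mono mult_left_mono) auto
  finally show ?thesis by simp
qed

lemma weight_small:
  assumes cb: "coeff_bound a c s t" and z: "z \<in> {s..t}"
  shows "\<exists>d>0. \<forall>u v. s \<le> u \<longrightarrow> u \<le> z \<longrightarrow> z \<le> v \<longrightarrow> v \<le> t \<longrightarrow> v - u < d \<longrightarrow>
    weight a c u z \<le> 1 \<and> weight a c z v \<le> 1"
proof -
  note cbd = coeff_boundD[OF cb]
  define e where "e = 1 / (8 * a + 16 * K * c + 1)"
  have pos: "0 \<le> 16 * K * c" using cbd K_ge_1 by simp
  then have e: "0 < e" using cbd(3) unfolding e_def by (intro divide_pos_pos) linarith+
  have le: "weight a c u v \<le> 1" if "W u v \<le> e" "v - u \<le> e" for u v
  proof -
    have "weight a c u v \<le> 8 * a * e + 16 * K * c * e"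
      unfolding weight_def using that cbd pos by (intro add_mono mult_left_mono) auto
    also have "\<dots> = (8 * a + 16 * K * c + 1) * e - e" by (simp add: algebra_simps)
    also have "\<dots> \<le> 1" using cbd(3) pos e unfolding e_def by simp
    finally show ?thesis .
  qed
  have "0 < p" using p by simp
  from pvar_small[OF this \<omega>_Cpvar[of s t], of z e] e z cbd
  show ?thesis by (auto intro!: le)
qed

text \<open>Where the weight is at most 1, a zero forces the variation to vanish; bisection spreads
  this over the interval in both directions of time. Forwards it gives uniqueness for
  \<open>x 0 = 0\<close>, backwards it shows that other solutions never vanish.\<close>

lemma zero_propagates:
  assumes st: "0 \<le> s" "s \<le> t" and cb: "coeff_bound a c s t" and z: "z \<in> {s..t}" "x z = 0" and r: "r \<in> {s..t}"
  shows "x r = 0"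
proof -
  have "s \<le> s \<longrightarrow> t \<le> t \<longrightarrow> (\<exists>z\<in>{s..t}. x z = 0) \<longrightarrow> (\<forall>r\<in>{s..t}. x r = 0)"
    using st(2)
  proof (rule Bolzano[where P = "\<lambda>u v. s \<le> u \<longrightarrow> v \<le> t \<longrightarrow> (\<exists>z\<in>{u..v}. x z = 0) \<longrightarrow> (\<forall>r\<in>{u..v}. x r = 0)"], goal_cases)
    case (1 u v w)
    show ?case
    proof (intro impI)
      assume *: "s \<le> u" "w \<le> t" "\<exists>z\<in>{u..w}. x z = 0"
      then have "x v = 0" using 1 by (metis atLeastAtMost_iff linorder_linear order_trans order_refl)
      then show "\<forall>r\<in>{u..w}. x r = 0" using 1 * by (metis atLeastAtMost_iff linorder_linear order_trans order_refl)
    qed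
  next
    case (2 y)
    then obtain d where d: "d > 0" "\<And>u v. \<lbrakk>s \<le> u; u \<le> y; y \<le> v; v \<le> t; v - u < d\<rbrakk> \<Longrightarrow>
        weight a c u y \<le> 1 \<and> weight a c y v \<le> 1"
      using weight_small[OF cb, of y] by auto
    have piece: "x r = 0" if "s \<le> u" "u \<le> v" "v \<le> t" "weight a c u v \<le> 1" "z \<in> {u..v}" "x z = 0" "r \<in> {u..v}"
      for u v z r
    proof -
      have "V u v \<le> 0"
        using variation_small[OF coeff_bound_subinterval[OF cb that(1-3)] that(4,5)] that(6) by simp
      then have "norm (x b - x a) \<le> 0" if "u \<le> a" "a \<le> b" "b \<le> v" for a b
      proof -
        have "norm (x b - x a) \<le> V a b" "V a b \<le> V u v"
          using norm_diff_le_pvar[OF _ bdd_x, of u v a b] V_mono[of u a b v] q_gt_1 st(1) \<open>s \<le> u\<close> that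
          by auto
        then show ?thesis using \<open>V u v \<le> 0\<close> by linarith
      qed
      from this[of r z] this[of z r] that show ?thesis by (cases "r \<le> z") auto
    qed
    show ?case
    proof (intro exI[of _ d] conjI allI impI d(1) ballI)
      fix u v r assume *: "u \<le> y \<and> y \<le> v \<and> v - u < d" "s \<le> u" "v \<le> t" "\<exists>z\<in>{u..v}. x z = 0" "r \<in> {u..v}"
      then obtain z where z: "z \<in> {u..v}" "x z = 0" by blast
      have w: "weight a c u y \<le> 1" "weight a c y v \<le> 1" using d(2)[of u v] * by auto
      \<comment> \<open>The base point is an endpoint of both pieces, so a zero in one of them
        reaches the other through \<open>y\<close>.\<close>
      have "x y = 0"
      proof (cases "z \<le> y")
        case True
        show ?thesis by (rule piece[OF _ _ _ w(1) _ z(2)]) (use * z True in auto)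
      next
        case False
        show ?thesis by (rule piece[OF _ _ _ w(2) _ z(2)]) (use * z False in auto)
      qed
      then show "x r = 0"
      proof (cases "r \<le> y")
        case True
        show ?thesis by (rule piece[OF _ _ _ w(1) _ \<open>x y = 0\<close>]) (use * True in auto)
      next
        case False
        show ?thesis by (rule piece[OF _ _ _ w(2) _ \<open>x y = 0\<close>]) (use * False in auto)
      qed
    qed
  qed
  then show ?thesis using z r by blast
qed

end

section \<open>Chopping an interval into few good pieces\<close>

text \<open>The index counts cuts, so there are \<open>n + 1\<close> pieces. Peeling from the left
  and allowing degenerate pieces lets initial pieces be merged or replaced by mere
  unfolding.\<close>

fun chop :: "(real \<Rightarrow> real \<Rightarrow> bool) \<Rightarrow> nat \<Rightarrow> real \<Rightarrow> real \<Rightarrow> bool" where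
  "chop P 0 a b \<longleftrightarrow> P a b"
| "chop P (Suc n) a b \<longleftrightarrow> (\<exists>c. a \<le> c \<and> c \<le> b \<and> P a c \<and> chop P n c b)"

lemma chop_of_partition:
  assumes "partition_of a b (Suc n) t" "\<And>i. i < Suc n \<Longrightarrow> P (t i) (t (Suc i))"
  shows "chop P n a b"
  using assms
proof (induction n arbitrary: a t)
  case 0
  then show ?case by (auto simp: partition_of_def)
next
  case (Suc n)
  have pt: "partition_of (t (Suc 0)) b (Suc n) (\<lambda>i. t (Suc i))"
    using Suc.prems(1) by (auto simp: partition_of_def)
  have "chop P n (t (Suc 0)) b" using Suc.prems(2) by (intro Suc.IH[OF pt]) auto
  moreover have "P a (t (Suc 0))" "a \<le> t (Suc 0)" "t (Suc 0) \<le> b"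
    using Suc.prems(2)[of 0] partition_of_bounds[OF Suc.prems(1), of "Suc 0"] Suc.prems(1)
    by (auto simp: partition_of_def)
  ultimately show ?case by auto
qed

text \<open>Two pieces are removed at a time. If the first two could be merged, the chopping would
  not be minimal; hence their union is bad and uses up more than 1 of \<open>\<Phi>\<close>.
  Minimality passes to the rest, since a shorter chopping of it could be put behind the two
  pieces.\<close>

lemma chop_minimal_le:
  assumes super: "\<And>u v w. \<lbrakk>a \<le> u; u \<le> v; v \<le> w; w \<le> b\<rbrakk> \<Longrightarrow> \<Phi> u v + \<Phi> v w \<le> \<Phi> u w"
    and nn: "\<And>u v. \<lbrakk>a \<le> u; u \<le> v; v \<le> b\<rbrakk> \<Longrightarrow> 0 \<le> \<Phi> u v"
    and big: "\<And>u v. \<lbrakk>a \<le> u; u \<le> v; v \<le> b; \<not> P u v\<rbrakk> \<Longrightarrow> 1 < \<Phi> u v"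
    and u: "a \<le> u" "u \<le> b" and n: "chop P n u b" and min: "\<And>m. m < n \<Longrightarrow> \<not> chop P m u b"
  shows "real n \<le> 2 * \<Phi> u b"
  using u n min
proof (induction n arbitrary: u rule: less_induct)
  case (less n)
  consider "n = 0" | "n = 1" | m where "n = Suc (Suc m)" by (metis One_nat_def old.nat.exhaust)
  then show ?case
  proof cases
    case 1
    then show ?thesis using nn[of u b] less.prems by simp
  next
    case 2
    then have "\<not> P u b" using less.prems(4)[of 0] by simp
    then show ?thesis using big[of u b] less.prems(1,2) 2 by simp
  next
    case (3 m)
    then obtain c d where cd: "u \<le> c" "c \<le> d" "d \<le> b" "P u c" "P c d" "chop P m d b"
      using less.prems(3) by auto
    have ud: "u \<le> d" using cd by simp
    have "\<not> P u d"
    proof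
      assume "P u d"
      then have "chop P (Suc m) u b" using cd ud by (auto intro!: exI[of _ d])
      then show False using less.prems(4)[of "Suc m"] 3 by simp
    qed
    then have 1: "1 < \<Phi> u d" using big cd ud less.prems(1) by simp
    have "\<not> chop P k d b" if "k < m" for k
    proof
      assume "chop P k d b"
      then have "chop P (Suc (Suc k)) u b"
        using cd order_trans[OF cd(2,3)] unfolding chop.simps by blast
      then show False using less.prems(4)[of "Suc (Suc k)"] 3 that by simp
    qed
    then have "real m \<le> 2 * \<Phi> d b" using less.IH[of m d] 3 cd ud less.prems(1) by simp
    then show ?thesis using super[of u d b] 1 cd ud less.prems(1) 3 by simp
  qed
qed

lemma chop_subadditive:
  assumes sub: "\<And>u v w. \<lbrakk>a \<le> u; u \<le> v; v \<le> w; w \<le> b\<rbrakk> \<Longrightarrow> G u w \<le> G u v + G v w"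
    and good: "\<And>u v. \<lbrakk>a \<le> u; u \<le> v; v \<le> b; P u v\<rbrakk> \<Longrightarrow> G u v \<le> \<kappa>"
    and u: "a \<le> u" "u \<le> b" and n: "chop P n u b"
  shows "G u b \<le> (real n + 1) * (\<kappa>::real)"
  using u n
proof (induction n arbitrary: u)
  case 0
  then show ?case using good by simp
next
  case (Suc n)
  then obtain c where c: "u \<le> c" "c \<le> b" "P u c" "chop P n c b" by auto
  have "G u b \<le> G u c + G c b" using sub c Suc.prems by simp
  also have "\<dots> \<le> \<kappa> + (real n + 1) * \<kappa>" using Suc.IH[of c] good[of u c] c Suc.prems by (intro add_mono) auto
  finally show ?case by (simp add: algebra_simps)
qed

section \<open>Variation of the normalised solution\<close>

text \<open>By the law of cosines, \<open>\<alpha> * \<beta>\<close> times the squared left-hand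
  side is \<open>2 * \<alpha> * \<beta> - 2 * (a \<bullet> b)\<close>, which differs from the square
  of \<open>norm (a - b)\<close> by the square of \<open>\<alpha> - \<beta>\<close>. The triangle
  inequality alone would cost a factor 2.\<close>

lemma norm_normalize_diff_le:
  fixes a b :: "'a::real_inner"
  assumes m: "0 < m" "m \<le> norm a" "m \<le> norm b"
  shows "norm (a /\<^sub>R norm a - b /\<^sub>R norm b) \<le> norm (a - b) / m"
proof -
  define \<alpha> \<beta> where "\<alpha> = norm a" and "\<beta> = norm b"
  have ab: "0 < \<alpha>" "0 < \<beta>" "m \<le> \<alpha>" "m \<le> \<beta>" using m by (auto simp: \<alpha>_def \<beta>_def)
  have sq: "a \<bullet> a = \<alpha>\<^sup>2" "b \<bullet> b = \<beta>\<^sup>2" by (simp_all add: \<alpha>_def \<beta>_def power2_norm_eq_inner)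
  have n1: "(norm (a /\<^sub>R \<alpha> - b /\<^sub>R \<beta>))\<^sup>2 = 2 - 2 * (a \<bullet> b) / (\<alpha> * \<beta>)"
  proof -
    have "(norm (a /\<^sub>R \<alpha> - b /\<^sub>R \<beta>))\<^sup>2
        = inverse \<alpha> * inverse \<alpha> * \<alpha>\<^sup>2 + inverse \<beta> * inverse \<beta> * \<beta>\<^sup>2 - 2 * (inverse \<alpha> * inverse \<beta> * (a \<bullet> b))"
      unfolding power2_norm_eq_inner inner_diff_left inner_diff_right
      by (simp add: inner_commute[of b a] sq)
    then show ?thesis using ab by (simp add: power2_eq_square field_simps)
  qed
  have n2: "(norm (a - b))\<^sup>2 = \<alpha>\<^sup>2 + \<beta>\<^sup>2 - 2 * (a \<bullet> b)"
    by (simp add: power2_norm_eq_inner inner_diff_left inner_diff_right inner_commute[of b a] sq)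
  have "(m * norm (a /\<^sub>R \<alpha> - b /\<^sub>R \<beta>))\<^sup>2 = m * m * (norm (a /\<^sub>R \<alpha> - b /\<^sub>R \<beta>))\<^sup>2"
    by (simp add: power2_eq_square algebra_simps)
  also have "\<dots> \<le> \<alpha> * \<beta> * (norm (a /\<^sub>R \<alpha> - b /\<^sub>R \<beta>))\<^sup>2"
    using ab m by (intro mult_right_mono mult_mono) auto
  also have "\<dots> = 2 * \<alpha> * \<beta> - 2 * (a \<bullet> b)" unfolding n1 using ab by (simp add: field_simps)
  also have "\<dots> \<le> (norm (a - b))\<^sup>2" unfolding n2 using sum_squares_bound[of \<alpha> \<beta>] by simp
  finally have "m * norm (a /\<^sub>R \<alpha> - b /\<^sub>R \<beta>) \<le> norm (a - b)"
    by (rule power2_le_imp_le) simp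
  then show ?thesis using m by (simp add: \<alpha>_def \<beta>_def field_simps)
qed

context yde_path
begin

abbreviation "y r \<equiv> x r /\<^sub>R norm (x r)"

lemma min_norm_attained:
  assumes st: "0 \<le> s" "s \<le> t"
  obtains z where "z \<in> {s..t}" "\<And>r. r \<in> {s..t} \<Longrightarrow> norm (x z) \<le> norm (x r)"
proof -
  have "continuous_on {s..t} (\<lambda>r. norm (x r))"
    using x_Cpvar[OF st] by (auto simp: in_Cpvar_def intro: continuous_intros)
  then show ?thesis
    using continuous_attains_inf[of "{s..t}" "\<lambda>r. norm (x r)"] st that by auto
qed

lemma y_variation_le:
  assumes st: "0 \<le> s" "s \<le> t" and nz: "x z \<noteq> 0" and min: "\<And>r. r \<in> {s..t} \<Longrightarrow> norm (x z) \<le> norm (x r)"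
  shows "bdd_above (pvar_sums q y s t)" "pvar_seminorm q y s t \<le> V s t / norm (x z)"
proof -
  have pos: "0 < norm (x z)" using nz by simp
  have sa: "supadd q (\<lambda>u v. (1 / norm (x z)) * V u v) s t"
    using q_gt_1 bdd_x[OF st] by (intro supadd_mult supadd_pvar) auto
  have le: "norm (y v - y u) \<le> (1 / norm (x z)) * V u v" if "s \<le> u" "u \<le> v" "v \<le> t" for u v
  proof -
    have "norm (y v - y u) \<le> norm (x v - x u) / norm (x z)"
      using that min pos by (intro norm_normalize_diff_le) auto
    also have "\<dots> \<le> V u v / norm (x z)"
      using norm_diff_le_pvar[OF _ bdd_x[OF st], of u v] that q_gt_1 by (intro divide_right_mono) auto
    finally show ?thesis by simp
  qed
  show "bdd_above (pvar_sums q y s t)" "pvar_seminorm q y s t \<le> V s t / norm (x z)"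
    using pvar_le_supadd[OF _ sa st(2) le] q_gt_1 by auto
qed

lemma y_bdd:
  assumes st: "0 \<le> s" "s \<le> t" and nz: "\<And>r. r \<in> {s..t} \<Longrightarrow> x r \<noteq> 0"
  shows "bdd_above (pvar_sums q y s t)"
  using min_norm_attained[OF st] y_variation_le(1)[OF st] nz by metis

text \<open>With the minimum of the norm as reference point, the factor \<open>norm (x z)\<close> of
  \<open>variation_small\<close> cancels the denominator produced by normalising.\<close>

lemma y_variation_small:
  assumes cb: "coeff_bound a c s t" and nz: "\<And>r. r \<in> {s..t} \<Longrightarrow> x r \<noteq> 0" and w: "weight a c s t \<le> 1"
  shows "pvar_seminorm q y s t \<le> 2 / 13 * weight a c s t"
proof -
  note cbd = coeff_boundD[OF cb]
  obtain z where z: "z \<in> {s..t}" "\<And>r. r \<in> {s..t} \<Longrightarrow> norm (x z) \<le> norm (x r)"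
    using min_norm_attained[OF cbd(1,2)] by blast
  have pos: "0 < norm (x z)" using nz z by simp
  have "pvar_seminorm q y s t \<le> V s t / norm (x z)" using y_variation_le(2)[OF cbd(1,2) _ z(2)] pos by simp
  also have "\<dots> \<le> 2 / 13 * weight a c s t * norm (x z) / norm (x z)"
    using variation_small[OF cb w z(1)] by (intro divide_right_mono) auto
  finally show ?thesis using pos by simp
qed

text \<open>A minimal chopping into pieces of weight at most 1 has few pieces, because the union of two
  consecutive ones has weight above 1 and the \<open>p\<close>-th power of the weight is dominated by a
  superadditive function.\<close>

lemma y_variation:
  assumes cb: "coeff_bound a c s t" and nz: "\<And>r. r \<in> {s..t} \<Longrightarrow> x r \<noteq> 0" and len: "t \<le> s + 1"
  shows "pvar_seminorm q y s t
    \<le> 8 * a + 16 * K * c * W s t + (8 * a) powr p + (16 * K * c * W s t) powr p"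
proof -
  note cbd = coeff_boundD[OF cb]
  have kc: "0 \<le> 16 * K * c" using cbd K_ge_1 by simp
  let ?w = "weight a c"
  have w_le: "?w s t \<le> 8 * a + 16 * K * c * W s t"
    using mult_left_mono[of "t - s" 1 "8 * a"] cbd len by (simp add: weight_def)
  have w0: "0 \<le> ?w s t" using cbd kc by (simp add: weight_def)
  have nn: "0 \<le> (8 * a) powr p" "0 \<le> (16 * K * c * W s t) powr p" by simp_all
  show ?thesis
  proof (cases "?w s t \<le> 1")
    case True
    then show ?thesis using y_variation_small[OF cb nz] w_le w0 nn by linarith
  next
    case False
    then have st: "s < t" using cbd p by (cases "s = t") (auto simp: weight_def)
    \<comment> \<open>\<open>2 powr (p - 1)\<close> is the convexity constant for the weight one
      half; it separates the weight into the two \<open>p\<close>-th powers that occur in the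
      claim.\<close>
    define \<Phi> where "\<Phi> u v = 2 powr (p - 1) * ((8 * a * (v - u)) powr p + (16 * K * c * W u v) powr p)" for u v
    have sl: "supadd p (\<lambda>u v. 8 * a * (v - u)) s t" using p cbd by (intro supadd_mult supadd_length) auto
    have sw: "supadd p (\<lambda>u v. 16 * K * c * W u v) s t" using kc cbd by (intro supadd_mult supadd_W) auto
    have w\<Phi>: "?w u v powr p \<le> \<Phi> u v" if "s \<le> u" "u \<le> v" "v \<le> t" for u v
    proof -
      have half: "(1 / 2) powr (1 - p) = 2 powr (p - 1)"
        using powr_minus_divide[of "2::real" "1 - p"] by (simp add: powr_divide)
      have "(8 * a * (v - u) + 16 * K * c * W u v) powr p \<le>
         (1 / 2) powr (1 - p) * (8 * a * (v - u)) powr p + (1 - 1 / 2) powr (1 - p) * (16 * K * c * W u v) powr p"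
        using p that cbd kc by (intro convex_powr_split) auto
      then show ?thesis by (simp add: weight_def \<Phi>_def half distrib_left)
    qed
    have super: "\<Phi> u v + \<Phi> v w \<le> \<Phi> u w" if "s \<le> u" "u \<le> v" "v \<le> w" "w \<le> t" for u v w
    proof -
      have "2 powr (p - 1) * (((8 * a * (v - u)) powr p + (8 * a * (w - v)) powr p)
         + ((16 * K * c * W u v) powr p + (16 * K * c * W v w) powr p)) \<le> \<Phi> u w"
        unfolding \<Phi>_def using supaddD(2)[OF sl that] supaddD(2)[OF sw that]
        by (intro mult_left_mono add_mono) auto
      then show ?thesis by (simp add: \<Phi>_def algebra_simps)
    qed
    have \<Phi>0: "0 \<le> \<Phi> u v" for u v by (simp add: \<Phi>_def)
    have big: "1 < \<Phi> u v" if "s \<le> u" "u \<le> v" "v \<le> t" "\<not> ?w u v \<le> 1" for u v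
    proof -
      have "1 powr p < ?w u v powr p" using that(4) p by (intro powr_less_mono2) auto
      then show ?thesis using w\<Phi>[OF that(1-3)] by simp
    qed
    obtain n r where r: "partition_of s t n r" "\<forall>i<n. ?w (r i) (r (Suc i)) \<le> 1"
      using partition_good[OF cbd(2), of "\<lambda>u v. ?w u v \<le> 1"] weight_small[OF cb] by auto
    obtain n' where "n = Suc n'" using r(1) st by (cases n) (auto simp: partition_of_def)
    then have ex: "\<exists>n. chop (\<lambda>u v. ?w u v \<le> 1) n s t"
      using chop_of_partition[of s t n' r "\<lambda>u v. ?w u v \<le> 1"] r by auto
    define N where "N = (LEAST n. chop (\<lambda>u v. ?w u v \<le> 1) n s t)"
    have N: "chop (\<lambda>u v. ?w u v \<le> 1) N s t" unfolding N_def by (rule LeastI_ex[OF ex])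
    have Nmin: "\<not> chop (\<lambda>u v. ?w u v \<le> 1) m s t" if "m < N" for m
      using not_less_Least that unfolding N_def by blast
    have N\<Phi>: "real N \<le> 2 * \<Phi> s t"
      by (rule chop_minimal_le[where a = s and P = "\<lambda>u v. ?w u v \<le> 1"])
        (use super \<Phi>0 big cbd N Nmin in auto)
    have "pvar_seminorm q y s t \<le> (real N + 1) * (2 / 13)"
    proof (rule chop_subadditive[where a = s and P = "\<lambda>u v. ?w u v \<le> 1" and G = "pvar_seminorm q y"])
      show "pvar_seminorm q y u w \<le> pvar_seminorm q y u v + pvar_seminorm q y v w"
        if "s \<le> u" "u \<le> v" "v \<le> w" "w \<le> t" for u v w
        using that q_gt_1 cbd nz by (intro pvar_subadd y_bdd) auto
      show "pvar_seminorm q y u v \<le> 2 / 13" if "s \<le> u" "u \<le> v" "v \<le> t" "?w u v \<le> 1" for u v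
        using y_variation_small[OF coeff_bound_subinterval[OF cb that(1-3)] _ that(4)] nz that by force
    qed (use N cbd in auto)
    \<comment> \<open>There are \<open>N + 1\<close> pieces, and the extra one is paid by the
      weight, which exceeds 1 here. Since \<open>\<Phi> s t\<close> is at most twice the sum of the
      two powers, 4 * 2/13 < 1 then removes all numerical factors.\<close>
    also have "\<dots> \<le> (2 * \<Phi> s t + ?w s t) * (2 / 13)" using N\<Phi> False by simp
    finally have "pvar_seminorm q y s t \<le> (2 * \<Phi> s t + ?w s t) * (2 / 13)" .
    moreover have "\<Phi> s t \<le> 2 * ((8 * a) powr p + (16 * K * c * W s t) powr p)"
    proof -
      have "2 powr (p - 1) \<le> 2 powr 1" using p by (intro powr_mono) auto
      moreover have "(8 * a * (t - s)) powr p \<le> (8 * a) powr p"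
        using p cbd len mult_left_mono[of "t - s" 1 "8 * a"] by (intro powr_mono2) auto
      ultimately show ?thesis unfolding \<Phi>_def by (intro mult_mono add_mono) auto
    qed
    moreover have "Y \<le> g + A + B"
      if "Y \<le> (2 * F + w) * (2 / 13)" "F \<le> 2 * (A + B)" "w \<le> g" "0 \<le> w" "0 \<le> A" "0 \<le> B"
      for Y F w g A B :: real using that by (simp add: algebra_simps)
    ultimately show ?thesis using w_le w0 nn by blast
  qed
qed

end

section \<open>Growth of the logarithm of the norm\<close>

text \<open>Squared norms are exactly quadratic in the increment, so \<open>ln z \<le> z - 1\<close>
  at the ratio of the squares is a second-order upper bound valid for increments of any
  size.\<close>

lemma ln_norm_diff_le:
  fixes a b :: "'a::real_inner"
  assumes "a \<noteq> 0" "b \<noteq> 0"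
  shows "ln (norm b) - ln (norm a) \<le> (a \<bullet> (b - a)) / (norm a)\<^sup>2 + (norm (b - a))\<^sup>2 / (2 * (norm a)\<^sup>2)"
proof -
  have pos: "0 < norm a" "0 < norm b" using assms by auto
  have "2 * (ln (norm b) - ln (norm a)) = ln ((norm b)\<^sup>2 / (norm a)\<^sup>2)"
    using pos by (simp add: ln_div ln_realpow)
  also have "\<dots> \<le> (norm b)\<^sup>2 / (norm a)\<^sup>2 - 1" using pos by (intro ln_le_minus_one) auto
  also have "(norm b)\<^sup>2 = (norm a)\<^sup>2 + 2 * (a \<bullet> (b - a)) + (norm (b - a))\<^sup>2"
    by (simp add: power2_norm_eq_inner inner_diff_left inner_diff_right inner_commute)
  also have "\<dots> / (norm a)\<^sup>2 - 1 = 2 * (a \<bullet> (b - a)) / (norm a)\<^sup>2 + (norm (b - a))\<^sup>2 / (norm a)\<^sup>2"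
    using pos by (simp add: add_divide_distrib)
  finally show ?thesis using pos by (simp add: field_simps)
qed

context yde_path
begin

abbreviation "growth u \<equiv> (x u \<bullet> (C u *v x u)) / (norm (x u))\<^sup>2"

lemma hf_integrable:
  assumes "0 \<le> u" "u \<le> v"
  shows "(\<lambda>r. f r - h r) integrable_on {u..v}"
proof -
  have "h integrable_on {u..v}"
    using integrable_on_subinterval[OF h_integrable[of v], of u v] assms by auto
  moreover have "f integrable_on {u..v}"
    using f_cont assms by (intro integrable_continuous_interval continuous_on_subset[OF f_cont]) auto
  ultimately show ?thesis by (intro integrable_diff) auto
qed

text \<open>Dissipativity tested at one nonzero vector bounds \<open>h\<close> by the operator norm
  of \<open>A\<close>. The resulting two-sided bound controls the error when
  \<open>norm (x r)\<close> is replaced by \<open>norm (x u)\<close> in the dissipation.\<close>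

lemma h_bound:
  assumes cb: "coeff_bound a c s t" and r: "r \<in> {s..t}" and nz: "z \<noteq> (0 :: real^'d)"
  shows "\<bar>f r - h r\<bar> \<le> a"
proof -
  have r0: "0 \<le> r" using coeff_boundD(1)[OF cb] r by auto
  have "h r * (norm z)\<^sup>2 \<le> - (z \<bullet> (A r *v z))" using A_diss[OF r0, of z] by simp
  also have "\<dots> \<le> norm z * norm (A r *v z)" using Cauchy_Schwarz_ineq2[of z "A r *v z"] by linarith
  also have "\<dots> \<le> norm z * (norm (mat_op (A r)) * norm z)"
    by (intro mult_left_mono norm_matrix_vector_le) auto
  finally have "h r \<le> norm (mat_op (A r))" using nz by (simp add: power2_eq_square)
  then show ?thesis
    using coeff_boundD(6)[OF cb r] h_nonneg[OF r0] f_pos[OF r0] norm_ge_zero[of "mat_op (A r)"] by linarith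
qed

lemma inner_drift_le:
  assumes cb: "coeff_bound a c s t" and X: "\<And>r. r \<in> {s..t} \<Longrightarrow> norm (x r) \<le> X"
    and u: "u \<in> {s..t}" and r: "r \<in> {s..t}" and d: "norm (x r - x u) \<le> d" and nz: "x u \<noteq> 0"
  shows "x u \<bullet> drift r \<le> (f r - h r) * (norm (x u))\<^sup>2 + 3 * a * X * d"
proof -
  note cbd = coeff_boundD[OF cb]
  have r0: "0 \<le> r" using cbd r by auto
  have d0: "0 \<le> d" using d norm_ge_zero order_trans by blast
  have X0: "0 \<le> X" using order_trans[OF norm_ge_zero X[OF u]] .
  have "x r \<bullet> F r (x r) \<le> norm (x r) * norm (F r (x r))" by (rule norm_cauchy_schwarz)
  also have "\<dots> \<le> norm (x r) * (f r * norm (x r))"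
    using F_lipschitz[OF r0, of "x r" 0] F_zero[OF r0] by (intro mult_left_mono) auto
  finally have 1: "x r \<bullet> drift r \<le> (f r - h r) * (norm (x r))\<^sup>2"
    using A_diss[OF r0, of "x r"] by (simp add: inner_add_right algebra_simps power2_eq_square)
  have "(x u - x r) \<bullet> drift r \<le> norm (x u - x r) * norm (drift r)" by (rule norm_cauchy_schwarz)
  also have "\<dots> \<le> d * (a * X)"
    using d d0 norm_drift_le[OF cb r] X[OF r] cbd(3) mult_left_mono[of "norm (x r)" X a]
    by (intro mult_mono) (auto simp: norm_minus_commute)
  finally have 2: "(x u - x r) \<bullet> drift r \<le> a * X * d" by (simp add: mult_ac)
  have "\<bar>(norm (x r))\<^sup>2 - (norm (x u))\<^sup>2\<bar> = \<bar>norm (x r) - norm (x u)\<bar> * (norm (x r) + norm (x u))"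
    by (simp add: power2_eq_square square_diff_square_factored abs_mult)
  also have "\<dots> \<le> d * (X + X)"
    using norm_triangle_ineq3[of "x r" "x u"] d d0 X[OF u] X[OF r] by (intro mult_mono add_mono) auto
  finally have "\<bar>f r - h r\<bar> * \<bar>(norm (x r))\<^sup>2 - (norm (x u))\<^sup>2\<bar> \<le> a * (d * (X + X))"
    using h_bound[OF cb r nz] cbd(3) by (intro mult_mono) auto
  then have "(f r - h r) * ((norm (x r))\<^sup>2 - (norm (x u))\<^sup>2) \<le> 2 * a * X * d"
    unfolding abs_mult[symmetric] by (simp add: algebra_simps)
  then have "(f r - h r) * (norm (x r))\<^sup>2 \<le> (f r - h r) * (norm (x u))\<^sup>2 + 2 * a * X * d"
    by (simp add: algebra_simps)
  moreover have "x u \<bullet> drift r = x r \<bullet> drift r + (x u - x r) \<bullet> drift r" by (simp add: inner_diff_left)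
  ultimately show ?thesis using 1 2 by simp
qed

text \<open>The errors are those of freezing \<open>x u\<close> in the drift, of the left-point
  approximation (\<open>R\<close>) and of the quadratic Taylor term. On the step, \<open>x r\<close>
  stays within \<open>M * (2 * e)\<close> of \<open>x u\<close>, one \<open>e\<close> for the length
  and one for \<open>W\<close>; with the 3 of \<open>inner_drift_le\<close> this makes the
  6.\<close>

lemma ln_norm_step:
  assumes cb: "coeff_bound a c s t" and X: "\<And>r. r \<in> {s..t} \<Longrightarrow> norm (x r) \<le> X"
    and m: "0 < m" "\<And>r. r \<in> {s..t} \<Longrightarrow> m \<le> norm (x r)"
    and M: "a * X \<le> M" "K * c * (2 * X + V s t) \<le> M"
    and uv: "s \<le> u" "u \<le> v" "v \<le> t" and e: "W u v \<le> e" "v - u \<le> e"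
  shows "ln (norm (x v)) - ln (norm (x u)) \<le> integral {u..v} (\<lambda>r. f r - h r) + (\<omega> v - \<omega> u) * growth u
    + (6 * a * X * M * e / m\<^sup>2 * (v - u) + K / m * (pvar_seminorm q (\<lambda>s. C s *v x s) u v * W u v)
      + M\<^sup>2 / m\<^sup>2 * ((v - u)\<^sup>2 + (W u v)\<^sup>2))"
proof -
  note cbd = coeff_boundD[OF cb]
  note cbs = coeff_bound_subinterval[OF cb uv]
  have us: "u \<in> {s..t}" and vs: "v \<in> {s..t}" using uv by auto
  have u0: "0 \<le> u" using cbd uv by simp
  have X0: "0 \<le> X" using order_trans[OF norm_ge_zero X[OF us]] .
  have M0: "0 \<le> M" using M(1) cbd(3) X0 by (meson mult_nonneg_nonneg order_trans)
  have nu: "m \<le> norm (x u)" "0 < norm (x u)" "x u \<noteq> 0" "x v \<noteq> 0"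
    using m(2)[OF us] m(2)[OF vs] m(1) by auto
  have X': "\<And>r. r \<in> {u..v} \<Longrightarrow> norm (x r) \<le> X" using X uv by simp
  have inc: "norm (x r - x u) \<le> M * ((r - u) + W u r)" if "r \<in> {u..v}" for r
  proof -
    have "norm (x r - x u) \<le> (a * X) * (r - u) + (K * c * (2 * X + V s t)) * W u r"
      using increment_bound[OF cb X, of u r] that uv by auto
    also have "\<dots> \<le> M * (r - u) + M * W u r" using M that by (intro add_mono mult_right_mono) auto
    finally show ?thesis by (simp add: algebra_simps)
  qed
  obtain I where I: "(drift has_integral I) {u..v}"
    "norm (x v - x u - I - (\<omega> v - \<omega> u) *\<^sub>R (C u *v x u))
      \<le> K * (pvar_seminorm q (\<lambda>s. C s *v x s) u v * W u v)"
    using solution_increment[OF u0 uv(2) Cx_variation(1)[OF cbs X']] by blast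
  define R where "R = x v - x u - I - (\<omega> v - \<omega> u) *\<^sub>R (C u *v x u)"
  have "x u \<bullet> I \<le> integral {u..v} (\<lambda>r. f r - h r) * (norm (x u))\<^sup>2 + 6 * a * X * M * e * (v - u)"
  proof (rule has_integral_le)
    show "((\<lambda>r. x u \<bullet> drift r) has_integral x u \<bullet> I) {u..v}"
      using has_integral_linear[OF I(1) bounded_linear_inner_right[of "x u"]] by (simp add: o_def)
    have "((\<lambda>r. f r - h r) has_integral integral {u..v} (\<lambda>r. f r - h r)) {u..v}"
      using hf_integrable[OF u0 uv(2)] by (rule integrable_integral)
    moreover have "((\<lambda>r. 6 * a * X * M * e) has_integral 6 * a * X * M * e * (v - u)) {u..v}"
      using has_integral_const_real[of "6 * a * X * M * e" u v] uv by (simp add: mult_ac)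
    ultimately show "((\<lambda>r. (f r - h r) * (norm (x u))\<^sup>2 + 6 * a * X * M * e) has_integral
        integral {u..v} (\<lambda>r. f r - h r) * (norm (x u))\<^sup>2 + 6 * a * X * M * e * (v - u)) {u..v}"
      by (intro has_integral_add has_integral_mult_left)
    show "x u \<bullet> drift r \<le> (f r - h r) * (norm (x u))\<^sup>2 + 6 * a * X * M * e" if r: "r \<in> {u..v}" for r
    proof -
      have "W u r \<le> e" using W_mono[of u u r v] u0 r e by auto
      then have "M * ((r - u) + W u r) \<le> M * (2 * e)" using r e M0 by (intro mult_left_mono) auto
      with inc[OF r] have "norm (x r - x u) \<le> M * (2 * e)" by simp
      from inner_drift_le[OF cb X us _ this nu(3)] r uv show ?thesis by (simp add: algebra_simps)
    qed
  qed
  then have "(x u \<bullet> I) / (norm (x u))\<^sup>2 \<le>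
      (integral {u..v} (\<lambda>r. f r - h r) * (norm (x u))\<^sup>2 + 6 * a * X * M * e * (v - u)) / (norm (x u))\<^sup>2"
    by (intro divide_right_mono) auto
  also have "\<dots> = integral {u..v} (\<lambda>r. f r - h r) + 6 * a * X * M * e * (v - u) / (norm (x u))\<^sup>2"
    using nu by (simp add: add_divide_distrib)
  also have "6 * a * X * M * e * (v - u) / (norm (x u))\<^sup>2 \<le> 6 * a * X * M * e * (v - u) / m\<^sup>2"
    using nu m(1) cbd(3) X0 M0 e uv by (intro divide_left_mono mult_nonneg_nonneg power_mono) auto
  finally have 1: "(x u \<bullet> I) / (norm (x u))\<^sup>2 \<le> integral {u..v} (\<lambda>r. f r - h r) + 6 * a * X * M * e / m\<^sup>2 * (v - u)"
    by simp
  have "x u \<bullet> R \<le> norm (x u) * norm R" by (rule norm_cauchy_schwarz)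
  then have "(x u \<bullet> R) / (norm (x u))\<^sup>2 \<le> norm R / norm (x u)"
    using nu by (simp add: field_simps power2_eq_square)
  also have "\<dots> \<le> norm R / m" using nu m(1) by (intro divide_left_mono) auto
  also have "\<dots> \<le> K * (pvar_seminorm q (\<lambda>s. C s *v x s) u v * W u v) / m"
    using I(2) m(1) by (intro divide_right_mono) (auto simp: R_def)
  finally have 2: "(x u \<bullet> R) / (norm (x u))\<^sup>2 \<le> K / m * (pvar_seminorm q (\<lambda>s. C s *v x s) u v * W u v)"
    by simp
  have "(norm (x v - x u))\<^sup>2 \<le> (M * ((v - u) + W u v))\<^sup>2"
    using inc[of v] uv by (intro power_mono) auto
  also have "\<dots> = M\<^sup>2 * ((v - u) + W u v)\<^sup>2" by (simp add: power_mult_distrib)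
  also have "\<dots> \<le> M\<^sup>2 * (2 * ((v - u)\<^sup>2 + (W u v)\<^sup>2))"
    using sum_squares_bound[of "v - u" "W u v"] by (intro mult_left_mono) (auto simp: power2_sum)
  finally have "(norm (x v - x u))\<^sup>2 / (2 * (norm (x u))\<^sup>2) \<le> M\<^sup>2 * (2 * ((v - u)\<^sup>2 + (W u v)\<^sup>2)) / (2 * m\<^sup>2)"
    using nu m(1) by (intro frac_le mult_left_mono power_mono) auto
  then have 3: "(norm (x v - x u))\<^sup>2 / (2 * (norm (x u))\<^sup>2) \<le> M\<^sup>2 / m\<^sup>2 * ((v - u)\<^sup>2 + (W u v)\<^sup>2)"
    by (simp only: mult.left_commute[of _ 2] mult_divide_mult_cancel_left_if) simp
  have "x v - x u = I + (\<omega> v - \<omega> u) *\<^sub>R (C u *v x u) + R" by (simp add: R_def)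
  then have "(x u \<bullet> (x v - x u)) / (norm (x u))\<^sup>2 = (x u \<bullet> I) / (norm (x u))\<^sup>2 + (\<omega> v - \<omega> u) * growth u
      + (x u \<bullet> R) / (norm (x u))\<^sup>2"
    by (simp add: inner_add_right add_divide_distrib)
  then show ?thesis using ln_norm_diff_le[OF nu(3,4)] 1 2 3 by linarith
qed

text \<open>\<open>q / (q - 1)\<close> is conjugate to \<open>q\<close>, and \<open>p * (1 - 1 / q) < 1\<close> leaves a positive power of the
  small quantity \<open>b\<close> to spare.\<close>

lemma product_small:
  assumes "0 \<le> \<alpha>" "0 \<le> b" "b \<le> e"
  shows "\<alpha> * b \<le> e powr (1 - p * (1 - 1 / q)) * (\<alpha> powr q + b powr p)"
proof -
  define \<sigma> where "\<sigma> = p * (1 - 1 / q)"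
  have \<sigma>: "0 < \<sigma>" "\<sigma> < 1" using p q q_gt_1 by (auto simp: \<sigma>_def field_simps)
  have "\<alpha> * b = (\<alpha> * b powr \<sigma>) * b powr (1 - \<sigma>)"
    using assms powr_add[of b \<sigma> "1 - \<sigma>"] by simp
  also have "\<dots> \<le> (\<alpha> powr q + b powr p) * e powr (1 - \<sigma>)"
  proof (intro mult_mono)
    have "\<alpha> * b powr \<sigma> \<le> \<alpha> powr q / q + (b powr \<sigma>) powr (q / (q - 1)) / (q / (q - 1))"
      using assms q_gt_1 by (intro Youngs_inequality) (auto simp: field_simps)
    also have "(b powr \<sigma>) powr (q / (q - 1)) = b powr p"
    proof -
      have "\<sigma> * (q / (q - 1)) = p" using q_gt_1 by (simp add: \<sigma>_def field_simps)
      then show ?thesis by (simp only: powr_powr)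
    qed
    also have "\<alpha> powr q / q + b powr p / (q / (q - 1)) \<le> \<alpha> powr q / 1 + b powr p / 1"
      using q_gt_1 by (intro add_mono divide_left_mono) (auto simp: field_simps)
    finally show "\<alpha> * b powr \<sigma> \<le> \<alpha> powr q + b powr p" by simp
    show "b powr (1 - \<sigma>) \<le> e powr (1 - \<sigma>)" using assms \<sigma> by (intro powr_mono2) auto
  qed auto
  finally show ?thesis by (simp add: \<sigma>_def mult.commute)
qed

text \<open>Each error sum is a positive power of \<open>e\<close> times a quantity that
  superadditivity fixes in advance: the Young remainder by \<open>product_small\<close>, the squares
  of \<open>W\<close> because \<open>2 - p\<close> powers are left over. \<open>B\<close> must serve
  all partitions, since the chosen one depends on \<open>e\<close>.\<close>

lemma ln_norm_growth_approx:
  assumes cb: "coeff_bound a c s t" and X: "\<And>r. r \<in> {s..t} \<Longrightarrow> norm (x r) \<le> X"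
    and m: "0 < m" "\<And>r. r \<in> {s..t} \<Longrightarrow> m \<le> norm (x r)"
    and M: "a * X \<le> M" "K * c * (2 * X + V s t) \<le> M"
    and B: "\<And>n \<tau>. partition_of s t n \<tau> \<Longrightarrow> (\<Sum>i<n. (\<omega> (\<tau> (Suc i)) - \<omega> (\<tau> i)) * growth (\<tau> i)) \<le> B"
    and e: "0 < e"
  defines "Z \<equiv> pvar_seminorm q (\<lambda>s. C s *v x s) s t powr q + W s t powr p"
  shows "ln (norm (x t)) - ln (norm (x s)) \<le> integral {s..t} (\<lambda>r. f r - h r) + B
    + (6 * a * X * M / m\<^sup>2 * (t - s) * e + K / m * Z * e powr (1 - p * (1 - 1 / q))
      + M\<^sup>2 / m\<^sup>2 * ((t - s) * e + Z * e powr (2 - p)))"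
proof -
  note cbd = coeff_boundD[OF cb]
  let ?Y = "pvar_seminorm q (\<lambda>s. C s *v x s)"
  have p0: "0 < p" using p by simp
  obtain n \<tau> where \<tau>: "partition_of s t n \<tau>" "\<And>i. i < n \<Longrightarrow> W (\<tau> i) (\<tau> (Suc i)) \<le> e \<and> \<tau> (Suc i) - \<tau> i \<le> e"
    using partition_good[OF cbd(2), of "\<lambda>u v. W u v \<le> e \<and> v - u \<le> e"]
      pvar_small[OF p0 \<omega>_Cpvar[OF cbd(1,2)] _ _ e] by force
  define L where "L i = \<tau> (Suc i) - \<tau> i" for i
  define w where "w i = W (\<tau> i) (\<tau> (Suc i))" for i
  define \<alpha> where "\<alpha> i = ?Y (\<tau> i) (\<tau> (Suc i))" for i
  have st: "\<tau> 0 = s" "\<tau> n = t" using \<tau>(1) by (auto simp: partition_of_def)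
  have step: "s \<le> \<tau> i" "\<tau> i \<le> \<tau> (Suc i)" "\<tau> (Suc i) \<le> t" "0 \<le> \<tau> i" if "i < n" for i
    using partition_of_bounds[OF \<tau>(1), of i] partition_of_bounds[OF \<tau>(1), of "Suc i"]
      partition_of_step(1)[OF \<tau>(1) that] that cbd(1) by auto
  have telescope: "(\<Sum>i<k. g (\<tau> (Suc i)) - g (\<tau> i)) = g (\<tau> k) - g (\<tau> 0)" for g :: "real \<Rightarrow> real" and k
    by (induction k) auto
  have sumw: "(\<Sum>i<n. w i powr p) \<le> W s t powr p"
    using supadd_sum_mono[OF supadd_W[OF cbd(1,2)], of \<tau> n] step st by (simp add: w_def)
  have sum\<alpha>: "(\<Sum>i<n. \<alpha> i powr q) \<le> ?Y s t powr q"
    using supadd_sum_mono[OF supadd_pvar[OF _ Cx_variation(1)[OF cb X]], of \<tau> n] step st q_gt_1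
    by (simp add: \<alpha>_def)
  have sumZ: "(\<Sum>i<n. \<alpha> i powr q + w i powr p) \<le> Z"
    using sumw sum\<alpha> by (simp add: sum.distrib Z_def)
  have sumL: "(\<Sum>i<n. L i) = t - s" using telescope[of "\<lambda>r. r" n] st by (simp add: L_def)
  have Lnn: "0 \<le> L i" "L i \<le> e" "w i \<le> e" "0 \<le> w i" "0 \<le> \<alpha> i" if "i < n" for i
    using step[OF that] \<tau>(2)[OF that] by (auto simp: L_def w_def \<alpha>_def)
  have "(\<Sum>i<n. \<alpha> i * w i) \<le> (\<Sum>i<n. e powr (1 - p * (1 - 1 / q)) * (\<alpha> i powr q + w i powr p))"
    using Lnn by (intro sum_mono product_small) auto
  also have "\<dots> \<le> e powr (1 - p * (1 - 1 / q)) * Z"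
    unfolding sum_distrib_left[symmetric] using sumZ by (intro mult_left_mono) auto
  finally have 1: "(\<Sum>i<n. \<alpha> i * w i) \<le> e powr (1 - p * (1 - 1 / q)) * Z" .
  have "(\<Sum>i<n. (L i)\<^sup>2) \<le> (\<Sum>i<n. L i * e)"
    using Lnn by (intro sum_mono) (auto simp: power2_eq_square intro!: mult_left_mono)
  then have 2: "(\<Sum>i<n. (L i)\<^sup>2) \<le> (t - s) * e" by (simp add: sumL sum_distrib_right[symmetric])
  have "(\<Sum>i<n. (w i)\<^sup>2) \<le> (\<Sum>i<n. w i powr p * e powr (2 - p))"
  proof (intro sum_mono)
    fix i assume i: "i \<in> {..<n}"
    have "(w i)\<^sup>2 = w i powr (p + (2 - p))" using Lnn(4)[of i] i by simp
    also have "\<dots> = w i powr p * w i powr (2 - p)" by (simp only: powr_add)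
    also have "\<dots> \<le> w i powr p * e powr (2 - p)"
      using Lnn[of i] i p by (intro mult_left_mono powr_mono2) auto
    finally show "(w i)\<^sup>2 \<le> w i powr p * e powr (2 - p)" .
  qed
  also have "\<dots> = (\<Sum>i<n. w i powr p) * e powr (2 - p)" by (simp only: sum_distrib_right)
  also have "\<dots> \<le> Z * e powr (2 - p)"
    using sumw by (intro mult_right_mono) (auto simp: Z_def intro: order_trans)
  finally have 3: "(\<Sum>i<n. (w i)\<^sup>2) \<le> Z * e powr (2 - p)" .
  have sumI: "k \<le> n \<Longrightarrow> (\<Sum>i<k. integral {\<tau> i..\<tau> (Suc i)} (\<lambda>r. f r - h r)) = integral {s..\<tau> k} (\<lambda>r. f r - h r)" for k
  proof (induction k)
    case 0
    then show ?case by (simp add: st)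
  next
    case (Suc k)
    then have k: "k < n" by simp
    have "integral {s..\<tau> k} (\<lambda>r. f r - h r) + integral {\<tau> k..\<tau> (Suc k)} (\<lambda>r. f r - h r)
        = integral {s..\<tau> (Suc k)} (\<lambda>r. f r - h r)"
      using step[OF k] cbd(1) by (intro Henstock_Kurzweil_Integration.integral_combine hf_integrable) auto
    then show ?case using Suc by simp
  qed
  have "ln (norm (x t)) - ln (norm (x s)) = (\<Sum>i<n. ln (norm (x (\<tau> (Suc i)))) - ln (norm (x (\<tau> i))))"
    using telescope[of "\<lambda>r. ln (norm (x r))" n] st by simp
  also have "\<dots> \<le> (\<Sum>i<n. integral {\<tau> i..\<tau> (Suc i)} (\<lambda>r. f r - h r) + (\<omega> (\<tau> (Suc i)) - \<omega> (\<tau> i)) * growth (\<tau> i)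
     + (6 * a * X * M * e / m\<^sup>2 * L i + K / m * (\<alpha> i * w i) + M\<^sup>2 / m\<^sup>2 * ((L i)\<^sup>2 + (w i)\<^sup>2)))"
    unfolding L_def w_def \<alpha>_def using step \<tau>(2)
    by (intro sum_mono ln_norm_step[OF cb X m M]) auto
  also have "\<dots> = integral {s..t} (\<lambda>r. f r - h r) + (\<Sum>i<n. (\<omega> (\<tau> (Suc i)) - \<omega> (\<tau> i)) * growth (\<tau> i))
     + (6 * a * X * M * e / m\<^sup>2 * (t - s) + K / m * (\<Sum>i<n. \<alpha> i * w i) + M\<^sup>2 / m\<^sup>2 * ((\<Sum>i<n. (L i)\<^sup>2) + (\<Sum>i<n. (w i)\<^sup>2)))"
    using sumI[of n] by (simp only: sum.distrib sum_distrib_left[symmetric] sumL st order_refl simp_thms True_implies_equals)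
  also have "\<dots> \<le> integral {s..t} (\<lambda>r. f r - h r) + B
     + (6 * a * X * M * e / m\<^sup>2 * (t - s) + K / m * (e powr (1 - p * (1 - 1 / q)) * Z)
        + M\<^sup>2 / m\<^sup>2 * ((t - s) * e + Z * e powr (2 - p)))"
    using 1 2 3 B[OF \<tau>(1)] K_ge_1 m(1) by (intro add_mono mult_left_mono order_refl) auto
  finally show ?thesis by (simp add: mult_ac)
qed

text \<open>The constants in \<open>E\<close> depend only on the fixed interval, so the error
  vanishes as \<open>e\<close> tends to 0, while \<open>B\<close> and the integral do not
  change.\<close>

lemma ln_norm_growth:
  assumes st: "0 \<le> s" "s \<le> t" and cb: "coeff_bound a c s t" and nz: "\<And>r. r \<in> {s..t} \<Longrightarrow> x r \<noteq> 0"
    and B: "\<And>n \<tau>. partition_of s t n \<tau> \<Longrightarrow> (\<Sum>i<n. (\<omega> (\<tau> (Suc i)) - \<omega> (\<tau> i)) * growth (\<tau> i)) \<le> B"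
  shows "ln (norm (x t)) - ln (norm (x s)) \<le> integral {s..t} (\<lambda>r. f r - h r) + B"
proof -
  obtain z where z: "z \<in> {s..t}" "\<And>r. r \<in> {s..t} \<Longrightarrow> norm (x z) \<le> norm (x r)"
    using min_norm_attained[OF st] by blast
  have m: "0 < norm (x z)" using nz z by simp
  have "continuous_on {s..t} (\<lambda>r. norm (x r))"
    using x_Cpvar[OF st] by (auto simp: in_Cpvar_def intro: continuous_intros)
  then obtain z' where z': "\<And>r. r \<in> {s..t} \<Longrightarrow> norm (x r) \<le> norm (x z')"
    using continuous_attains_sup[of "{s..t}" "\<lambda>r. norm (x r)"] st by force
  define X M m where "X = norm (x z')" and "M = max (a * X) (K * c * (2 * X + V s t))" and "m = norm (x z)"
  define Z where "Z = pvar_seminorm q (\<lambda>s. C s *v x s) s t powr q + W s t powr p"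
  define E where "E e = (6 * a * X * M / m\<^sup>2 * (t - s) * e + K / m * Z * e powr (1 - p * (1 - 1 / q))
      + M\<^sup>2 / m\<^sup>2 * ((t - s) * e + Z * e powr (2 - p)))" for e
  let ?D = "ln (norm (x t)) - ln (norm (x s))" and ?I = "integral {s..t} (\<lambda>r. f r - h r) + B"
  have le: "?D \<le> ?I + E e" if "0 < e" for e
    unfolding E_def Z_def
    by (rule ln_norm_growth_approx[OF cb, where X = X and M = M and m = m and e = e])
      (use z z' m B that in \<open>auto simp: X_def m_def M_def\<close>)
  \<comment> \<open>This is \<open>1 / p + 1 / q > 1\<close> rearranged.\<close>
  have \<sigma>: "p * (1 - 1 / q) < 1" using p q q_gt_1 by (simp add: field_simps)
  have pw: "((\<lambda>e::real. e powr b) \<longlongrightarrow> 0) (at_right 0)" if "0 < b" for b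
  proof -
    have "((\<lambda>e::real. e powr b) \<longlongrightarrow> 0 powr b) (at_right 0)"
      using that by (intro tendsto_powr' tendsto_intros) (auto simp: eventually_at_right_less intro: eventually_mono[OF eventually_at_right_less])
    then show ?thesis by simp
  qed
  have "(E \<longlongrightarrow> 6 * a * X * M / m\<^sup>2 * (t - s) * 0 + K / m * Z * 0 + M\<^sup>2 / m\<^sup>2 * ((t - s) * 0 + Z * 0)) (at_right 0)"
    unfolding E_def using pw[of "1 - p * (1 - 1 / q)"] pw[of "2 - p"] \<sigma> p
    by (intro tendsto_intros) auto
  then have "((\<lambda>e. ?I + E e) \<longlongrightarrow> ?I + 0) (at_right 0)" by (intro tendsto_intros) simp
  moreover have "eventually (\<lambda>e. ?D \<le> ?I + E e) (at_right 0)"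
    using le by (intro eventually_mono[OF eventually_at_right_less[of 0]])
  ultimately have "?D \<le> ?I + 0" by (intro tendsto_lowerbound[of "\<lambda>e. ?I + E e" _ "at_right 0"]) auto
  then show ?thesis by simp
qed

text \<open>\<open>growth\<close> is the quadratic form of \<open>C\<close> at the unit vector
  \<open>y\<close>. Changing the left vector, the right vector and the matrix in turn costs
  \<open>c'\<close>, \<open>c'\<close> and 1 times the respective variation.\<close>

lemma growth_variation:
  assumes cb: "coeff_bound a c s t" and c': "\<And>r. r \<in> {s..t} \<Longrightarrow> norm (mat_op (C r)) \<le> c'"
    and nz: "\<And>r. r \<in> {s..t} \<Longrightarrow> x r \<noteq> 0"
  shows "bdd_above (pvar_sums q growth s t)"
    "pvar_seminorm q growth s t \<le> VC s t + 2 * c' * pvar_seminorm q y s t"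
proof -
  note cbd = coeff_boundD[OF cb]
  have c0: "0 \<le> c'" using order_trans[OF norm_ge_zero c'[of s]] cbd by auto
  have ybd: "bdd_above (pvar_sums q y s t)" using y_bdd[OF cbd(1,2) nz] .
  have sa: "supadd q (\<lambda>u v. VC u v + 2 * c' * pvar_seminorm q y u v) s t"
    using q_gt_1 c0 cbd by (intro supadd_add supadd_mult supadd_pvar bdd_C ybd) auto
  have eq: "growth u = y u \<bullet> (C u *v y u)" for u
    by (simp add: matrix_vector_mult_scaleR power2_eq_square divide_inverse mult_ac)
  have y1: "norm (y u) = 1" if "u \<in> {s..t}" for u using nz[OF that] by simp
  have le: "norm (growth v - growth u) \<le> VC u v + 2 * c' * pvar_seminorm q y u v"
    if uv: "s \<le> u" "u \<le> v" "v \<le> t" for u v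
  proof -
    have us: "u \<in> {s..t}" and vs: "v \<in> {s..t}" using uv by auto
    have dy: "norm (y v - y u) \<le> pvar_seminorm q y u v"
      using norm_diff_le_pvar[OF _ ybd uv] q_gt_1 by simp
    have dC: "norm (mat_op (C v - C u)) \<le> VC u v"
      using norm_diff_le_pvar[OF _ bdd_C[OF cbd(1,2)] uv] q_gt_1 by (simp add: mat_op_diff)
    have "growth v - growth u = (y v - y u) \<bullet> (C v *v y v) + y u \<bullet> (C v *v (y v - y u)) + y u \<bullet> ((C v - C u) *v y u)"
      unfolding eq by (simp add: inner_diff_left inner_diff_right matrix_vector_mult_diff_distrib matrix_vector_mult_diff_rdistrib)
    moreover have "\<bar>(y v - y u) \<bullet> (C v *v y v)\<bar> \<le> c' * pvar_seminorm q y u v"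
    proof -
      have "\<bar>(y v - y u) \<bullet> (C v *v y v)\<bar> \<le> norm (y v - y u) * norm (C v *v y v)" by (rule Cauchy_Schwarz_ineq2)
      also have "\<dots> \<le> pvar_seminorm q y u v * c'"
        using dy order_trans[OF norm_matrix_vector_le, of "C v" "y v" c'] c'[OF vs] y1[OF vs]
        by (intro mult_mono) auto
      finally show ?thesis by (simp add: mult.commute)
    qed
    moreover have "\<bar>y u \<bullet> (C v *v (y v - y u))\<bar> \<le> c' * pvar_seminorm q y u v"
    proof -
      have "\<bar>y u \<bullet> (C v *v (y v - y u))\<bar> \<le> norm (y u) * norm (C v *v (y v - y u))" by (rule Cauchy_Schwarz_ineq2)
      also have "\<dots> = norm (C v *v (y v - y u))" using y1[OF us] by simp
      also have "\<dots> \<le> norm (mat_op (C v)) * norm (y v - y u)" by (rule norm_matrix_vector_le)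
      also have "\<dots> \<le> c' * pvar_seminorm q y u v" using c'[OF vs] c0 dy by (intro mult_mono) auto
      finally show ?thesis .
    qed
    moreover have "\<bar>y u \<bullet> ((C v - C u) *v y u)\<bar> \<le> VC u v"
    proof -
      have "\<bar>y u \<bullet> ((C v - C u) *v y u)\<bar> \<le> norm (y u) * norm ((C v - C u) *v y u)" by (rule Cauchy_Schwarz_ineq2)
      also have "\<dots> = norm ((C v - C u) *v y u)" using y1[OF us] by simp
      also have "\<dots> \<le> norm (mat_op (C v - C u)) * norm (y u)" by (rule norm_matrix_vector_le)
      also have "\<dots> \<le> VC u v" using dC y1[OF us] by simp
      finally show ?thesis .
    qed
    ultimately show ?thesis unfolding real_norm_def by linarith
  qed
  show "bdd_above (pvar_sums q growth s t)"
    "pvar_seminorm q growth s t \<le> VC s t + 2 * c' * pvar_seminorm q y s t"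
    using pvar_le_supadd[OF _ sa cbd(2) le] q_gt_1 by auto
qed

text \<open>\<open>t\<close> may stop inside the unit interval, but the error term refers to the
  whole interval and so depends on \<open>k\<close> only.\<close>

lemma ln_norm_unit_growth:
  assumes cb: "coeff_bound a c k (k + 1)" and kt: "k \<le> t" "t \<le> k + 1"
    and c: "c = norm (mat_op (C k)) + VC k (k + 1)"
    and nz: "\<And>r. r \<in> {k..t} \<Longrightarrow> x r \<noteq> 0"
  defines "w \<equiv> W k (k + 1)"
  shows "ln (norm (x t)) - ln (norm (x k)) \<le> integral {k..t} (\<lambda>r. f r - h r)
    + K * c * w * (1 + 2 * (8 * a + 16 * K * c * w + (8 * a) powr p + (16 * K * c * w) powr p))"
proof -
  have cbt: "coeff_bound a c k t" using coeff_bound_subinterval[OF cb, of k t] kt by simp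
  note cbd = coeff_boundD[OF cbt]
  have Ww: "W k t \<le> w" "0 \<le> w" using W_mono[of k k t "k + 1"] kt cbd(1) by (auto simp: w_def)
  have kc: "0 \<le> 16 * K * c" using K_ge_1 cbd by simp
  have kcw: "16 * K * c * W k t \<le> 16 * K * c * w" using Ww kc by (intro mult_left_mono)
  define Y where "Y = 8 * a + 16 * K * c * w + (8 * a) powr p + (16 * K * c * w) powr p"
  have "pvar_seminorm q y k t \<le> 8 * a + 16 * K * c * W k t + (8 * a) powr p + (16 * K * c * W k t) powr p"
    by (rule y_variation[OF cbt nz kt(2)])
  also have "\<dots> \<le> Y"
    unfolding Y_def using kcw kc p by (intro add_mono powr_mono2 order_refl) auto
  finally have Y: "pvar_seminorm q y k t \<le> Y" .
  have Y0: "0 \<le> Y" using Y pvar_seminorm_nonneg order_trans by blast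
  have gr: "\<bar>growth k\<bar> \<le> norm (mat_op (C k))"
  proof -
    have nk: "0 < norm (x k)" using nz kt by simp
    have "\<bar>x k \<bullet> (C k *v x k)\<bar> \<le> norm (x k) * norm (C k *v x k)" by (rule Cauchy_Schwarz_ineq2)
    also have "\<dots> \<le> norm (x k) * (norm (mat_op (C k)) * norm (x k))"
      by (intro mult_left_mono norm_matrix_vector_le) auto
    finally show ?thesis using nk by (simp add: abs_divide divide_le_eq power2_eq_square mult_ac)
  qed
  have bg: "bdd_above (pvar_sums q growth k t)" using growth_variation(1)[OF cbt cbd(7) nz] by simp
  have "pvar_seminorm q growth k t \<le> VC k t + 2 * c * pvar_seminorm q y k t"
    using growth_variation(2)[OF cbt cbd(7) nz] by simp
  also have "\<dots> \<le> VC k (k + 1) + 2 * c * Y"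
    using VC_mono[of k k t "k + 1"] kt cbd Y by (intro add_mono mult_left_mono) auto
  finally have Vg: "pvar_seminorm q growth k t \<le> VC k (k + 1) + 2 * c * Y" .
  show ?thesis
    unfolding Y_def[symmetric]
  proof (rule ln_norm_growth[OF cbd(1,2) cbt nz])
    fix n \<tau> assume \<tau>: "partition_of k t n \<tau>"
    have "norm ((\<Sum>i<n. (\<omega> (\<tau> (Suc i)) - \<omega> (\<tau> i)) *\<^sub>R growth (\<tau> i)) - (\<omega> t - \<omega> k) *\<^sub>R growth k)
        \<le> K * (pvar_seminorm q growth k t * W k t)"
      using p q_gt_1 by (intro young_sum_bound[OF _ _ q(2) bg bdd_\<omega>[OF cbd(1,2)] \<tau>]) auto
    then have "(\<Sum>i<n. (\<omega> (\<tau> (Suc i)) - \<omega> (\<tau> i)) * growth (\<tau> i))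
        \<le> \<bar>(\<omega> t - \<omega> k) * growth k\<bar> + K * (pvar_seminorm q growth k t * W k t)"
      unfolding real_scaleR_def real_norm_def by linarith
    also have "\<bar>(\<omega> t - \<omega> k) * growth k\<bar> \<le> w * norm (mat_op (C k))"
      unfolding abs_mult using norm_diff_le_pvar[OF _ bdd_\<omega>[OF cbd(1,2)], of k t] p cbd gr Ww
      by (intro mult_mono) auto
    \<comment> \<open>The left-point term is enlarged by \<open>1 \<le> K\<close> so that
      \<open>norm (mat_op (C k))\<close> and \<open>VC k (k + 1)\<close> unite to \<open>c\<close>
      under a common factor.\<close>
    also have "w * norm (mat_op (C k)) \<le> K * (w * norm (mat_op (C k)))"
      using mult_right_mono[of 1 K "w * norm (mat_op (C k))"] K_ge_1 Ww by simp
    also have "K * (pvar_seminorm q growth k t * W k t) \<le> K * ((VC k (k + 1) + 2 * c * Y) * w)"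
      using K_ge_1 Vg Ww Y0 cbd by (intro mult_left_mono mult_mono) auto
    also have "K * (w * norm (mat_op (C k))) + K * ((VC k (k + 1) + 2 * c * Y) * w) = K * c * w * (1 + 2 * Y)"
      by (simp add: c algebra_simps)
    finally show "(\<Sum>i<n. (\<omega> (\<tau> (Suc i)) - \<omega> (\<tau> i)) * growth (\<tau> i)) \<le> K * c * w * (1 + 2 * Y)" by simp
  qed auto
qed

end

definition unit_growth :: "real \<Rightarrow> real \<Rightarrow> real \<Rightarrow> real \<Rightarrow> real \<Rightarrow> real" where
  "unit_growth K p a c w = K * c * w * (1 + 2 * (8 * a + 16 * K * c * w + (8 * a) powr p + (16 * K * c * w) powr p))"

section \<open>Norms of the coefficients on unit intervals and the bound on the half-line\<close>

lemma norm_le_sup_norm: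
  assumes "continuous_on {a..b} g" "r \<in> {a..b}"
  shows "norm (g r) \<le> sup_norm g a b"
proof -
  have "bdd_above ((\<lambda>t. norm (g t)) ` {a..b})"
    using assms(1) by (intro bounded_imp_bdd_above compact_imp_bounded compact_continuous_image continuous_intros) auto
  then show ?thesis unfolding sup_norm_def using assms(2) by (intro cSUP_upper)
qed

context yde_path
begin

abbreviation "rate_a s t \<equiv> sup_norm (\<lambda>t. mat_op (A t)) s t + sup_norm f s t"
abbreviation "rate_c s t \<equiv> pvar_norm q (\<lambda>t. mat_op (C t)) s t"

lemma coeff_bound_norms:
  assumes st: "0 \<le> s" "s \<le> t"
  shows "coeff_bound (rate_a s t) (rate_c s t) s t"
proof -
  have A: "continuous_on {s..t} (\<lambda>t. mat_op (A t))"
    using st by (intro continuous_on_mat_op continuous_on_subset[OF A_cont[of "t + 1"]]) auto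
  have fc: "continuous_on {s..t} f"
    using st by (intro continuous_on_subset[OF f_cont]) auto
  have "norm (mat_op (A r)) + f r \<le> rate_a s t" if "r \<in> {s..t}" for r
    using norm_le_sup_norm[OF A that] norm_le_sup_norm[OF fc that] by simp
  moreover have "norm (mat_op (C r)) \<le> rate_c s t" if "r \<in> {s..t}" for r
  proof -
    have "norm (mat_op (C r)) \<le> norm (mat_op (C s)) + norm (mat_op (C r) - mat_op (C s))"
      by (rule norm_triangle_sub)
    also have "norm (mat_op (C r) - mat_op (C s)) \<le> VC s r"
      using norm_diff_le_pvar[OF _ bdd_C[OF st], of s r] that q_gt_1 by simp
    also have "VC s r \<le> VC s t" using VC_mono[of s s r t] that st by simp
    finally show ?thesis by (simp add: pvar_norm_def)
  qed
  ultimately show ?thesis using st by (auto simp: coeff_bound_def pvar_norm_def)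
qed

lemma solution_zero:
  assumes "x 0 = 0" "0 \<le> t" shows "x t = 0"
  using zero_propagates[OF _ assms(2) coeff_bound_norms[OF _ assms(2)], of 0 t] assms by simp

lemma solution_nonzero:
  assumes "x 0 \<noteq> 0" "0 \<le> t" shows "x t \<noteq> 0"
  using zero_propagates[OF _ assms(2) coeff_bound_norms[OF _ assms(2)], of t 0] assms by auto

text \<open>The last, possibly incomplete unit interval is charged in full. The sum then has
  \<open>nat \<lfloor>t\<rfloor> + 1\<close> terms, matching the divisor \<open>real m + 1\<close>
  of the means.\<close>

lemma ln_norm_solution_le:
  assumes nz: "x 0 \<noteq> 0" and t: "0 \<le> t"
  defines "g \<equiv> \<lambda>k. unit_growth K p (rate_a (real k) (real k + 1)) (rate_c (real k) (real k + 1)) (W (real k) (real k + 1))"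
  shows "ln (norm (x t)) \<le> ln (norm (x 0)) + integral {0..t} (\<lambda>r. f r - h r) + (\<Sum>k\<le>nat \<lfloor>t\<rfloor>. g k)"
proof -
  have comb: "integral {0..u} (\<lambda>r. f r - h r) + integral {u..v} (\<lambda>r. f r - h r) = integral {0..v} (\<lambda>r. f r - h r)"
    if "0 \<le> u" "u \<le> v" for u v
    using that by (intro Henstock_Kurzweil_Integration.integral_combine hf_integrable) auto
  have unit: "ln (norm (x s)) - ln (norm (x (real k))) \<le> integral {real k..s} (\<lambda>r. f r - h r) + g k"
    if "real k \<le> s" "s \<le> real k + 1" for k s
    unfolding g_def unit_growth_def
    by (rule ln_norm_unit_growth[OF coeff_bound_norms that])
      (use solution_nonzero[OF nz] in \<open>auto simp: pvar_norm_def\<close>)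
  have int: "ln (norm (x (real n))) \<le> ln (norm (x 0)) + integral {0..real n} (\<lambda>r. f r - h r) + (\<Sum>k<n. g k)" for n
  proof (induction n)
    case (Suc n)
    then show ?case using unit[of n "real (Suc n)"] comb[of "real n" "real (Suc n)"] by simp
  qed simp
  define n where "n = nat \<lfloor>t\<rfloor>"
  have n: "real n \<le> t" "t \<le> real n + 1" using t unfolding n_def by linarith+
  have "(\<Sum>k\<le>n. g k) = (\<Sum>k<n. g k) + g n" by (simp add: lessThan_Suc_atMost[symmetric])
  then show ?thesis using unit[OF n] int[of n] comb[of "real n" t] n unfolding n_def[symmetric] by simp
qed

end

section \<open>Power means\<close>

definition power_mean :: "real \<Rightarrow> (nat \<Rightarrow> real) \<Rightarrow> nat \<Rightarrow> real" where
  "power_mean r a m = (1 / (real m + 1) * (\<Sum>k\<le>m. a k powr r)) powr (1 / r)"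

lemma limsup_mean_eq: "limsup_mean r a = limsup (\<lambda>m. ereal (power_mean r a m))"
  by (simp add: limsup_mean_def power_mean_def)

lemma power_mean_nonneg [simp]: "0 \<le> power_mean r a m"
  by (simp add: power_mean_def)

lemma power_mean_one:
  "(\<And>k. 0 \<le> a k) \<Longrightarrow> power_mean 1 a m = 1 / (real m + 1) * (\<Sum>k\<le>m. a k)"
  by (simp add: power_mean_def sum_nonneg)

lemma power_mean_powr:
  assumes "0 < s" "0 < r"
  shows "power_mean r (\<lambda>k. a k powr s) m = power_mean (r * s) a m powr s"
  using assms by (simp add: power_mean_def powr_powr mult.commute)

lemma bernoulli_powr:
  fixes u t :: real
  assumes "1 \<le> t" "0 \<le> u" shows "1 + t * (u - 1) \<le> u powr t"
proof (cases "t = 1")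
  case False
  then have t: "1 < t" using assms by simp
  have "u * 1 \<le> u powr t / t + 1 powr (t / (t - 1)) / (t / (t - 1))"
    using t assms by (intro Youngs_inequality) (auto simp: field_simps)
  then have "u \<le> (u powr t + (t - 1)) / t" using t by (simp add: add_divide_distrib)
  then show ?thesis using t by (simp add: pos_le_divide_eq algebra_simps)
qed (use assms in simp)

text \<open>Jensen's inequality by a tangent line: Bernoulli is applied to
  \<open>a k powr r / G\<close>, and the linear terms cancel in the sum because \<open>G\<close> is
  the mean.\<close>

lemma power_mean_mono_exponent:
  assumes r: "0 < r" "r \<le> s"
  shows "power_mean r a m \<le> power_mean s a m"
proof -
  define G where "G = 1 / (real m + 1) * (\<Sum>k\<le>m. a k powr r)"
  have G0: "0 \<le> G" by (simp add: G_def sum_nonneg)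
  have G: "G powr (s / r) \<le> 1 / (real m + 1) * (\<Sum>k\<le>m. a k powr s)"
  proof (cases "G = 0")
    case True
    then show ?thesis by (simp add: sum_nonneg)
  next
    case False
    with G0 have pos: "0 < G" by simp
    have "1 + s / r * (a k powr r / G - 1) \<le> a k powr s / G powr (s / r)" for k
    proof -
      have "1 + s / r * (a k powr r / G - 1) \<le> (a k powr r / G) powr (s / r)"
        using r pos by (intro bernoulli_powr) auto
      also have "\<dots> = a k powr s / G powr (s / r)" using r pos by (simp add: powr_divide powr_powr)
      finally show ?thesis .
    qed
    then have "(\<Sum>k\<le>m. 1 + s / r * (a k powr r / G - 1)) \<le> (\<Sum>k\<le>m. a k powr s / G powr (s / r))"
      by (intro sum_mono)
    also have "(\<Sum>k\<le>m. 1 + s / r * (a k powr r / G - 1))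
       = (real m + 1) + s / r * ((\<Sum>k\<le>m. a k powr r) / G - (real m + 1))"
      by (simp add: sum.distrib sum_distrib_left[symmetric] sum_subtractf sum_divide_distrib[symmetric])
    also have "(\<Sum>k\<le>m. a k powr r) = (real m + 1) * G" by (simp add: G_def)
    finally show ?thesis using pos by (simp add: sum_divide_distrib[symmetric] field_simps)
  qed
  have "power_mean r a m = (G powr (s / r)) powr (1 / s)" using r by (simp add: power_mean_def G_def powr_powr)
  also have "\<dots> \<le> power_mean s a m" unfolding power_mean_def using r G by (intro powr_mono2) auto
  finally show ?thesis .
qed

text \<open>Squaring yields two factors \<open>1 / (real m + 1)\<close>, one for each sum in the
  Cauchy-Schwarz inequality, so means obey it with constant 1.\<close>

lemma power_mean_mult_le:
  assumes r: "0 < r" and nn: "\<And>k. 0 \<le> a k" "\<And>k. 0 \<le> b k"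
  shows "power_mean r (\<lambda>k. a k * b k) m \<le> power_mean (2 * r) a m * power_mean (2 * r) b m"
proof -
  let ?n = "1 / (real m + 1)"
  let ?S = "\<lambda>a r. ?n * (\<Sum>k\<le>m. a k powr r)"
  have sq: "(u powr r)\<^sup>2 = u powr (2 * r)" for u :: real
    by (simp add: power2_eq_square powr_add[symmetric])
  have "(?S (\<lambda>k. a k * b k) r)\<^sup>2 = ?n\<^sup>2 * (\<Sum>k\<le>m. a k powr r * b k powr r)\<^sup>2"
    by (simp only: powr_mult power_mult_distrib)
  also have "\<dots> \<le> ?n\<^sup>2 * ((\<Sum>k\<le>m. (a k powr r)\<^sup>2) * (\<Sum>k\<le>m. (b k powr r)\<^sup>2))"
    by (intro mult_left_mono Cauchy_Schwarz_ineq_sum) auto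
  also have "\<dots> = ?S a (2 * r) * ?S b (2 * r)" unfolding sq by (simp add: power2_eq_square)
  finally have "((?S (\<lambda>k. a k * b k) r)\<^sup>2) powr (1 / (2 * r)) \<le> (?S a (2 * r) * ?S b (2 * r)) powr (1 / (2 * r))"
    using r by (intro powr_mono2) auto
  moreover have "((?S (\<lambda>k. a k * b k) r)\<^sup>2) powr (1 / (2 * r)) = power_mean r (\<lambda>k. a k * b k) m"
  proof -
    have S0: "0 \<le> ?S (\<lambda>k. a k * b k) r" by (intro mult_nonneg_nonneg sum_nonneg) auto
    have "(?S (\<lambda>k. a k * b k) r)\<^sup>2 = ?S (\<lambda>k. a k * b k) r powr 2" using powr_numeral[OF S0] by simp
    then show ?thesis by (simp only: powr_powr power_mean_def) simp
  qed
  ultimately show ?thesis by (simp only: powr_mult power_mean_def)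
qed

section \<open>Averages of the growth bounds over unit intervals\<close>

definition mean_growth :: "real \<Rightarrow> real \<Rightarrow> real \<Rightarrow> real \<Rightarrow> real \<Rightarrow> real \<Rightarrow> real \<Rightarrow> real" where
  "mean_growth K p a c w2 w4 w6 = K * c * (w2 * (1 + 16 * a + 2 * 8 powr p * a powr p)
     + 32 * K * c * w4\<^sup>2 + 2 * (16 powr p * K powr p * c powr p) * w6 powr (p + 1))"

text \<open>Origin of the exponents. In \<open>c * a powr p * w\<close> Cauchy-Schwarz first splits
  off \<open>w\<close> with exponent 2, then gives \<open>c\<close> and \<open>a powr p\<close>
  exponent 4, that is \<open>4 * p\<close> for \<open>a\<close>; the powers \<open>p + 1\<close> of
  \<open>c\<close> and \<open>w\<close> lead to \<open>2 * p + 2\<close>. As \<open>p > 1\<close>,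
  the latter dominates 2 and 4, so one mean of \<open>c\<close> serves all terms, while the three
  means of \<open>w\<close> stay separate.\<close>

lemma mean_unit_growth_le:
  assumes p: "1 < p" and K: "0 \<le> K" and nn: "\<And>k. 0 \<le> a k" "\<And>k. 0 \<le> c k" "\<And>k. 0 \<le> w k"
  shows "1 / (real m + 1) * (\<Sum>k\<le>m. unit_growth K p (a k) (c k) (w k)) \<le>
    mean_growth K p (power_mean (4 * p) a m) (power_mean (2 * p + 2) c m)
      (power_mean 2 w m) (power_mean 4 w m) (power_mean (2 * p + 2) w m)"
proof -
  define A C W2 W4 W6 where "A = power_mean (4 * p) a m" "C = power_mean (2 * p + 2) c m"
    "W2 = power_mean 2 w m" "W4 = power_mean 4 w m" "W6 = power_mean (2 * p + 2) w m"
  have nn': "0 \<le> A" "0 \<le> C" "0 \<le> W2" "0 \<le> W4" "0 \<le> W6" by (simp_all add: A_C_W2_W4_W6_def)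
  have C: "power_mean 2 c m \<le> C" "power_mean 4 c m \<le> C"
    unfolding A_C_W2_W4_W6_def using p by (auto intro!: power_mean_mono_exponent)
  have A4: "power_mean 4 a m \<le> A"
    unfolding A_C_W2_W4_W6_def using p by (auto intro!: power_mean_mono_exponent)
  let ?M = "\<lambda>g. 1 / (real m + 1) * (\<Sum>k\<le>m. g k)"
  have T1: "?M (\<lambda>k. c k * w k) \<le> C * W2"
  proof -
    have "power_mean 1 (\<lambda>k. c k * w k) m \<le> power_mean 2 c m * W2"
      using power_mean_mult_le[of 1 c w m] nn by (simp add: A_C_W2_W4_W6_def)
    also have "\<dots> \<le> C * W2" using C nn' by (intro mult_right_mono) auto
    finally show ?thesis using nn by (subst (asm) power_mean_one) auto
  qed
  \<comment> \<open>One scheme for the two mixed terms, with \<open>b\<close> equal to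
    \<open>a\<close> or to its \<open>p\<close>-th power.\<close>
  have T23: "?M (\<lambda>k. c k * b k * w k) \<le> C * B * W2" if b: "\<And>k. 0 \<le> b k" "power_mean 4 b m \<le> B" for b B
  proof -
    have "power_mean 1 (\<lambda>k. c k * b k * w k) m \<le> power_mean 2 (\<lambda>k. c k * b k) m * W2"
      using power_mean_mult_le[of 1 "\<lambda>k. c k * b k" w m] nn b by (simp add: A_C_W2_W4_W6_def)
    also have "\<dots> \<le> (power_mean 4 c m * power_mean 4 b m) * W2"
      using power_mean_mult_le[of 2 c b m] nn b nn' by (intro mult_right_mono) auto
    also have "\<dots> \<le> C * B * W2" using C nn' b(2) by (intro mult_right_mono mult_mono) auto
    finally show ?thesis using nn b by (subst (asm) power_mean_one) auto
  qed
  have "power_mean 4 (\<lambda>k. a k powr p) m = A powr p"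
    using power_mean_powr[of p 4 a m] p by (simp add: A_C_W2_W4_W6_def)
  then have T3: "?M (\<lambda>k. c k * a k powr p * w k) \<le> C * A powr p * W2" by (intro T23) auto
  have T2: "?M (\<lambda>k. c k * a k * w k) \<le> C * A * W2" using nn A4 by (intro T23) auto
  have T45: "?M (\<lambda>k. c k powr s * w k powr s) \<le> power_mean (2 * s) c m powr s * power_mean (2 * s) w m powr s"
    if "0 < s" for s
  proof -
    have "power_mean 1 (\<lambda>k. c k powr s * w k powr s) m \<le> power_mean 2 (\<lambda>k. c k powr s) m * power_mean 2 (\<lambda>k. w k powr s) m"
      using power_mean_mult_le[of 1 "\<lambda>k. c k powr s" "\<lambda>k. w k powr s" m] by simp
    also have "\<dots> = power_mean (2 * s) c m powr s * power_mean (2 * s) w m powr s"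
      using power_mean_powr[of s 2 c m] power_mean_powr[of s 2 w m] that by simp
    finally show ?thesis by (subst (asm) power_mean_one) auto
  qed
  have T4: "?M (\<lambda>k. (c k)\<^sup>2 * (w k)\<^sup>2) \<le> C\<^sup>2 * W4\<^sup>2"
  proof -
    have "?M (\<lambda>k. (c k)\<^sup>2 * (w k)\<^sup>2) \<le> (power_mean 4 c m)\<^sup>2 * W4\<^sup>2"
      using T45[of 2] nn by (simp add: A_C_W2_W4_W6_def)
    also have "\<dots> \<le> C\<^sup>2 * W4\<^sup>2" using C by (intro mult_right_mono power_mono) auto
    finally show ?thesis .
  qed
  have T5: "?M (\<lambda>k. c k powr (p + 1) * w k powr (p + 1)) \<le> C powr (p + 1) * W6 powr (p + 1)"
    using T45[of "p + 1"] p by (simp add: A_C_W2_W4_W6_def algebra_simps)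
  have expand: "unit_growth K p (a k) (c k) (w k) = K * (c k * w k) + 16 * K * (c k * a k * w k)
      + 32 * K\<^sup>2 * ((c k)\<^sup>2 * (w k)\<^sup>2) + 2 * K * 8 powr p * (c k * a k powr p * w k)
      + 2 * K * (16 powr p * K powr p) * (c k powr (p + 1) * w k powr (p + 1))" for k
    using nn by (simp add: unit_growth_def powr_mult powr_add algebra_simps power2_eq_square)
  have "?M (\<lambda>k. unit_growth K p (a k) (c k) (w k)) = K * ?M (\<lambda>k. c k * w k) + 16 * K * ?M (\<lambda>k. c k * a k * w k)
      + 32 * K\<^sup>2 * ?M (\<lambda>k. (c k)\<^sup>2 * (w k)\<^sup>2) + 2 * K * 8 powr p * ?M (\<lambda>k. c k * a k powr p * w k)
      + 2 * K * (16 powr p * K powr p) * ?M (\<lambda>k. c k powr (p + 1) * w k powr (p + 1))"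
    unfolding expand by (simp only: sum.distrib sum_distrib_left[symmetric]) (simp add: algebra_simps)
  also have "\<dots> \<le> K * (C * W2) + 16 * K * (C * A * W2) + 32 * K\<^sup>2 * (C\<^sup>2 * W4\<^sup>2)
      + 2 * K * 8 powr p * (C * A powr p * W2) + 2 * K * (16 powr p * K powr p) * (C powr (p + 1) * W6 powr (p + 1))"
    using K by (intro add_mono mult_left_mono[OF T1] mult_left_mono[OF T2] mult_left_mono[OF T3]
        mult_left_mono[OF T4] mult_left_mono[OF T5]) auto
  also have "\<dots> = mean_growth K p A C W2 W4 W6"
    using nn' by (simp add: mean_growth_def powr_add algebra_simps power2_eq_square)
  finally show ?thesis unfolding A_C_W2_W4_W6_def .
qed

lemma mean_growth_mono:
  assumes "1 < p" "0 \<le> K" "0 \<le> a" "0 \<le> c" "0 \<le> w2" "0 \<le> w4" "0 \<le> w6"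
    and "a \<le> a'" "c \<le> c'" "w2 \<le> w2'" "w4 \<le> w4'" "w6 \<le> w6'"
  shows "mean_growth K p a c w2 w4 w6 \<le> mean_growth K p a' c' w2' w4' w6'"
  unfolding mean_growth_def using assms
  by (intro mult_mono add_mono power_mono powr_mono2 order_refl add_nonneg_nonneg mult_nonneg_nonneg) auto

lemma eventually_power_mean_less:
  assumes "limsup_mean r a < \<infinity>" "0 < \<eta>"
  shows "\<forall>\<^sub>F m in sequentially. power_mean r a m < real_of_ereal (limsup_mean r a) + \<eta>"
    and "0 \<le> real_of_ereal (limsup_mean r a)"
proof -
  have 0: "0 \<le> limsup_mean r a"
    unfolding limsup_mean_eq by (rule le_Limsup) (auto intro: always_eventually)
  with assms obtain l where l: "limsup_mean r a = ereal l"
    by (cases "limsup_mean r a") auto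
  show "0 \<le> real_of_ereal (limsup_mean r a)" using 0 by (rule real_of_ereal_pos)
  have "limsup_mean r a < ereal (l + \<eta>)" using assms l by simp
  then show "\<forall>\<^sub>F m in sequentially. power_mean r a m < real_of_ereal (limsup_mean r a) + \<eta>"
    using Limsup_lessD[of sequentially "\<lambda>m. ereal (power_mean r a m)" "ereal (l + \<eta>)"] l
    by (simp add: limsup_mean_eq)
qed

lemma limsup_mean_finite_mono:
  assumes "0 < r" "r \<le> s" "limsup_mean s a < \<infinity>"
  shows "limsup_mean r a < \<infinity>"
proof -
  have "limsup_mean r a \<le> limsup_mean s a"
    unfolding limsup_mean_eq using power_mean_mono_exponent[OF assms(1,2)]
    by (intro Limsup_mono always_eventually) auto
  then show ?thesis using assms(3) by (rule le_less_trans)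
qed

text \<open>All five means are eventually within a common \<open>\<eta>\<close> of their upper
  limits. Monotonicity moves this into \<open>mean_growth\<close>, and its continuity as
  \<open>\<eta>\<close> tends to 0 keeps the value below \<open>\<beta>\<close>.\<close>

lemma eventually_mean_unit_growth_le:
  assumes p: "1 < p" and K: "0 \<le> K" and nn: "\<And>k. 0 \<le> a k" "\<And>k. 0 \<le> c k" "\<And>k. 0 \<le> w k"
    and fin: "limsup_mean (4 * p) a < \<infinity>" "limsup_mean (2 * p + 2) c < \<infinity>" "limsup_mean (2 * p + 2) w < \<infinity>"
    and less: "mean_growth K p (real_of_ereal (limsup_mean (4 * p) a)) (real_of_ereal (limsup_mean (2 * p + 2) c))
      (real_of_ereal (limsup_mean 2 w)) (real_of_ereal (limsup_mean 4 w)) (real_of_ereal (limsup_mean (2 * p + 2) w)) < \<beta>"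
  shows "\<forall>\<^sub>F m in sequentially. (\<Sum>k\<le>m. unit_growth K p (a k) (c k) (w k)) \<le> \<beta> * (real m + 1)"
proof -
  have fin2: "limsup_mean 2 w < \<infinity>"
    by (rule limsup_mean_finite_mono[OF _ _ fin(3)]) (use p in auto)
  have fin4: "limsup_mean 4 w < \<infinity>"
    by (rule limsup_mean_finite_mono[OF _ _ fin(3)]) (use p in auto)
  define l where "l r b = real_of_ereal (limsup_mean r b)" for r b
  define G where "G \<eta> = mean_growth K p (l (4 * p) a + \<eta>) (l (2 * p + 2) c + \<eta>) (l 2 w + \<eta>) (l 4 w + \<eta>) (l (2 * p + 2) w + \<eta>)" for \<eta>
  have l0: "0 \<le> l (4 * p) a" "0 \<le> l (2 * p + 2) c" "0 \<le> l 2 w" "0 \<le> l 4 w" "0 \<le> l (2 * p + 2) w"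
    unfolding l_def using fin fin2 fin4 by (auto intro!: eventually_power_mean_less(2)[where \<eta> = 1])
  have ev: "\<forall>\<^sub>F \<eta> in at_right 0. 0 \<le> b + \<eta>" if "0 \<le> b" for b :: real
    using that by (intro eventually_mono[OF eventually_at_right_less[of "0::real"]]) auto
  have lim: "((\<lambda>\<eta>::real. b + \<eta>) \<longlongrightarrow> b) (at_right 0)" for b :: real
    using tendsto_add[OF tendsto_const[of b] tendsto_ident_at[of "0::real" "{0<..}"]] by simp
  \<comment> \<open>A limit \<open>b\<close> may be 0; \<open>tendsto_powr'\<close> then asks for a
    positive exponent and an eventually nonnegative base, whence the one-sided filter.\<close>
  have limp: "((\<lambda>\<eta>::real. (b + \<eta>) powr s) \<longlongrightarrow> b powr s) (at_right 0)" if "0 \<le> b" "0 < s" for b s :: real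
    using that ev[OF that(1)] by (intro tendsto_powr' lim tendsto_const) auto
  have "(G \<longlongrightarrow> mean_growth K p (l (4 * p) a) (l (2 * p + 2) c) (l 2 w) (l 4 w) (l (2 * p + 2) w)) (at_right 0)"
    unfolding G_def mean_growth_def using p l0
    by (intro tendsto_mult tendsto_add tendsto_power tendsto_const lim limp) auto
  from order_tendstoD(2)[OF this] have "\<forall>\<^sub>F \<eta> in at_right 0. G \<eta> < \<beta>" using less by (simp add: l_def)
  then have "\<forall>\<^sub>F \<eta> in at_right 0. G \<eta> < \<beta> \<and> 0 < \<eta>"
    using eventually_at_right_less[of "0::real"] by eventually_elim auto
  then obtain \<eta> where \<eta>: "G \<eta> < \<beta>" "0 < \<eta>"
    using eventually_happens'[of "at_right (0::real)"] trivial_limit_at_right_real by blast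
  note e = eventually_power_mean_less(1)[OF _ \<eta>(2), folded l_def]
  have "\<forall>\<^sub>F m in sequentially. 1 / (real m + 1) * (\<Sum>k\<le>m. unit_growth K p (a k) (c k) (w k)) \<le> \<beta>"
    using e[OF fin(1)] e[OF fin(2)] e[OF fin2] e[OF fin4] e[OF fin(3)]
  proof eventually_elim
    case (elim m)
    have "1 / (real m + 1) * (\<Sum>k\<le>m. unit_growth K p (a k) (c k) (w k)) \<le> G \<eta>"
      unfolding G_def using elim
      by (intro order_trans[OF mean_unit_growth_le[OF p K nn]] mean_growth_mono p K) auto
    then show ?case using \<eta>(1) by simp
  qed
  then show ?thesis by eventually_elim (simp add: field_simps)
qed

section \<open>Exponential stability\<close>

lemma yde_solution_zero:
  assumes p: "0 < q" and F: "\<And>t. 0 \<le> t \<Longrightarrow> F t 0 = 0"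
  shows "yde_solution q \<omega> A C F 0 (\<lambda>_. 0)"
  unfolding yde_solution_def
proof (intro conjI allI impI)
  fix T :: real assume "0 < T"
  have "supadd q (\<lambda>_ _. 0) 0 T" by (auto simp: supadd_def)
  then show "in_Cpvar q (\<lambda>_. 0 :: real^'d) 0 T"
    using pvar_le_supadd(1)[OF p, of "\<lambda>_ _. 0" 0 T "\<lambda>_. 0 :: real^'d"] \<open>0 < T\<close> by (auto simp: in_Cpvar_def)
next
  fix t :: real assume t: "0 \<le> t"
  have "((\<lambda>s. A s *v 0 + F s 0) has_integral 0) {0..t}"
    by (rule has_integral_is_0) (simp add: F)
  moreover have "has_young_integral (\<lambda>s. C s *v 0) \<omega> 0 t 0"
    by (auto simp: has_young_integral_def intro: exI[of _ 1])
  ultimately show "\<exists>I J. ((\<lambda>s. A s *v 0 + F s 0) has_integral I) {0..t} \<and>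
      has_young_integral (\<lambda>s. C s *v 0) \<omega> 0 t J \<and> 0 = 0 + I + J"
    by (intro exI[of _ 0]) simp
qed

text \<open>Origin of \<open>1 + 4 * G\<close>: the factor of \<open>w2\<close> is 1 plus twice
  \<open>8 * a\<close> plus twice its \<open>p\<close>-th power, each at most \<open>2 * G\<close>.
  The other two factors are at most \<open>2 * G\<close> and are enlarged to the same value.\<close>

lemma mean_growth_le:
  fixes K p a c w2 w4 w6 G :: real
  assumes K: "0 \<le> K" and nn: "0 \<le> a" "0 \<le> c" "0 \<le> w2"
    and G: "8 * a \<le> G" "16 * K * c \<le> G" "8 powr p * a powr p \<le> G" "16 powr p * K powr p * c powr p \<le> G"
  shows "mean_growth K p a c w2 w4 w6 \<le> K * (1 + 4 * G) * c * (w2 + w4\<^sup>2 + w6 powr (p + 1))"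
proof -
  have G0: "0 \<le> G" using G(1) nn by linarith
  have "w2 * (1 + 16 * a + 2 * 8 powr p * a powr p) + 32 * K * c * w4\<^sup>2
      + 2 * (16 powr p * K powr p * c powr p) * w6 powr (p + 1)
    \<le> w2 * (1 + 4 * G) + (1 + 4 * G) * w4\<^sup>2 + (1 + 4 * G) * w6 powr (p + 1)"
  proof -
    have 1: "1 + 16 * a + 2 * 8 powr p * a powr p \<le> 1 + 4 * G" using G by simp
    have 2: "32 * K * c \<le> 1 + 4 * G" using G G0 by simp
    have 3: "2 * (16 powr p * K powr p * c powr p) \<le> 1 + 4 * G" using G G0 by simp
    show ?thesis
      using nn by (intro add_mono mult_left_mono[OF 1] mult_right_mono[OF 2] mult_right_mono[OF 3]) auto
  qed
  then have "K * c * (w2 * (1 + 16 * a + 2 * 8 powr p * a powr p) + 32 * K * c * w4\<^sup>2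
      + 2 * (16 powr p * K powr p * c powr p) * w6 powr (p + 1))
    \<le> K * c * (w2 * (1 + 4 * G) + (1 + 4 * G) * w4\<^sup>2 + (1 + 4 * G) * w6 powr (p + 1))"
    using K nn by (intro mult_left_mono) auto
  then show ?thesis by (simp add: mean_growth_def algebra_simps)
qed

text \<open>The bound of the growth of the logarithm does not depend on the solution, so that it yields
  both stability and the exponential rate.\<close>

lemma exp_stable_of_ln_bound:
  fixes S :: "(real \<Rightarrow> 'a::real_normed_vector) set" and g :: "real \<Rightarrow> real"
  assumes mem: "(\<lambda>_. 0) \<in> S"
    and zero: "\<And>x t. \<lbrakk>x \<in> S; x 0 = 0; 0 \<le> t\<rbrakk> \<Longrightarrow> x t = 0"
    and nonzero: "\<And>x t. \<lbrakk>x \<in> S; x 0 \<noteq> 0; 0 \<le> t\<rbrakk> \<Longrightarrow> x t \<noteq> 0 \<and> ln (norm (x t)) \<le> ln (norm (x 0)) + g t"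
    and bdd: "\<And>T. 0 \<le> T \<Longrightarrow> bdd_above (g ` {0..T})"
    and decay: "0 < \<eta>" "\<forall>\<^sub>F t in at_top. g t \<le> b - 2 * \<eta> * t"
  shows "exp_stable_sol S (\<lambda>_. 0)"
proof -
  obtain T where T: "\<And>t. T \<le> t \<Longrightarrow> g t \<le> b - 2 * \<eta> * t" using decay(2) by (auto simp: eventually_at_top_linorder)
  obtain M0 where M0: "\<And>y. y \<in> g ` {0..max 0 T} \<Longrightarrow> y \<le> M0"
    using bdd[of "max 0 T"] by (auto simp: bdd_above_def)
  define M where "M = max M0 b"
  have M: "g t \<le> M" if "0 \<le> t" for t
  proof (cases "t \<le> max 0 T")
    case True
    then show ?thesis using M0[of "g t"] that by (simp add: M_def)
  next
    case False
    then have "g t \<le> b - 2 * \<eta> * t" using T by simp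
    moreover have "0 \<le> 2 * \<eta> * t" using that decay(1) by simp
    ultimately show ?thesis by (simp add: M_def)
  qed
  have bound: "norm (x t) \<le> norm (x 0) * exp M" if "x \<in> S" "0 \<le> t" for x t
  proof (cases "x 0 = 0")
    case True
    then show ?thesis using zero that by simp
  next
    case False
    from nonzero[OF that(1) False that(2)] have nz: "x t \<noteq> 0" and l: "ln (norm (x t)) \<le> ln (norm (x 0)) + M"
      using M[OF that(2)] by auto
    have "norm (x t) = exp (ln (norm (x t)))" using nz by simp
    also have "\<dots> \<le> exp (ln (norm (x 0)) + M)" using l by simp
    also have "\<dots> = norm (x 0) * exp M" using False by (simp add: exp_add)
    finally show ?thesis .
  qed
  have "stable_sol S (\<lambda>_. 0)"
    unfolding stable_sol_def
  proof (intro conjI mem allI impI)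
    fix \<epsilon> :: real assume \<epsilon>: "0 < \<epsilon>"
    \<comment> \<open>The radius aims at half of \<open>\<epsilon>\<close>, because a supremum of
      strict bounds is bounded only weakly.\<close>
    have "(SUP t\<in>{0..}. ereal (norm (x t - 0))) < ereal \<epsilon>" if x: "x \<in> S" "norm (x 0 - 0) < \<epsilon> / (2 * exp M)" for x
    proof -
      have "(SUP t\<in>{0..}. ereal (norm (x t - 0))) \<le> ereal (\<epsilon> / 2)"
      proof (rule SUP_least)
        fix t :: real assume "t \<in> {0..}"
        then have "norm (x t) \<le> norm (x 0) * exp M" using bound[OF x(1)] by simp
        also have "\<dots> \<le> \<epsilon> / (2 * exp M) * exp M" using x(2) by (intro mult_right_mono) auto
        finally show "ereal (norm (x t - 0)) \<le> ereal (\<epsilon> / 2)" by simp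
      qed
      also have "\<dots> < ereal \<epsilon>" using \<epsilon> by simp
      finally show ?thesis .
    qed
    then show "\<exists>r>0. \<forall>x\<in>S. norm (x 0 - 0) < r \<longrightarrow> (SUP t\<in>{0..}. ereal (norm (x t - 0))) < ereal \<epsilon>"
      using \<epsilon> by (intro exI[of _ "\<epsilon> / (2 * exp M)"]) auto
  qed
  moreover have "Limsup at_top (\<lambda>t. ereal (1 / t) * ereal_log (norm (x t - 0))) < 0" if x: "x \<in> S" for x
  proof -
    have "\<forall>\<^sub>F t in at_top. ereal (1 / t) * ereal_log (norm (x t - 0)) \<le> ereal (- \<eta>)"
    proof (cases "x 0 = 0")
      case True
      show ?thesis
        using eventually_gt_at_top[of 0]
      proof eventually_elim
        case (elim t)
        \<comment> \<open>The logarithm is \<open>-\<infinity>\<close> here and stays so after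
          multiplication by the positive \<open>1 / t\<close>.\<close>
        then show ?case using zero[OF x True, of t] by (simp add: ereal_log_def)
      qed
    next
      case False
      show ?thesis
        using decay(2) eventually_gt_at_top[of 0] eventually_ge_at_top[of "(ln (norm (x 0)) + b) / \<eta>"]
      proof eventually_elim
        case (elim t)
        have nz: "x t \<noteq> 0" and l: "ln (norm (x t)) \<le> ln (norm (x 0)) + g t"
          using nonzero[OF x False, of t] elim by auto
        \<comment> \<open>Half of the decay \<open>2 * \<eta> * t\<close> absorbs the initial value
          and the offset; the other half is the rate.\<close>
        have "ln (norm (x 0)) + b \<le> \<eta> * t" using elim(3) decay(1) by (simp add: pos_divide_le_eq mult.commute)
        then have "ln (norm (x t)) \<le> - \<eta> * t" using l elim(1) by simp
        then have "ln (norm (x t)) / t \<le> - \<eta>" using elim(2) by (simp add: pos_divide_le_eq)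
        then show ?case using nz by (simp add: ereal_log_def)
      qed
    qed
    then have "Limsup at_top (\<lambda>t. ereal (1 / t) * ereal_log (norm (x t - 0))) \<le> ereal (- \<eta>)"
      by (rule Limsup_bounded)
    also have "\<dots> < 0" using decay(1) by simp
    finally show ?thesis .
  qed
  ultimately show ?thesis unfolding exp_stable_sol_def by (auto intro!: exI[of _ 1])
qed

theorem theorem3p4:
  fixes p q h0 K \<theta> Ahat Chat Ghat :: real
    and \<omega> h f :: "real \<Rightarrow> real"
    and A C :: "real \<Rightarrow> real^'d^'d"
    and F :: "real \<Rightarrow> real^'d \<Rightarrow> real^'d"
  assumes p: "1 < p" "p < 2"
    and q: "p \<le> q" "1 / p + 1 / q > 1"
    and \<omega>_pvar: "\<And>T. T > 0 \<Longrightarrow> in_Cpvar p \<omega> 0 T"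
    and A_cont: "\<And>T. T > 0 \<Longrightarrow> continuous_on {0..T} A"
    and C_qvar: "\<And>T. T > 0 \<Longrightarrow> in_Cpvar q (\<lambda>t. mat_op (C t)) 0 T"
    and h_nonneg: "\<And>t. t \<ge> 0 \<Longrightarrow> h t \<ge> 0"
    and h_integrable: "\<And>t. t \<ge> 0 \<Longrightarrow> h integrable_on {0..t}"
    and A_diss: "\<And>t x. t \<ge> 0 \<Longrightarrow> x \<bullet> (A t *v x) \<le> - h t * (norm x)\<^sup>2"
    and F_zero: "\<And>t. t \<ge> 0 \<Longrightarrow> F t 0 = 0"
    and f_pos: "\<And>t. t \<ge> 0 \<Longrightarrow> f t > 0"
    and f_cont: "continuous_on {0..} f"
    and F_lipschitz: "\<And>t x y. t \<ge> 0 \<Longrightarrow> norm (F t x - F t y) \<le> f t * norm (x - y)"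
    and A_fin: "limsup_mean (4 * p)
        (\<lambda>k. sup_norm (\<lambda>t. mat_op (A t)) (real k) (real k + 1) + sup_norm f (real k) (real k + 1)) < \<infinity>"
    and Ahat: "Ahat = real_of_ereal (limsup_mean (4 * p)
        (\<lambda>k. sup_norm (\<lambda>t. mat_op (A t)) (real k) (real k + 1) + sup_norm f (real k) (real k + 1)))"
    and C_fin: "limsup_mean (2 * p + 2)
        (\<lambda>k. pvar_norm q (\<lambda>t. mat_op (C t)) (real k) (real k + 1)) < \<infinity>"
    and Chat: "Chat = real_of_ereal (limsup_mean (2 * p + 2)
        (\<lambda>k. pvar_norm q (\<lambda>t. mat_op (C t)) (real k) (real k + 1)))"
    and Gam_fin: "Gam p \<omega> (2 * p + 2) < \<infinity>"
    and h0_pos: "h0 > 0"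
    and h0_liminf: "Liminf at_top (\<lambda>t. ereal (1 / t * integral {0..t} (\<lambda>s. h s - f s))) \<ge> ereal h0"
    and \<theta>: "\<theta> = 1 / p + 1 / q"
    and K: "K = inverse (1 - 2 powr (1 - \<theta>))"
    and Ghat: "Ghat = Max {8 * Ahat, 16 * K * Chat, 8 powr p * Ahat powr p,
                           16 powr p * K powr p * Chat powr p}"
    and main: "h0 > K * (1 + 4 * Ghat) * Chat *
        (real_of_ereal (Gam p \<omega> 2) + (real_of_ereal (Gam p \<omega> 4))\<^sup>2
          + (real_of_ereal (Gam p \<omega> (2 * p + 2))) powr (p + 1))"
  shows "exp_stable_sol {x. \<exists>x0. yde_solution q \<omega> A C F x0 x} (\<lambda>_. 0)"
proof -
  define S where "S = {x. \<exists>x0. yde_solution q \<omega> A C F x0 x}"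
  define a where "a k = sup_norm (\<lambda>t. mat_op (A t)) (real k) (real k + 1) + sup_norm f (real k) (real k + 1)" for k
  define c where "c k = pvar_norm q (\<lambda>t. mat_op (C t)) (real k) (real k + 1)" for k
  define w where "w k = pvar_seminorm p \<omega> (real k) (real k + 1)" for k
  define B where "B k = unit_growth K p (a k) (c k) (w k)" for k
  define g where "g t = integral {0..t} (\<lambda>r. f r - h r) + (\<Sum>k\<le>nat \<lfloor>t\<rfloor>. B k)" for t
  have q0: "0 < q" using p q by simp
  have KY: "K = young_const p q" by (simp add: K \<theta> young_const_def)
  have K0: "0 \<le> K" using young_const_ge_1[OF q(2)] by (simp add: KY)
  have yde: "yde_path p q \<omega> h f A C F x0 x" if "yde_solution q \<omega> A C F x0 x" for x0 x
    by unfold_locales (fact p q \<omega>_pvar A_cont C_qvar h_nonneg h_integrable A_diss F_zero f_pos f_cont F_lipschitz that)+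
  have zero_sol: "yde_solution q \<omega> A C F 0 (\<lambda>_. 0)" by (rule yde_solution_zero) (use q0 F_zero in auto)
  \<comment> \<open>The zero solution gives access to the locale facts that concern only the
    coefficients.\<close>
  interpret Z: yde_path p q \<omega> h f A C F 0 "\<lambda>_. 0" by (rule yde[OF zero_sol])
  have nn: "0 \<le> a k" "0 \<le> c k" "0 \<le> w k" for k
    using Z.coeff_boundD(3,4)[OF Z.coeff_bound_norms[of "real k" "real k + 1"]] by (auto simp: a_def c_def w_def)
  have B0: "0 \<le> B k" for k
    using nn[of k] K0 unfolding B_def unit_growth_def by (intro mult_nonneg_nonneg add_nonneg_nonneg) auto
  have fin: "limsup_mean (4 * p) a < \<infinity>" "limsup_mean (2 * p + 2) c < \<infinity>" "limsup_mean (2 * p + 2) w < \<infinity>"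
    using A_fin C_fin Gam_fin by (simp_all add: a_def[abs_def] c_def[abs_def] w_def[abs_def] Gam_def)
  have hat: "Ahat = real_of_ereal (limsup_mean (4 * p) a)" "Chat = real_of_ereal (limsup_mean (2 * p + 2) c)"
    "\<And>r. Gam p \<omega> r = limsup_mean r w"
    using Ahat Chat by (simp_all add: a_def[abs_def] c_def[abs_def] w_def[abs_def] Gam_def)
  have nn_hat: "0 \<le> Ahat" "0 \<le> Chat" "0 \<le> real_of_ereal (limsup_mean 2 w)"
    using eventually_power_mean_less(2)[where \<eta> = 1] fin limsup_mean_finite_mono[OF _ _ fin(3), of 2] p
    by (auto simp: hat)
  have "mean_growth K p Ahat Chat (real_of_ereal (limsup_mean 2 w)) (real_of_ereal (limsup_mean 4 w))
      (real_of_ereal (limsup_mean (2 * p + 2) w)) < h0"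
    by (rule le_less_trans[OF mean_growth_le[where G = Ghat] main[unfolded hat(3)]])
      (use K0 nn_hat in \<open>auto simp: Ghat\<close>)
  then obtain \<beta> where \<beta>: "mean_growth K p Ahat Chat (real_of_ereal (limsup_mean 2 w)) (real_of_ereal (limsup_mean 4 w))
      (real_of_ereal (limsup_mean (2 * p + 2) w)) < \<beta>" "\<beta> < h0"
    using dense by blast
  have sumB: "\<forall>\<^sub>F m in sequentially. (\<Sum>k\<le>m. B k) \<le> \<beta> * (real m + 1)"
    unfolding B_def using \<beta>(1) by (intro eventually_mean_unit_growth_le p K0 nn fin) (simp add: hat)
  \<comment> \<open>The sign allows \<open>nat \<lfloor>t\<rfloor> + 1\<close> to be replaced by
    \<open>t + 1\<close> in the decay estimate.\<close>
  have \<beta>0: "0 \<le> \<beta>"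
  proof -
    obtain m where m: "(\<Sum>k\<le>m. B k) \<le> \<beta> * (real m + 1)"
      using eventually_happens'[OF _ sumB] by auto
    have "0 \<le> (\<Sum>k\<le>m. B k)" by (intro sum_nonneg B0)
    with m have "0 \<le> \<beta> * (real m + 1)" by linarith
    then show ?thesis by (simp add: zero_le_mult_iff)
  qed
  \<comment> \<open>A third of the gap is spent on getting strictly below the lower limit of the
    averaged integral; \<open>h0 - \<eta> - \<beta> = 2 * \<eta>\<close> remains.\<close>
  define \<eta> where "\<eta> = (h0 - \<beta>) / 3"
  have \<eta>: "0 < \<eta>" using \<beta>(2) by (simp add: \<eta>_def)
  have "ereal (h0 - \<eta>) < Liminf at_top (\<lambda>t. ereal (1 / t * integral {0..t} (\<lambda>s. h s - f s)))"
    by (rule less_le_trans[OF _ h0_liminf]) (use \<eta> in simp)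
  then have intE: "\<forall>\<^sub>F t in at_top. h0 - \<eta> < 1 / t * integral {0..t} (\<lambda>s. h s - f s)"
    using less_LiminfD by force
  have floor_top: "filterlim (\<lambda>t::real. nat \<lfloor>t\<rfloor>) sequentially at_top"
    by (intro filterlim_compose[OF filterlim_nat_sequentially] filterlim_floor_sequentially)
  have neg: "integral {0..t} (\<lambda>r. f r - h r) = - integral {0..t} (\<lambda>s. h s - f s)" for t
    using integral_neg[of "{0..t}" "\<lambda>s. h s - f s"] by simp
  have decay: "\<forall>\<^sub>F t in at_top. g t \<le> \<beta> - 2 * \<eta> * t"
    using intE eventually_compose_filterlim[OF sumB floor_top] eventually_gt_at_top[of 0]
  proof eventually_elim
    case (elim t)
    have "(h0 - \<eta>) * t < integral {0..t} (\<lambda>s. h s - f s)" using elim(1,3) by (simp add: field_simps)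
    moreover have "\<beta> * (real (nat \<lfloor>t\<rfloor>) + 1) \<le> \<beta> * (t + 1)"
      using \<beta>0 elim(3) by (intro mult_left_mono) auto
    ultimately have "g t \<le> - ((h0 - \<eta>) * t) + \<beta> * (t + 1)" using elim(2) neg[of t] by (simp add: g_def)
    also have "\<dots> = \<beta> - 2 * \<eta> * t" by (simp add: \<eta>_def field_simps)
    finally show ?case .
  qed
  \<comment> \<open>The decay holds only for large times; boundedness on the initial stretch
    supplies the constant for stability.\<close>
  have bdd: "bdd_above (g ` {0..T})" if T: "0 \<le> T" for T
  proof -
    have "continuous_on {0..T} (\<lambda>t. integral {0..t} (\<lambda>r. f r - h r))"
      using Z.hf_integrable[OF _ T] by (intro indefinite_integral_continuous_1) simp
    then have "bdd_above ((\<lambda>t. integral {0..t} (\<lambda>r. f r - h r)) ` {0..T})"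
      by (intro bounded_imp_bdd_above compact_imp_bounded compact_continuous_image) auto
    then obtain D where D: "\<And>t. t \<in> {0..T} \<Longrightarrow> integral {0..t} (\<lambda>r. f r - h r) \<le> D"
      by (force simp: bdd_above_def)
    have "g t \<le> D + (\<Sum>k\<le>nat \<lfloor>T\<rfloor>. B k)" if "t \<in> {0..T}" for t
    proof -
      have "nat \<lfloor>t\<rfloor> \<le> nat \<lfloor>T\<rfloor>" using that by (intro nat_mono floor_mono) auto
      then have "(\<Sum>k\<le>nat \<lfloor>t\<rfloor>. B k) \<le> (\<Sum>k\<le>nat \<lfloor>T\<rfloor>. B k)" by (intro sum_mono2 B0) auto
      then show ?thesis using D[OF that] by (simp add: g_def)
    qed
    then show ?thesis by (rule bdd_aboveI2)
  qed
  have "exp_stable_sol S (\<lambda>_. 0)"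
  proof (rule exp_stable_of_ln_bound[OF _ _ _ bdd \<eta> decay])
    show "(\<lambda>_. 0) \<in> S" using zero_sol by (auto simp: S_def)
    fix x and t :: real assume x: "x \<in> S" and t: "0 \<le> t"
    then obtain x0 where "yde_solution q \<omega> A C F x0 x" by (auto simp: S_def)
    then interpret X: yde_path p q \<omega> h f A C F x0 x by (rule yde)
    show "x t = 0" if "x 0 = 0" using X.solution_zero[OF that t] .
    show "x t \<noteq> 0 \<and> ln (norm (x t)) \<le> ln (norm (x 0)) + g t" if "x 0 \<noteq> 0"
      using X.solution_nonzero[OF that t] X.ln_norm_solution_le[OF that t]
      by (simp add: g_def B_def a_def c_def w_def KY)
  qed
  then show ?thesis by (simp add: S_def)
qed

end
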